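(* Let $(f_n)$ be a sequence of complex rational maps of degree $d\ge2$. The number of non-trivial scales $\varepsilon<(1)$ for which there exists a $g$-rescaling $(M,\varepsilon)$ adapted to some iterate $(f_n^l)$, $l\in\mathbb N_{\ge1}$, is at most $2d-2$. In particular the total number of scales of $g$-rescalings adapted to iterates of $f$ is at most $2d-1$.
   Context: Fix a non-principal ultrafilter $\omega$ on $\mathbb N$; $\lim$ denotes the limit along $\omega$. A scale is an equivalence class of bounded sequences of positive reals, $(\varepsilon_n)\sim(\eta_n)$ iff $\lim\varepsilon_n/\eta_n\in(0,\infty)$, totally ordered by $\varepsilon\le\eta$ iff $\lim \varepsilon_n/\eta_n<\infty$ ($\varepsilon<\eta$ iff the limit is $0$), with maximum the trivial scale $(1)$. For a scale $\varepsilon$, $\mathscr H_\varepsilon$ is the quotient of $\{(z_n)\in\mathbb C^{\mathbb N}:\lim|z_n|^{\varepsilon_n}<\infty\}$ by $\{(z_n):\lim|z_n|^{\varepsilon_n}=0\}$ with norm $\lim|z_n|^{\min(1,\varepsilon_n)}$; $\mathscr H_{(1)}\cong\mathbb C$, and for $\varepsilon<(1)$ it is an algebraically closed complete non-Archimedean field with residue field $\widetilde{\mathscr H}_\varepsilon$ of characteristic $0$. Limits: for a sequence $(g_n)$ of complex rational maps of degree $d$, write $g_n=[P_n:Q_n]$ with coefficients of maximal modulus $1$; the coefficient sequences give $P_\varepsilon,Q_\varepsilon$ over $\mathscr H_\varepsilon$; dividing by their gcd gives the limit $g_\varepsilon$. $M\cdot f\cdot M^{-1}=(M_n\circ f_n\circ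 M_n^{-1})$. Over a non-Archimedean field, $g$ has good reduction iff $|\mathrm{Res}(g)|=|\mathrm{Res}(P,Q)|/\max(|\text{coefficients}|)^{2d}=1$; potential good reduction iff conjugate over the field to a map with good reduction; by convention a map over $\mathbb C$ never has potential good reduction. For $\varepsilon<(1)$, $x_g$ is the Gauss point; directions at $x_g$ are identified with $\mathbb P^1(\widetilde{\mathscr H}_\varepsilon)$; a direction $v$ at a fixed point $x$ of $G$ is bad if its open component meets $G^{-1}(x)$; for $\varepsilon<\eta$ the canonical map $\mathbb P^1(\widetilde{\mathscr H}_\varepsilon)\to\mathbb P^1(\mathscr H_\eta)$ sends a point with homogeneous coordinates given by complex sequences of modulus $\le1$ (one of modulus $1$) to the point with the same coordinate sequences. A $g$-rescaling is a pair $(M,\eta)$ of a sequence of complex Möbius transformations and a scale. It is adapted to a sequence $h$ of complex rational maps if: (A1) $(M\cdot h\cdot M^{-1})_\eta$ has degree $\delta\ge1$; (A2) if $\eta<(1)$ it does not have potential good reduction; (A3) if $\delta=1$, there is a scale $\varepsilon<\eta$ such that $(M\cdot h\cdot M^{-1})_\varepsilon$ fixes $x_g$ with local degree $1$ and a bad direction $v$ at $x_g$ whose image in $\mathbb P^1(\mathscr H_\eta)$ has infinite orbit under $(M\cdot h\cdot M^{-1})_\eta$. *)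

theory Defs
  imports "HOL-Computational_Algebra.Polynomial" "HOL-Library.Extended_Real"
          "Subresultants.Resultant_Prelim"
begin

definition nonprincipal_ultrafilter :: "nat filter \<Rightarrow> bool" where
  "nonprincipal_ultrafilter F \<longleftrightarrow> F \<noteq> bot \<and> F \<le> cofinite \<and>
     (\<forall>A. eventually (\<lambda>n. n \<in> A) F \<or> eventually (\<lambda>n. n \<notin> A) F)"

definition wlim :: "nat filter \<Rightarrow> (nat \<Rightarrow> real) \<Rightarrow> ereal" where
  "wlim F x = Lim F (\<lambda>n. ereal (x n))"

definition scale :: "(nat \<Rightarrow> real) \<Rightarrow> bool" where
  "scale e \<longleftrightarrow> (\<forall>n. 0 < e n) \<and> bdd_above (range e)"

definition scale_le :: "nat filter \<Rightarrow> (nat \<Rightarrow> real) \<Rightarrow> (nat \<Rightarrow> real) \<Rightarrow> bool" where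
  "scale_le F e h \<longleftrightarrow> wlim F (\<lambda>n. e n / h n) < \<infinity>"

definition scale_less :: "nat filter \<Rightarrow> (nat \<Rightarrow> real) \<Rightarrow> (nat \<Rightarrow> real) \<Rightarrow> bool" where
  "scale_less F e h \<longleftrightarrow> wlim F (\<lambda>n. e n / h n) = 0"

definition scale_equiv :: "nat filter \<Rightarrow> (nat \<Rightarrow> real) \<Rightarrow> (nat \<Rightarrow> real) \<Rightarrow> bool" where
  "scale_equiv F e h \<longleftrightarrow> 0 < wlim F (\<lambda>n. e n / h n) \<and> wlim F (\<lambda>n. e n / h n) < \<infinity>"

definition one_scale :: "nat \<Rightarrow> real" where "one_scale = (\<lambda>_. 1)"

section \<open>The fields H_eps and their residue fields, on representing sequences\<close>

definition Hdom :: "nat filter \<Rightarrow> (nat \<Rightarrow> real) \<Rightarrow> (nat \<Rightarrow> complex) \<Rightarrow> bool" where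
  "Hdom F e z \<longleftrightarrow> wlim F (\<lambda>n. cmod (z n) powr e n) < \<infinity>"

definition Hzero :: "nat filter \<Rightarrow> (nat \<Rightarrow> real) \<Rightarrow> (nat \<Rightarrow> complex) \<Rightarrow> bool" where
  "Hzero F e z \<longleftrightarrow> wlim F (\<lambda>n. cmod (z n) powr e n) = 0"

definition Hnorm :: "nat filter \<Rightarrow> (nat \<Rightarrow> real) \<Rightarrow> (nat \<Rightarrow> complex) \<Rightarrow> ereal" where
  "Hnorm F e z = wlim F (\<lambda>n. cmod (z n) powr min 1 (e n))"

text \<open>residue field: valuation ring {|z| \<le> 1} modulo maximal ideal {|z| < 1}\<close>
definition Rdom :: "nat filter \<Rightarrow> (nat \<Rightarrow> real) \<Rightarrow> (nat \<Rightarrow> complex) \<Rightarrow> bool" where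
  "Rdom F e z \<longleftrightarrow> Hnorm F e z \<le> 1"

definition Rzero :: "nat filter \<Rightarrow> (nat \<Rightarrow> real) \<Rightarrow> (nat \<Rightarrow> complex) \<Rightarrow> bool" where
  "Rzero F e z \<longleftrightarrow> Hnorm F e z < 1"

text \<open>A sequence p of complex polynomials with declared degree k represents the
  homogeneous form of degree k whose coefficient sequences are the coeff (p n) i
  (the form being Y^k p(X/Y)). D is the domain predicate, Z the zero predicate.\<close>

definition form :: "((nat \<Rightarrow> complex) \<Rightarrow> bool) \<Rightarrow> nat \<Rightarrow> (nat \<Rightarrow> complex poly) \<Rightarrow> bool" where
  "form D k p \<longleftrightarrow> (\<forall>n. degree (p n) \<le> k) \<and> (\<forall>i. D (\<lambda>n. coeff (p n) i))"

definition feq :: "((nat \<Rightarrow> complex) \<Rightarrow> bool) \<Rightarrow> nat \<Rightarrow> (nat \<Rightarrow> complex poly) \<Rightarrow> (nat \<Rightarrow> complex poly) \<Rightarrow> bool" where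
  "feq Z k p q \<longleftrightarrow> (\<forall>i\<le>k. Z (\<lambda>n. coeff (p n) i - coeff (q n) i))"

definition fzero :: "((nat \<Rightarrow> complex) \<Rightarrow> bool) \<Rightarrow> nat \<Rightarrow> (nat \<Rightarrow> complex poly) \<Rightarrow> bool" where
  "fzero Z k p \<longleftrightarrow> feq Z k p (\<lambda>_. 0)"

definition fdvd :: "((nat \<Rightarrow> complex) \<Rightarrow> bool) \<Rightarrow> ((nat \<Rightarrow> complex) \<Rightarrow> bool) \<Rightarrow> nat \<Rightarrow> nat
     \<Rightarrow> (nat \<Rightarrow> complex poly) \<Rightarrow> (nat \<Rightarrow> complex poly) \<Rightarrow> bool" where
  "fdvd D Z j k c a \<longleftrightarrow> j \<le> k \<and> (\<exists>a'. form D (k - j) a' \<and> feq Z k a (\<lambda>n. c n * a' n))"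

definition fcoprime :: "((nat \<Rightarrow> complex) \<Rightarrow> bool) \<Rightarrow> ((nat \<Rightarrow> complex) \<Rightarrow> bool) \<Rightarrow> nat
     \<Rightarrow> (nat \<Rightarrow> complex poly) \<Rightarrow> (nat \<Rightarrow> complex poly) \<Rightarrow> bool" where
  "fcoprime D Z k a b \<longleftrightarrow>
     (\<forall>j c. form D j c \<and> \<not> fzero Z j c \<and> fdvd D Z j k c a \<and> fdvd D Z j k c b \<longrightarrow> j = 0)"

definition reduced_pair :: "((nat \<Rightarrow> complex) \<Rightarrow> bool) \<Rightarrow> ((nat \<Rightarrow> complex) \<Rightarrow> bool) \<Rightarrow> nat
     \<Rightarrow> (nat \<Rightarrow> complex poly) \<Rightarrow> (nat \<Rightarrow> complex poly) \<Rightarrow> nat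
     \<Rightarrow> (nat \<Rightarrow> complex poly) \<Rightarrow> (nat \<Rightarrow> complex poly) \<Rightarrow> bool" where
  "reduced_pair D Z K P Q k A B \<longleftrightarrow> k \<le> K \<and> form D k A \<and> form D k B \<and>
     (\<exists>C. form D (K - k) C \<and> \<not> fzero Z (K - k) C \<and>
          feq Z K P (\<lambda>n. C n * A n) \<and> feq Z K Q (\<lambda>n. C n * B n)) \<and>
     fcoprime D Z k A B"

text \<open>(p,q) with declared degree d is the map [P:Q] with P(X,Y) = Y^d p(X/Y) etc.\<close>
definition ratmap :: "nat \<Rightarrow> complex poly \<times> complex poly \<Rightarrow> bool" where
  "ratmap d g \<longleftrightarrow> coprime (fst g) (snd g) \<and> max (degree (fst g)) (degree (snd g)) = d"

definition hsubst :: "nat \<Rightarrow> complex poly \<Rightarrow> complex poly \<Rightarrow> complex poly \<Rightarrow> complex poly" where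
  "hsubst k h a b = (\<Sum>i\<le>k. smult (coeff h i) (a ^ i * b ^ (k - i)))"

definition hcomp :: "nat \<Rightarrow> complex poly \<times> complex poly \<Rightarrow> complex poly \<times> complex poly
     \<Rightarrow> complex poly \<times> complex poly" where
  "hcomp k f g = (hsubst k (fst f) (fst g) (snd g), hsubst k (snd f) (fst g) (snd g))"

fun hiter :: "nat \<Rightarrow> complex poly \<times> complex poly \<Rightarrow> nat \<Rightarrow> complex poly \<times> complex poly" where
  "hiter d f 0 = ([:0, 1:], [:1:])"
| "hiter d f (Suc l) = hcomp d f (hiter d f l)"

type_synonym mobius = "complex \<times> complex \<times> complex \<times> complex"

definition mob_det :: "mobius \<Rightarrow> complex" where
  "mob_det M = (case M of (a, b, c, d) \<Rightarrow> a * d - b * c)"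

definition mob :: "mobius \<Rightarrow> complex poly \<times> complex poly" where
  "mob M = (case M of (a, b, c, d) \<Rightarrow> ([:b, a:], [:d, c:]))"

definition mob_inv :: "mobius \<Rightarrow> complex poly \<times> complex poly" where
  "mob_inv M = (case M of (a, b, c, d) \<Rightarrow> ([:- b, d:], [:a, - c:]))"

definition conj :: "nat \<Rightarrow> mobius \<Rightarrow> complex poly \<times> complex poly \<Rightarrow> complex poly \<times> complex poly" where
  "conj k M g = hcomp 1 (mob M) (hcomp k g (mob_inv M))"

definition maxcoef :: "nat \<Rightarrow> complex poly \<times> complex poly \<Rightarrow> real" where
  "maxcoef k g = Max ((\<lambda>i. cmod (coeff (fst g) i)) ` {..k} \<union> (\<lambda>i. cmod (coeff (snd g) i)) ` {..k})"

definition normalize_pair :: "nat \<Rightarrow> complex poly \<times> complex poly \<Rightarrow> complex poly \<times> complex poly" where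
  "normalize_pair k g = (smult (complex_of_real (1 / maxcoef k g)) (fst g),
                         smult (complex_of_real (1 / maxcoef k g)) (snd g))"

text \<open>lim_rep F e K g k A B: the limit g_e of the sequence g of maps of degree K has
  degree k and is represented (over H_e) by the coprime pair of forms (A,B)\<close>
definition lim_rep :: "nat filter \<Rightarrow> (nat \<Rightarrow> real) \<Rightarrow> nat \<Rightarrow> (nat \<Rightarrow> complex poly \<times> complex poly)
     \<Rightarrow> nat \<Rightarrow> (nat \<Rightarrow> complex poly) \<Rightarrow> (nat \<Rightarrow> complex poly) \<Rightarrow> bool" where
  "lim_rep F e K g k A B \<longleftrightarrow>
     reduced_pair (Hdom F e) (Hzero F e) K (\<lambda>n. fst (normalize_pair K (g n)))
        (\<lambda>n. snd (normalize_pair K (g n))) k A B"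

definition hres :: "nat \<Rightarrow> complex poly \<times> complex poly \<Rightarrow> complex" where
  "hres k g = det (sylvester_mat_sub k k (fst g) (snd g))"

definition good_reduction :: "nat filter \<Rightarrow> (nat \<Rightarrow> real) \<Rightarrow> nat \<Rightarrow> (nat \<Rightarrow> complex poly \<times> complex poly) \<Rightarrow> bool" where
  "good_reduction F e k G \<longleftrightarrow>
     0 < Hnorm F e (\<lambda>n. complex_of_real (maxcoef k (G n))) \<and>
     Hnorm F e (\<lambda>n. complex_of_real (maxcoef k (G n))) < \<infinity> \<and>
     Hnorm F e (\<lambda>n. hres k (G n)) = Hnorm F e (\<lambda>n. complex_of_real (maxcoef k (G n))) ^ (2 * k)"

definition pot_good_reduction :: "nat filter \<Rightarrow> (nat \<Rightarrow> real) \<Rightarrow> nat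
     \<Rightarrow> (nat \<Rightarrow> complex poly) \<Rightarrow> (nat \<Rightarrow> complex poly) \<Rightarrow> bool" where
  "pot_good_reduction F e k A B \<longleftrightarrow>
     (\<exists>N :: nat \<Rightarrow> mobius.
        Hdom F e (\<lambda>n. fst (N n)) \<and> Hdom F e (\<lambda>n. fst (snd (N n))) \<and>
        Hdom F e (\<lambda>n. fst (snd (snd (N n)))) \<and> Hdom F e (\<lambda>n. snd (snd (snd (N n)))) \<and>
        \<not> Hzero F e (\<lambda>n. mob_det (N n)) \<and>
        good_reduction F e k (\<lambda>n. conj k (N n) (A n, B n)))"

definition Kpoly :: "nat filter \<Rightarrow> (nat \<Rightarrow> real) \<Rightarrow> (nat \<Rightarrow> complex poly) \<Rightarrow> bool" where
  "Kpoly F e h \<longleftrightarrow> (\<exists>m. form (Hdom F e) m h)"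

definition berk_point :: "nat filter \<Rightarrow> (nat \<Rightarrow> real) \<Rightarrow> ((nat \<Rightarrow> complex poly) \<Rightarrow> real) \<Rightarrow> bool" where
  "berk_point F e z \<longleftrightarrow>
     (\<forall>m h h'. form (Hdom F e) m h \<and> form (Hdom F e) m h' \<and> feq (Hzero F e) m h h' \<longrightarrow> z h = z h') \<and>
     (\<forall>h. Kpoly F e h \<longrightarrow> 0 \<le> z h) \<and>
     (\<forall>h h'. Kpoly F e h \<and> Kpoly F e h' \<longrightarrow> z (\<lambda>n. h n * h' n) = z h * z h') \<and>
     (\<forall>h h'. Kpoly F e h \<and> Kpoly F e h' \<longrightarrow> z (\<lambda>n. h n + h' n) \<le> z h + z h') \<and>
     (\<forall>c. Hdom F e c \<longrightarrow> z (\<lambda>n. [:c n:]) = real_of_ereal (Hnorm F e c))"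

definition gauss :: "nat filter \<Rightarrow> (nat \<Rightarrow> real) \<Rightarrow> (nat \<Rightarrow> complex poly) \<Rightarrow> real" where
  "gauss F e h = real_of_ereal (SUP i. Hnorm F e (\<lambda>n. coeff (h n) i))"

text \<open>the map given by the forms (A,B) of degree k sends the point z to x_g:
  z(h \<circ> G) = x_g(h), where h \<circ> G = (\<Sum> h_i A^i B^(m-i)) / B^m\<close>
definition maps_to_gauss :: "nat filter \<Rightarrow> (nat \<Rightarrow> real) \<Rightarrow> nat \<Rightarrow> (nat \<Rightarrow> complex poly)
     \<Rightarrow> (nat \<Rightarrow> complex poly) \<Rightarrow> ((nat \<Rightarrow> complex poly) \<Rightarrow> real) \<Rightarrow> bool" where
  "maps_to_gauss F e k A B z \<longleftrightarrow> z B \<noteq> 0 \<and>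
     (\<forall>m h. form (Hdom F e) m h \<longrightarrow>
        z (\<lambda>n. hsubst m (h n) (A n) (B n)) / z B ^ m = gauss F e h)"

definition fixes_gauss :: "nat filter \<Rightarrow> (nat \<Rightarrow> real) \<Rightarrow> nat \<Rightarrow> (nat \<Rightarrow> complex poly)
     \<Rightarrow> (nat \<Rightarrow> complex poly) \<Rightarrow> bool" where
  "fixes_gauss F e k A B \<longleftrightarrow> maps_to_gauss F e k A B (gauss F e)"

text \<open>a direction at x_g, i.e. a point of P^1 of the residue field, given by coordinate
  sequences of modulus \<le> 1, one of them of modulus 1\<close>
definition dir_rep :: "(nat \<Rightarrow> complex) \<Rightarrow> (nat \<Rightarrow> complex) \<Rightarrow> bool" where
  "dir_rep a0 a1 \<longleftrightarrow> (\<forall>n. cmod (a0 n) \<le> 1 \<and> cmod (a1 n) \<le> 1 \<and> max (cmod (a0 n)) (cmod (a1 n)) = 1)"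

text \<open>the point z (of the Berkovich affine line) lies in the open component of
  P^1 \ {x_g} corresponding to the direction [a0:a1]: the open residue disc
  {z(T - a0/a1) < 1} if [a0:a1] is finite, {z(T) > 1} if it is \<infinity>\<close>
definition in_dir :: "nat filter \<Rightarrow> (nat \<Rightarrow> real) \<Rightarrow> (nat \<Rightarrow> complex) \<Rightarrow> (nat \<Rightarrow> complex)
     \<Rightarrow> ((nat \<Rightarrow> complex poly) \<Rightarrow> real) \<Rightarrow> bool" where
  "in_dir F e a0 a1 z \<longleftrightarrow>
     (if Rzero F e a1 then 1 < z (\<lambda>n. [:0, 1:])
      else z (\<lambda>n. [:- (a0 n / a1 n), 1:]) < 1)"

text \<open>the direction is bad: its open component meets G^{-1}(x_g)
  (the point \<infinity>, being of type I, never maps to x_g)\<close>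
definition bad_dir :: "nat filter \<Rightarrow> (nat \<Rightarrow> real) \<Rightarrow> nat \<Rightarrow> (nat \<Rightarrow> complex poly)
     \<Rightarrow> (nat \<Rightarrow> complex poly) \<Rightarrow> (nat \<Rightarrow> complex) \<Rightarrow> (nat \<Rightarrow> complex) \<Rightarrow> bool" where
  "bad_dir F e k A B a0 a1 \<longleftrightarrow>
     (\<exists>z. berk_point F e z \<and> in_dir F e a0 a1 z \<and> maps_to_gauss F e k A B z)"

text \<open>local degree of G (fixing x_g) at x_g: the degree of its reduction, i.e. of the
  reduction of the normalised pair after removing the common factor over the residue field\<close>
definition local_degree_gauss :: "nat filter \<Rightarrow> (nat \<Rightarrow> real) \<Rightarrow> nat \<Rightarrow> (nat \<Rightarrow> complex poly)
     \<Rightarrow> (nat \<Rightarrow> complex poly) \<Rightarrow> nat \<Rightarrow> bool" where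
  "local_degree_gauss F e k A B r \<longleftrightarrow>
     (\<exists>A1 B1. reduced_pair (Rdom F e) (Rzero F e) k
         (\<lambda>n. fst (normalize_pair k (A n, B n))) (\<lambda>n. snd (normalize_pair k (A n, B n))) r A1 B1)"

definition happ :: "nat \<Rightarrow> (nat \<Rightarrow> complex poly) \<Rightarrow> (nat \<Rightarrow> complex poly)
     \<Rightarrow> (nat \<Rightarrow> complex) \<times> (nat \<Rightarrow> complex) \<Rightarrow> (nat \<Rightarrow> complex) \<times> (nat \<Rightarrow> complex)" where
  "happ k A B x = ((\<lambda>n. \<Sum>i\<le>k. coeff (A n) i * fst x n ^ i * snd x n ^ (k - i)),
                   (\<lambda>n. \<Sum>i\<le>k. coeff (B n) i * fst x n ^ i * snd x n ^ (k - i)))"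

definition peq :: "nat filter \<Rightarrow> (nat \<Rightarrow> real) \<Rightarrow> (nat \<Rightarrow> complex) \<times> (nat \<Rightarrow> complex)
     \<Rightarrow> (nat \<Rightarrow> complex) \<times> (nat \<Rightarrow> complex) \<Rightarrow> bool" where
  "peq F e x y \<longleftrightarrow> Hzero F e (\<lambda>n. fst x n * snd y n - snd x n * fst y n)"

definition infinite_orbit :: "nat filter \<Rightarrow> (nat \<Rightarrow> real) \<Rightarrow> nat \<Rightarrow> (nat \<Rightarrow> complex poly)
     \<Rightarrow> (nat \<Rightarrow> complex poly) \<Rightarrow> (nat \<Rightarrow> complex) \<times> (nat \<Rightarrow> complex) \<Rightarrow> bool" where
  "infinite_orbit F e k A B x \<longleftrightarrow>
     infinite (range (\<lambda>j. {y. peq F e ((happ k A B ^^ j) x) y}))"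

definition adapted :: "nat filter \<Rightarrow> nat \<Rightarrow> (nat \<Rightarrow> complex poly \<times> complex poly)
     \<Rightarrow> (nat \<Rightarrow> mobius) \<Rightarrow> (nat \<Rightarrow> real) \<Rightarrow> bool" where
  "adapted F K h M eta \<longleftrightarrow>
     (\<forall>n. mob_det (M n) \<noteq> 0) \<and>
     (let g = (\<lambda>n. conj K (M n) (h n)) in
      \<exists>k A B. lim_rep F eta K g k A B \<and> 1 \<le> k \<and>
        (scale_less F eta one_scale \<longrightarrow> \<not> pot_good_reduction F eta k A B) \<and>
        (k = 1 \<longrightarrow>
          (\<exists>e. scale e \<and> scale_less F e eta \<and>
             (\<exists>k' A' B'. lim_rep F e K g k' A' B' \<and>
                fixes_gauss F e k' A' B' \<and> local_degree_gauss F e k' A' B' 1 \<and>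
                (\<exists>a0 a1. dir_rep a0 a1 \<and> bad_dir F e k' A' B' a0 a1 \<and>
                   infinite_orbit F eta k A B (a0, a1))))))"

end

theory Submission
  imports Defs "HOL-Computational_Algebra.Fundamental_Theorem_Algebra" "Jordan_Normal_Form.Char_Poly"
begin

text \<open>After conjugating each \<open>f\<^sub>n\<close> so that three of its distinguished points (fixed points or
  preimages) are \<open>\<infinity>\<close>, \<open>0\<close>, \<open>1\<close>, the coefficients depend on \<open>2d - 2\<close> parameters. Let \<open>L\<close> be the relative
  algebraic closure, in the ultrapower of \<open>\<complex>\<close>, of the field generated over \<open>\<complex>\<close> by the sequences of these
  parameters. A scale \<open>\<eta>\<close> induces an absolute value on \<open>L\<close> (with value \<open>\<infinity>\<close> allowed).

  Suppose that it only takes the values \<open>0\<close>, \<open>1\<close>, \<open>\<infinity>\<close>. The limit of an iterate at a rescaling of scale \<open>\<eta>\<close>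
  then has three points in distinct directions that come from points of \<open>P\<^sup>1(L)\<close>: fixed points and
  their preimages. Moving them to \<open>\<infinity>\<close>, \<open>0\<close>, \<open>1\<close> conjugates the limit to a map whose coefficients are
  ratios of reductions of elements of \<open>L\<close>, hence lie in a trivially valued subfield, so the resultant has norm
  \<open>1\<close>. Thus the limit has potential good reduction, against (A2). In degree one at most two fixed points
  are available, and the same argument is applied to the Jordan form.

  So every non-trivial adapted scale gives an element of \<open>L\<close>, and then an element of the field generated by
  the parameters, whose norm is not \<open>0\<close>, \<open>1\<close>, \<open>\<infinity>\<close>. Elements obtained from inequivalent scales are
  algebraically independent, because their monomials have incomparable moduli; hence there are
  at most \<open>2d - 2\<close> of them.\<close>

section \<open>Binary forms\<close>

text \<open>A rescaling conjugates by arbitrary Moebius maps \<open>W n\<close>, so neither its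
  coefficients nor those of its limit need come from L. What survives: fixed points of the limit and
  their preimages pull back to points over L, and three points determine a coordinate. In it all
  coefficients are elements of L times one common factor, which ratios eliminate. Two points leave a
  diagonal freedom, hence the separate treatment of degree one.

  Three points exist in degree k \<ge> 2 since there are k + 1 \<ge> 3 fixed points with
  multiplicity; a double one is not totally invariant, which gives a chain of preimages r -> q -> p.
  This is used over H for the limit and over the complex numbers for the normal form.

  The bound: 2d + 2 coefficients minus three linear conditions leave 2d - 1, and homogeneity removes
  one more. Elements of L lead back to the parameters because two terms of an algebraic equation
  must be comparable, so a power of the element has the size of a ratio of coefficients up to
  bounded factors, which a scale tending to 0 does not see.\<close>

definition hev :: "nat \<Rightarrow> 'a::comm_semiring_1 poly \<Rightarrow> 'a \<times> 'a \<Rightarrow> 'a" where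
  "hev k p v = (\<Sum>i\<le>k. coeff p i * fst v ^ i * snd v ^ (k - i))"

definition hev2 :: "nat \<Rightarrow> 'a::comm_semiring_1 poly \<times> 'a poly \<Rightarrow> 'a \<times> 'a \<Rightarrow> 'a \<times> 'a" where
  "hev2 k g v = (hev k (fst g) v, hev k (snd g) v)"

text \<open>Points of the projective line are kept as homogeneous vectors, so that \<infinity> is no
  special case; over a field, two non-zero vectors are the same point iff their wedge
  vanishes.\<close>

definition wedge :: "'a::comm_ring_1 \<times> 'a \<Rightarrow> 'a \<times> 'a \<Rightarrow> 'a" where
  "wedge v w = fst v * snd w - snd v * fst w"

text \<open>The linear form whose zero is the point \<open>v\<close>: its value at \<open>w\<close>
  is \<open>wedge w v\<close>.\<close>

definition lin :: "'a::comm_ring_1 \<times> 'a \<Rightarrow> 'a poly" where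
  "lin v = [:- fst v, snd v:]"

definition cmul :: "'a::comm_ring_1 \<Rightarrow> 'a \<times> 'a \<Rightarrow> 'a \<times> 'a" where
  "cmul c v = (c * fst v, c * snd v)"

lemma hev_zero [simp]: "hev k 0 v = 0"
  by (simp add: hev_def)

lemma hev_add: "hev k (p + q) v = hev k p v + hev k q v"
  by (simp add: hev_def sum.distrib algebra_simps)

lemma hev_diff: "hev k (p - q) v = hev k p v - hev k (q :: 'a :: comm_ring_1 poly) v"
  by (simp add: hev_def sum_subtractf algebra_simps)

lemma hev_smult: "hev k (smult c p) v = c * hev k p v"
  by (simp add: hev_def sum_distrib_left algebra_simps)

lemma hev_sum: "hev k (sum f A) v = (\<Sum>x\<in>A. hev k (f x) v)"
  by (induction A rule: infinite_finite_induct) (auto simp: hev_add)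

lemma hev_cmul: "hev k p (cmul c v) = c ^ k * hev k p (v :: 'a :: comm_ring_1 \<times> 'a)"
proof -
  have "c ^ k * (coeff p i * fst v ^ i * snd v ^ (k - i)) =
        coeff p i * (c * fst v) ^ i * (c * snd v) ^ (k - i)" if "i \<le> k" for i
    using that power_add[of c i "k - i"] by (simp add: power_mult_distrib algebra_simps)
  then show ?thesis
    by (simp add: hev_def cmul_def sum_distrib_left)
qed

lemma hev2_cmul: "hev2 k g (cmul c v) = cmul (c ^ k) (hev2 k g (v :: 'a :: comm_ring_1 \<times> 'a))"
  unfolding hev2_def hev_cmul by (simp add: cmul_def)

lemma hev_poly:
  fixes p :: "'a :: field poly"
  assumes "snd v \<noteq> 0" "degree p \<le> k"
  shows "hev k p v = snd v ^ k * poly p (fst v / snd v)"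
proof -
  have "poly p (fst v / snd v) = (\<Sum>i\<le>k. coeff p i * (fst v / snd v) ^ i)"
    unfolding poly_altdef using assms(2)
    by (intro sum.mono_neutral_left) (auto simp: coeff_eq_0)
  moreover have "snd v ^ k * (coeff p i * (fst v / snd v) ^ i) = coeff p i * fst v ^ i * snd v ^ (k - i)"
    if "i \<le> k" for i
    using assms(1) that by (simp add: power_divide power_diff field_simps)
  ultimately show ?thesis
    unfolding hev_def sum_distrib_left by (metis (mono_tags, lifting) atMost_iff sum.cong sum_distrib_left)
qed

lemma hev_infinity: "snd v = 0 \<Longrightarrow> hev k p v = coeff p k * fst v ^ k"
  unfolding hev_def by (subst sum.mono_neutral_right[of _ "{k}"]) (auto simp: power_0_left)

lemma coeff_mult_bound:
  assumes "degree p \<le> m" "degree q \<le> n"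
  shows "coeff (p * q) (m + n) = coeff p m * coeff q n"
proof -
  have "coeff (p * q) (m + n) = (\<Sum>i\<le>m + n. if i = m then coeff p i * coeff q (m + n - i) else 0)"
    unfolding coeff_mult 
  proof (intro sum.cong refl)
    fix i assume "i \<in> {..m + n}"
    then consider "i > m" | "m + n - i > n" | "i = m" by fastforce
    then show "coeff p i * coeff q (m + n - i) = (if i = m then coeff p i * coeff q (m + n - i) else 0)"
      using assms by cases (auto simp: coeff_eq_0)
  qed
  then show ?thesis
    by (simp add: sum.delta)
qed

lemma hev_mult:
  fixes p q :: "'a :: field poly"
  assumes "degree p \<le> m" "degree q \<le> n"
  shows "hev (m + n) (p * q) v = hev m p v * hev n q v"
proof (cases "snd v = 0")
  case True
  then show ?thesis
    using coeff_mult_bound[OF assms] by (simp add: hev_infinity power_add)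
next
  case False
  moreover have "degree (p * q) \<le> m + n"
    using degree_mult_le[of p q] assms by linarith
  ultimately show ?thesis
    using assms by (simp add: hev_poly power_add)
qed

lemma hev_one: "hev 0 1 v = 1"
  by (simp add: hev_def)

lemma hev_power:
  fixes p :: "'a :: field poly"
  assumes "degree p \<le> m"
  shows "hev (m * i) (p ^ i) v = hev m p v ^ i"
proof (induction i)
  case (Suc i)
  have "degree (p ^ i) \<le> m * i"
    using assms degree_power_le[of p i] by (meson le_trans mult_le_mono1)
  from hev_mult[OF assms this, of v] Suc show ?case
    by simp
qed (simp add: hev_one)

lemma hev_lin: "hev 1 (lin v) w = wedge w v"
  by (simp add: hev_def lin_def wedge_def algebra_simps)

lemma degree_lin [simp]: "degree (lin v) \<le> 1"
  by (simp add: lin_def)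

lemma lin_eq_0_iff: "lin v = 0 \<longleftrightarrow> v = (0, 0)"
  by (cases v) (auto simp: lin_def)

lemma degree_prod_lin: "degree (\<Prod>w\<leftarrow>ws. lin w) \<le> length ws"
proof (induction ws)
  case (Cons w ws)
  have "degree (lin w * (\<Prod>w\<leftarrow>ws. lin w)) \<le> degree (lin w) + degree (\<Prod>w\<leftarrow>ws. lin w)"
    by (rule degree_mult_le)
  with Cons show ?case
    using degree_lin[of w] by simp
qed simp

lemma hev_prod_lin:
  fixes ws :: "('a :: field \<times> 'a) list"
  shows "hev (length ws) (\<Prod>w\<leftarrow>ws. lin w) v = (\<Prod>w\<leftarrow>ws. wedge v w)"
proof (induction ws)
  case (Cons w ws)
  show ?case
    using hev_mult[OF degree_lin[of w] degree_prod_lin[of ws], of v] Cons hev_lin[of w v] by simp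
qed (simp add: hev_one)

lemma hev_pCons: "hev (Suc k) (pCons 0 p) v = fst v * hev k p v"
proof -
  have "hev (Suc k) (pCons 0 p) v = (\<Sum>i\<le>k. coeff p i * fst v ^ Suc i * snd v ^ (k - i))"
    unfolding hev_def by (subst sum.atMost_Suc_shift) simp
  then show ?thesis
    by (simp add: hev_def sum_distrib_left algebra_simps)
qed

lemma hev_Suc: "degree p \<le> k \<Longrightarrow> hev (Suc k) p v = snd v * hev k p v"
  unfolding hev_def sum_distrib_left
  by (auto simp: coeff_eq_0 Suc_diff_le algebra_simps intro!: sum.cong)

lemma wedge_self [simp]: "wedge v v = 0"
  by (simp add: wedge_def)

lemma wedge_swap: "wedge v w = - wedge w v"
  by (simp add: wedge_def)

lemma wedge_swap_zero: "wedge v w = 0 \<longleftrightarrow> wedge w v = 0"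
  using wedge_swap[of v w] by simp

lemma wedge_cmul [simp]: "wedge (cmul c v) w = c * wedge v w" "wedge v (cmul c w) = c * wedge v w"
  by (auto simp: wedge_def cmul_def algebra_simps)

lemma wedge_zero_imp_cmul:
  fixes v w :: "'a :: field \<times> 'a"
  assumes "wedge v w = 0" "v \<noteq> (0, 0)"
  obtains c where "w = cmul c v"
proof (cases "fst v = 0")
  case True
  with assms have "w = cmul (snd w / snd v) v"
    by (cases v; cases w) (auto simp: wedge_def cmul_def)
  then show ?thesis by (rule that)
next
  case False
  with assms have "w = cmul (fst w / fst v) v"
    by (cases v; cases w) (auto simp: wedge_def cmul_def field_simps)
  then show ?thesis by (rule that)
qed

lemma cmul_eq_0: "cmul c v = (0, 0) \<longleftrightarrow> c = 0 \<or> v = (0, 0 :: 'a :: field)"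
  by (cases v) (auto simp: cmul_def)

text \<open>The middle vector has to be non-zero, because the zero vector has vanishing wedge with
  everything.\<close>

lemma wedge_trans:
  fixes u v w :: "'a :: field \<times> 'a"
  assumes "wedge u v = 0" "wedge v w = 0" "v \<noteq> (0, 0)"
  shows "wedge u w = 0"
proof -
  obtain c where "w = cmul c v" using wedge_zero_imp_cmul[OF assms(2,3)] .
  moreover obtain d where "u = cmul d v"
    using wedge_zero_imp_cmul[of v u] assms wedge_swap_zero by metis
  ultimately show ?thesis by simp
qed

text \<open>A polynomial of degree below \<open>k\<close> has, as a form of degree \<open>k\<close>,
  zeros at infinity: copies of the constant factor \<open>lin (1, 0)\<close> make up the
  difference.\<close>

lemma form_factor:
  fixes p :: "'a :: alg_closed_field poly"
  assumes "p \<noteq> 0" "degree p \<le> k"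
  obtains c ws where "c \<noteq> 0" "length ws = k" "\<And>w. w \<in> set ws \<Longrightarrow> w \<noteq> (0, 0)"
    "p = smult c (\<Prod>w\<leftarrow>ws. lin w)"
proof -
  obtain A where A: "size A = degree p" "p = smult (lead_coeff p) (\<Prod>x\<in>#A. [:-x, 1:])"
    using alg_closed_imp_factorization[OF assms(1)] by blast
  obtain xs where xs: "mset xs = A" using ex_mset by blast
  define ws where "ws = map (\<lambda>x. (x, 1)) xs @ replicate (k - degree p) (1, 0::'a)"
  have len: "length ws = k"
    using A(1) xs assms(2) by (auto simp: ws_def simp flip: size_mset)
  have "(\<Prod>x\<in>#A. [:-x, 1:]) = (\<Prod>x\<leftarrow>xs. [:-x, 1:])"
    unfolding xs[symmetric] by (simp flip: prod_mset_prod_list mset_map)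
  moreover have "(\<Prod>w\<leftarrow>replicate n (1, 0::'a). lin w) = [:(-1) ^ n:]" for n
    by (induction n) (auto simp: lin_def)
  ultimately have "(\<Prod>w\<leftarrow>ws. lin w) = smult ((-1) ^ (k - degree p)) (\<Prod>x\<in>#A. [:-x, 1:])"
    by (simp add: ws_def lin_def o_def)
  then have "p = smult (lead_coeff p * (-1) ^ (k - degree p)) (\<Prod>w\<leftarrow>ws. lin w)"
    using A(2) by (simp add: mult.assoc flip: power_mult_distrib)
  moreover have "w \<noteq> (0, 0)" if "w \<in> set ws" for w
    using that by (auto simp: ws_def)
  ultimately show ?thesis
    using that[of "lead_coeff p * (-1) ^ (k - degree p)" ws] assms(1) len by simp
qed

lemma form_has_zero:
  fixes p :: "'a :: alg_closed_field poly"
  assumes "1 \<le> k" "degree p \<le> k"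
  obtains v where "v \<noteq> (0, 0)" "hev k p v = 0"
proof (cases "p = 0")
  case True
  then show ?thesis using that[of "(1, 0)"] by simp
next
  case False
  from form_factor[OF False assms(2)] obtain c ws
    where ws: "c \<noteq> 0" "length ws = k" "\<And>w. w \<in> set ws \<Longrightarrow> w \<noteq> (0, 0)"
      "p = smult c (\<Prod>w\<leftarrow>ws. lin w)" by metis
  then obtain w ws' where "ws = w # ws'"
    using assms(1) by (cases ws) auto
  with ws show ?thesis
    using that[of w] hev_prod_lin[of ws w] by (auto simp: hev_smult)
qed

section \<open>Fixed points, preimages and three distinguished points\<close>

definition fixform :: "'a::comm_ring_1 poly \<times> 'a poly \<Rightarrow> 'a poly" where
  "fixform g = pCons 0 (snd g) - fst g"

definition preform :: "'a::comm_ring_1 \<times> 'a \<Rightarrow> 'a poly \<times> 'a poly \<Rightarrow> 'a poly" where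
  "preform p g = smult (snd p) (fst g) - smult (fst p) (snd g)"

text \<open>Over an algebraically closed field this is coprimality of the two forms. The point
  \<open>(1, 0)\<close> is included, so that one of the polynomials has exact degree
  \<open>k\<close>.\<close>

definition nondeg :: "nat \<Rightarrow> 'a::comm_ring_1 poly \<times> 'a poly \<Rightarrow> bool" where
  "nondeg k g \<longleftrightarrow> degree (fst g) \<le> k \<and> degree (snd g) \<le> k \<and>
     (\<forall>v. v \<noteq> (0, 0) \<longrightarrow> hev2 k g v \<noteq> (0, 0))"

lemma degree_fixform:
  assumes "degree (fst g) \<le> k" "degree (snd g) \<le> k"
  shows "degree (fixform g) \<le> Suc k"
  unfolding fixform_def
  by (rule degree_diff_le) (use assms degree_pCons_le[of 0 "snd g"] in auto)

lemma degree_preform: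
  assumes "degree (fst g) \<le> k" "degree (snd g) \<le> k"
  shows "degree (preform p g) \<le> k"
  unfolding preform_def
  by (rule degree_diff_le) (use assms degree_smult_le le_trans in blast)+

lemma hev_fixform:
  assumes "degree (fst g) \<le> k"
  shows "hev (Suc k) (fixform g) v = wedge v (hev2 k g v)"
  by (simp add: fixform_def hev_diff hev_pCons hev_Suc assms wedge_def hev2_def)

lemma hev_preform: "hev k (preform p g) v = wedge (hev2 k g v) p"
  by (simp add: preform_def hev_diff hev_smult wedge_def hev2_def algebra_simps)

text \<open>If every point were fixed, then as forms (P, Q) = (X R, Y R) with R of degree k - 1
  \<ge> 1, and a zero of R would be a common zero.\<close>

lemma fixform_nonzero:
  fixes g :: "'a :: alg_closed_field poly \<times> 'a poly"
  assumes "nondeg k g" "2 \<le> k"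
  shows "fixform g \<noteq> 0"
proof
  assume "fixform g = 0"
  then have A: "fst g = pCons 0 (snd g)" by (simp add: fixform_def)
  have deg: "degree (snd g) \<le> k - 1"
  proof (cases "snd g = 0")
    case False
    then show ?thesis using assms A by (auto simp: nondeg_def)
  qed simp
  have "1 \<le> k - 1" using assms(2) by simp
  from form_has_zero[OF this deg] obtain v where v: "v \<noteq> (0, 0)" "hev (k - 1) (snd g) v = 0"
    by blast
  have "hev k (fst g) v = 0"
    using hev_pCons[of "k - 1" "snd g" v] v A assms(2) by simp
  moreover have "hev k (snd g) v = 0"
    using hev_Suc[OF deg, of v] v assms(2) by simp
  ultimately show False
    using assms(1) v(1) unfolding nondeg_def hev2_def by metis
qed

text \<open>Otherwise \<open>g\<close> is constantly the point \<open>p\<close>; but the coordinate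
  of \<open>g\<close> in which \<open>p\<close> does not vanish has a zero somewhere, and there the
  other coordinate survives.\<close>

lemma preform_nonzero:
  fixes g :: "'a :: alg_closed_field poly \<times> 'a poly"
  assumes "nondeg k g" "1 \<le> k" "p \<noteq> (0, 0)"
  shows "preform p g \<noteq> 0"
proof
  assume 0: "preform p g = 0"
  have *: "wedge (hev2 k g v) p = 0" for v
    using hev_preform[of k p g v] 0 by simp
  show False
  proof (cases "snd p = 0")
    case True
    obtain v where v: "v \<noteq> (0, 0)" "hev k (fst g) v = 0"
      using form_has_zero[of k "fst g"] assms by (auto simp: nondeg_def)
    then have "hev k (snd g) v \<noteq> 0"
      using assms(1) unfolding nondeg_def hev2_def by metis
    with *[of v] v True assms(3) show False
      by (cases p) (auto simp: wedge_def hev2_def)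
  next
    case False
    obtain v where v: "v \<noteq> (0, 0)" "hev k (snd g) v = 0"
      using form_has_zero[of k "snd g"] assms by (auto simp: nondeg_def)
    then have "hev k (fst g) v \<noteq> 0"
      using assms(1) unfolding nondeg_def hev2_def by metis
    with *[of v] v False show False
      by (cases p) (auto simp: wedge_def hev2_def)
  qed
qed

lemma hev2_wedge_zero:
  fixes g :: "'a :: field poly \<times> 'a poly"
  assumes "wedge v w = 0" "v \<noteq> (0, 0)" 
  shows "wedge (hev2 k g v) (hev2 k g w) = 0"
proof -
  obtain c where "w = cmul c v" using wedge_zero_imp_cmul[OF assms] .
  then show ?thesis by (simp add: hev2_cmul)
qed

lemma lin_proportional:
  fixes v w :: "'a :: field \<times> 'a"
  assumes "wedge v w = 0" "v \<noteq> (0, 0)"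
  obtains c where "lin w = smult c (lin v)"
  using wedge_zero_imp_cmul[OF assms] by (metis cmul_def lin_def fst_conv snd_conv smult_pCons smult_0_right mult_minus_right)

text \<open>A totally invariant fixed point of a map of degree at least two is superattracting,
  hence a simple fixed point.\<close>

lemma totally_invariant_simple:
  fixes g :: "'a :: alg_closed_field poly \<times> 'a poly"
  assumes g: "nondeg k g" and k: "2 \<le> k" and p: "p \<noteq> (0, 0)"
    and sq: "fixform g = lin p * lin p * R" "degree R \<le> k - 1"
    and tot: "\<And>v. v \<noteq> (0, 0) \<Longrightarrow> wedge (hev2 k g v) p = 0 \<Longrightarrow> wedge v p = 0"
  shows False
proof -
  have degs: "degree (fst g) \<le> k" "degree (snd g) \<le> k"
    using g by (auto simp: nondeg_def)
  obtain c ws where ws: "c \<noteq> 0" "length ws = k" "\<And>w. w \<in> set ws \<Longrightarrow> w \<noteq> (0, 0)"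
      "preform p g = smult c (\<Prod>w\<leftarrow>ws. lin w)"
    using form_factor[OF preform_nonzero[OF g _ p] degree_preform[OF degs, of p]] k
    by (metis Suc_1 Suc_leD One_nat_def)
  have "\<exists>b. lin w = smult b (lin p)" if w: "w \<in> set ws" for w
  proof -
    have "hev k (preform p g) w = c * (\<Prod>u\<leftarrow>ws. wedge w u)"
      using ws hev_prod_lin[of ws w] by (simp add: hev_smult)
    also have "\<dots> = 0"
      using w wedge_self[of w] by (auto simp: prod_list_zero_iff image_iff intro: bexI[of _ w])
    finally have "wedge w p = 0"
      using tot[OF ws(3)[OF w]] by (simp add: hev_preform)
    then show ?thesis
      using lin_proportional[of p w] p wedge_swap_zero by metis
  qed
  \<comment> \<open>By total invariance all \<open>k\<close> zeros of the preimage form are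
    \<open>p\<close>, so that form is a multiple of \<open>lin p ^ k\<close>, in particular of
    \<open>lin p\<close> squared.\<close>
  then have "\<exists>b. (\<Prod>w\<leftarrow>xs. lin w) = smult b (lin p ^ length xs)" if "set xs \<subseteq> set ws" for xs
    using that
  proof (induction xs)
    case (Cons x xs)
    then obtain b where "(\<Prod>w\<leftarrow>xs. lin w) = smult b (lin p ^ length xs)" by auto
    moreover obtain b' where "lin x = smult b' (lin p)"
      using Cons.prems \<open>\<And>w. w \<in> set ws \<Longrightarrow> \<exists>b. lin w = smult b (lin p)\<close> by (metis list.set_intros(1) subsetD)
    ultimately have "(\<Prod>w\<leftarrow>x # xs. lin w) = smult (b' * b) (lin p ^ length (x # xs))"
      by (simp add: algebra_simps)
    then show ?case by blast
  qed (auto intro: exI[of _ 1])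
  from this[of ws] obtain b where "(\<Prod>w\<leftarrow>ws. lin w) = smult b (lin p ^ length ws)"
    by blast
  then have pk: "preform p g = smult (c * b) (lin p ^ k)"
    unfolding ws(4) by (simp add: ws(2))
  have lk: "lin p ^ k = lin p * lin p * lin p ^ (k - 2)"
    using power_add[of "lin p" 2 "k - 2"] k by (simp add: power2_eq_square add_2_eq_Suc'[symmetric] del: add_2_eq_Suc')
  obtain S where S: "preform p g = lin p * lin p * S" "degree S \<le> k - 2"
  proof -
    have "degree (lin p ^ (k - 2)) \<le> k - 2"
      using le_trans[OF degree_power_le mult_le_mono1[OF degree_lin]] by (metis mult_1)
    then have "degree (smult (c * b) (lin p ^ (k - 2))) \<le> k - 2"
      using degree_smult_le le_trans by blast
    moreover have "preform p g = lin p * lin p * smult (c * b) (lin p ^ (k - 2))"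
      using pk lk by simp
    ultimately show ?thesis using that by blast
  qed
  have lp: "lin p \<noteq> 0" using p by (simp add: lin_eq_0_iff)
  define X where "X = [:0, 1 :: 'a:]"
  define a where "a = [:fst p:]"
  define b where "b = [:snd p:]"
  have X: "pCons 0 q = X * q" and a: "smult (fst p) q = a * q" and b: "smult (snd p) q = b * q"
    for q :: "'a poly" by (simp_all add: X_def a_def b_def)
  have l: "lin p = b * X - a" by (simp add: lin_def X_def a_def b_def)
  \<comment> \<open>Cramer's rule recovers \<open>lin p * Q\<close> and \<open>lin p * P\<close>
    from the fixed form and the preimage form. Both of these are divisible by \<open>lin p\<close>
    squared, so \<open>lin p\<close> divides P and Q, which makes \<open>p\<close> a common
    zero.\<close>
  have "snd g * lin p = b * fixform g + preform p g" "fst g * lin p = a * fixform g + X * preform p g"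
    unfolding l fixform_def preform_def X a b by (simp_all add: algebra_simps)
  then have "lin p * snd g = lin p * (lin p * (b * R + S))"
    "lin p * fst g = lin p * (lin p * (a * R + X * S))"
    by (simp_all add: sq S algebra_simps)
  then have eq: "snd g = lin p * (smult (snd p) R + S)" "fst g = lin p * (smult (fst p) R + pCons 0 S)"
    unfolding X a b using lp by (metis mult_left_cancel)+
  have d: "degree (smult (snd p) R + S) \<le> k - 1" "degree (smult (fst p) R + pCons 0 S) \<le> k - 1"
    using degree_smult_le[of "snd p" R] degree_smult_le[of "fst p" R] degree_pCons_le[of 0 S] sq(2) S(2) k
    by (auto intro!: degree_add_le)
  have "hev k (snd g) p = 0" "hev k (fst g) p = 0"
    using hev_mult[OF degree_lin[of p] d(1), of p] hev_mult[OF degree_lin[of p] d(2), of p]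
      hev_lin[of p p] k by (simp_all flip: eq)
  then show False
    using g p unfolding nondeg_def hev2_def by metis
qed

definition indep3 :: "'a::comm_ring_1 \<times> 'a \<Rightarrow> 'a \<times> 'a \<Rightarrow> 'a \<times> 'a \<Rightarrow> bool" where
  "indep3 p q r \<longleftrightarrow> wedge p q \<noteq> 0 \<and> wedge q r \<noteq> 0 \<and> wedge p r \<noteq> 0"

text \<open>The fixed form has k + 1 \<ge> 3 zeros. If the first three are not distinct, some fixed
  point \<open>p\<close> is double, hence not totally invariant, and has a preimage \<open>q\<close>
  different from it. Any preimage \<open>r\<close> of \<open>q\<close> is then a third point, since
  \<open>p\<close> and \<open>q\<close> are both mapped to \<open>p\<close>.\<close>

lemma three_points:
  fixes g :: "'a :: alg_closed_field poly \<times> 'a poly"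
  assumes g: "nondeg k g" and k: "2 \<le> k"
  shows "\<exists>p q r. indep3 p q r \<and>
     (wedge p (hev2 k g p) = 0 \<and> wedge q (hev2 k g q) = 0 \<and> wedge r (hev2 k g r) = 0 \<or>
      wedge p (hev2 k g p) = 0 \<and> wedge (hev2 k g q) p = 0 \<and> wedge (hev2 k g r) q = 0)"
proof -
  have degs: "degree (fst g) \<le> k" "degree (snd g) \<le> k"
    using g by (auto simp: nondeg_def)
  obtain c ws where ws: "c \<noteq> 0" "length ws = Suc k" "\<And>w. w \<in> set ws \<Longrightarrow> w \<noteq> (0, 0)"
      "fixform g = smult c (\<Prod>w\<leftarrow>ws. lin w)"
    using form_factor[OF fixform_nonzero[OF g k] degree_fixform[OF degs]] by metis
  have fixed: "wedge w (hev2 k g w) = 0" if "w \<in> set ws" for w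
  proof -
    have "hev (Suc k) (fixform g) w = c * (\<Prod>u\<leftarrow>ws. wedge w u)"
      using ws hev_prod_lin[of ws w] by (simp add: hev_smult)
    also have "\<dots> = 0"
      using that wedge_self[of w] by (auto simp: prod_list_zero_iff image_iff intro: bexI[of _ w])
    finally show ?thesis by (simp add: hev_fixform[OF degs(1)])
  qed
  have nz: "hev2 k g v \<noteq> (0, 0)" if "v \<noteq> (0, 0)" for v
    using g that unfolding nondeg_def by blast
  obtain v1 v2 v3 us where us: "ws = v1 # v2 # v3 # us"
    using ws(2) k 
    by (cases ws; cases "tl ws"; cases "tl (tl ws)") auto
  show ?thesis
  proof (cases "indep3 v1 v2 v3")
    case True
    then show ?thesis using fixed[of v1] fixed[of v2] fixed[of v3] us
      by (intro exI[of _ v1] exI[of _ v2] exI[of _ v3]) simp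
  next
    case False
    have "\<exists>p q rs. p \<in> set ws \<and> wedge p q = 0 \<and> length rs = k - 1 \<and>
       (\<Prod>w\<leftarrow>ws. lin w) = lin p * lin q * (\<Prod>w\<leftarrow>rs. lin w)"
    proof -
      from False consider "wedge v1 v2 = 0" | "wedge v2 v3 = 0" | "wedge v1 v3 = 0"
        by (auto simp: indep3_def)
      then show ?thesis
      proof cases
        case 1
        then show ?thesis using us ws(2)
          by (intro exI[of _ v1] exI[of _ v2] exI[of _ "v3 # us"]) (auto simp: algebra_simps)
      next
        case 2
        then show ?thesis using us ws(2)
          by (intro exI[of _ v2] exI[of _ v3] exI[of _ "v1 # us"]) (auto simp: algebra_simps)
      next
        case 3
        then show ?thesis using us ws(2)
          by (intro exI[of _ v1] exI[of _ v3] exI[of _ "v2 # us"]) (auto simp: algebra_simps)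
      qed
    qed
    then obtain p q' rs where p: "p \<in> set ws" "wedge p q' = 0" "length rs = k - 1"
      and pr: "(\<Prod>w\<leftarrow>ws. lin w) = lin p * lin q' * (\<Prod>w\<leftarrow>rs. lin w)" by blast
    have p0: "p \<noteq> (0, 0)" using p ws by auto
    obtain b where b: "lin q' = smult b (lin p)" using lin_proportional[OF p(2) p0] .
    have sq: "fixform g = lin p * lin p * smult (c * b) (\<Prod>w\<leftarrow>rs. lin w)"
      unfolding ws(4) pr b by (simp add: algebra_simps)
    have "degree (smult (c * b) (\<Prod>w\<leftarrow>rs. lin w)) \<le> k - 1"
      using degree_prod_lin[of rs] p(3) degree_smult_le le_trans by metis
    then obtain q where q: "q \<noteq> (0, 0)" "wedge (hev2 k g q) p = 0" "wedge q p \<noteq> 0"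
      using totally_invariant_simple[OF g k p0 sq] by blast
    obtain r where r: "r \<noteq> (0, 0)" "hev k (preform q g) r = 0"
      using form_has_zero[OF _ degree_preform[OF degs]] k by (metis Suc_leD numeral_2_eq_2 One_nat_def)
    then have r': "wedge (hev2 k g r) q = 0" by (simp add: hev_preform)
    have fp: "wedge p (hev2 k g p) = 0" using fixed p by auto
    have "wedge r p \<noteq> 0"
    proof
      assume "wedge r p = 0"
      then have "wedge (hev2 k g r) (hev2 k g p) = 0" using hev2_wedge_zero r(1) by blast
      then have "wedge (hev2 k g r) p = 0"
        using wedge_trans[of _ "hev2 k g p" p] fp nz[OF p0] wedge_swap_zero by blast
      then show False
        using wedge_trans[of p "hev2 k g r" q] r' nz[OF r(1)] q(3) wedge_swap_zero by blast
    qed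
    moreover have "wedge r q \<noteq> 0"
    proof
      assume "wedge r q = 0"
      then have "wedge (hev2 k g r) (hev2 k g q) = 0" using hev2_wedge_zero r(1) by blast
      then have "wedge (hev2 k g r) p = 0"
        using wedge_trans[of _ "hev2 k g q" p] q nz[OF q(1)] by blast
      then show False
        using wedge_trans[of p "hev2 k g r" q] r' nz[OF r(1)] q(3) wedge_swap_zero by blast
    qed
    ultimately have "indep3 p q r"
      using q(3) by (auto simp: indep3_def wedge_swap_zero[of p] wedge_swap_zero[of q r])
    then show ?thesis using fp q r' by blast
  qed
qed

section \<open>Limits along an ultrafilter\<close>

definition ultra :: "nat filter \<Rightarrow> bool" where
  "ultra F \<longleftrightarrow> F \<noteq> bot \<and> (\<forall>A. eventually (\<lambda>n. n \<in> A) F \<or> eventually (\<lambda>n. n \<notin> A) F)"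

lemma ultra_bot: "ultra F \<Longrightarrow> F \<noteq> bot"
  by (simp add: ultra_def)

lemma ultra_not: "ultra F \<Longrightarrow> (\<not> eventually P F) \<longleftrightarrow> eventually (\<lambda>n. \<not> P n) F"
proof -
  assume u: "ultra F"
  have "eventually (\<lambda>n. n \<in> Collect P) F \<or> eventually (\<lambda>n. n \<notin> Collect P) F"
    using u unfolding ultra_def by blast
  moreover have False if "eventually P F" "eventually (\<lambda>n. \<not> P n) F"
  proof -
    from that have "eventually (\<lambda>n. False) F" by eventually_elim simp
    then show False using ultra_bot[OF u] by simp
  qed
  ultimately show ?thesis by auto
qed

lemma ultra_disj:
  "ultra F \<Longrightarrow> eventually (\<lambda>n. P n \<or> Q n) F \<longleftrightarrow> eventually P F \<or> eventually Q F"
proof -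
  assume u: "ultra F"
  have "eventually Q F" if "eventually (\<lambda>n. P n \<or> Q n) F" "\<not> eventually P F"
  proof -
    have "eventually (\<lambda>n. \<not> P n) F" using that ultra_not[OF u] by simp
    with that(1) show ?thesis by eventually_elim auto
  qed
  then show ?thesis by (auto elim: eventually_mono)
qed

text \<open>Turns a choice among finitely many candidates made separately for each n into a single
  choice. This is how maxima, dominant terms and cases are fixed along the filter.\<close>

lemma ultra_bex:
  assumes "ultra F" "finite A"
  shows "eventually (\<lambda>n. \<exists>x\<in>A. P x n) F \<longleftrightarrow> (\<exists>x\<in>A. eventually (P x) F)"
  using assms(2)
proof induction
  case empty
  then show ?case using ultra_bot[OF assms(1)] by simp
next
  case (insert x A)
  then show ?case using ultra_disj[OF assms(1), of "P x" "\<lambda>n. \<exists>x\<in>A. P x n"] by simp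
qed

text \<open>Compactness of the extended reals: the limit is the supremum of the eventual lower
  bounds, and the ultrafilter property turns "not eventually above" into "eventually below".\<close>

lemma ultra_tendsto:
  assumes "ultra F"
  shows "((\<lambda>n. ereal (x n)) \<longlongrightarrow> wlim F x) F"
proof -
  define L where "L = Sup {c. eventually (\<lambda>n. c \<le> ereal (x n)) F}"
  have "((\<lambda>n. ereal (x n)) \<longlongrightarrow> L) F"
  proof (rule order_tendstoI)
    fix a assume "a < L"
    then obtain c where "a < c" "eventually (\<lambda>n. c \<le> ereal (x n)) F"
      unfolding L_def less_Sup_iff by auto
    then show "eventually (\<lambda>n. a < ereal (x n)) F"
      by (auto elim: eventually_mono)
  next
    fix a assume "L < a"
    then have "\<not> eventually (\<lambda>n. a \<le> ereal (x n)) F"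
      unfolding L_def by (meson Sup_upper leD mem_Collect_eq)
    then show "eventually (\<lambda>n. ereal (x n) < a) F"
      using ultra_not[OF assms] by (auto simp: not_le)
  qed
  then show ?thesis
    using tendsto_Lim[OF ultra_bot[OF assms], of "\<lambda>n. ereal (x n)" L] unfolding wlim_def by simp
qed

lemma wlim_eqI: "ultra F \<Longrightarrow> ((\<lambda>n. ereal (x n)) \<longlongrightarrow> l) F \<Longrightarrow> wlim F x = l"
  using tendsto_unique[OF ultra_bot ultra_tendsto] by blast

lemma wlim_eq_ereal: "ultra F \<Longrightarrow> wlim F x = ereal r \<longleftrightarrow> (x \<longlongrightarrow> r) F"
  using wlim_eqI[of F x "ereal r"] ultra_tendsto[of F x] by auto

lemma wlim_nonneg:
  assumes "ultra F" "eventually (\<lambda>n. 0 \<le> x n) F"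
  shows "0 \<le> wlim F x"
  by (rule tendsto_lowerbound[OF ultra_tendsto[OF assms(1)] _ ultra_bot[OF assms(1)]])
     (use assms(2) in auto)

lemma wlim_finite_iff:
  assumes "ultra F" "eventually (\<lambda>n. 0 \<le> x n) F"
  shows "wlim F x < \<infinity> \<longleftrightarrow> (\<exists>r. (x \<longlongrightarrow> r) F)"
proof (cases "wlim F x")
  case (real r)
  then show ?thesis using wlim_eq_ereal[OF assms(1), of x r] by auto
next
  case PInf
  then have "\<not> (x \<longlongrightarrow> r) F" for r using wlim_eq_ereal[OF assms(1), of x r] by simp
  then show ?thesis using PInf by simp
next
  case MInf
  then show ?thesis using wlim_nonneg[OF assms] by simp
qed

lemma wlim_infinite_iff:
  assumes "ultra F"
  shows "wlim F x = \<infinity> \<longleftrightarrow> filterlim x at_top F"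
  using wlim_eqI[OF assms, of x \<infinity>] ultra_tendsto[OF assms, of x] by (auto simp: tendsto_PInfty_eq_at_top)

lemma ultra_bounded_tendsto:
  fixes x :: "nat \<Rightarrow> real"
  assumes "ultra F" "eventually (\<lambda>n. \<bar>x n\<bar> \<le> C) F"
  obtains r where "(x \<longlongrightarrow> r) F"
proof (cases "wlim F x")
  case (real r)
  then show ?thesis using wlim_eq_ereal[OF assms(1), of x r] that by simp
next
  case PInf
  then have "eventually (\<lambda>n. ereal (x n) > ereal C) F"
    using order_tendstoD(1)[OF ultra_tendsto[OF assms(1), of x], of "ereal C"] by simp
  then have "eventually (\<lambda>n. False) F" using assms(2) by eventually_elim auto
  then show ?thesis using ultra_bot[OF assms(1)] by simp
next
  case MInf
  then have "eventually (\<lambda>n. ereal (x n) < ereal (-C)) F"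
    using order_tendstoD(2)[OF ultra_tendsto[OF assms(1), of x], of "ereal (- C)"] by simp
  then have "eventually (\<lambda>n. False) F" using assms(2) by eventually_elim auto
  then show ?thesis using ultra_bot[OF assms(1)] by simp
qed

lemma wlim_cong: "eventually (\<lambda>n. x n = y n) F \<Longrightarrow> wlim F x = wlim F y"
proof -
  assume "eventually (\<lambda>n. x n = y n) F"
  then have "((\<lambda>n. ereal (x n)) \<longlongrightarrow> l) F \<longleftrightarrow> ((\<lambda>n. ereal (y n)) \<longlongrightarrow> l) F" for l
    by (intro tendsto_cong) (auto elim: eventually_mono)
  then show ?thesis by (simp only: wlim_def t2_space_class.Lim_def)
qed

section \<open>Absolute values of complex sequences at a scale\<close>

locale scaled =
  fixes F :: "nat filter" and \<eta> :: "nat \<Rightarrow> real"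
  assumes ultra: "ultra F" and scale: "scale \<eta>"
begin

abbreviation "ev P \<equiv> eventually P F"
abbreviation "Hd \<equiv> Hdom F \<eta>"
abbreviation "Hz \<equiv> Hzero F \<eta>"

text \<open>The norm before passing to the limit. The exponent is \<open>\<eta> n\<close>, as in
  \<open>Hdom\<close>, and not \<open>min 1 (\<eta> n)\<close> as in \<open>Hnorm\<close>; the
  limits agree for scales tending to 0.\<close>

definition N :: "(nat \<Rightarrow> complex) \<Rightarrow> nat \<Rightarrow> real" where
  "N z n = cmod (z n) powr \<eta> n"

definition nrm :: "(nat \<Rightarrow> complex) \<Rightarrow> real" where
  "nrm z = real_of_ereal (wlim F (N z))"

lemma eta_pos: "0 < \<eta> n"
  using scale by (simp add: scale_def)

lemma eta_bound: obtains C where "\<And>n. \<eta> n \<le> C" "1 \<le> C"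
proof -
  obtain C where "\<And>n. \<eta> n \<le> C" using scale by (auto simp: scale_def bdd_above_def)
  then show ?thesis using that[of "max C 1"] by (auto simp: le_max_iff_disj)
qed

lemma N_nonneg [simp]: "0 \<le> N z n"
  by (simp add: N_def)

lemma wlim_N_nonneg: "0 \<le> wlim F (N z)"
  by (rule wlim_nonneg[OF ultra]) simp

lemma Hd_iff: "Hd z \<longleftrightarrow> (\<exists>r. (N z \<longlongrightarrow> r) F)"
  using wlim_finite_iff[OF ultra, of "N z"] by (simp add: Hdom_def N_def[abs_def])

lemma Hz_iff: "Hz z \<longleftrightarrow> (N z \<longlongrightarrow> 0) F"
  using wlim_eq_ereal[OF ultra, of "N z" 0] by (simp add: Hzero_def N_def[abs_def] zero_ereal_def)

lemma Hz_imp_Hd: "Hz z \<Longrightarrow> Hd z"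
  unfolding Hz_iff Hd_iff by blast

lemma nrm_eqI: "(N z \<longlongrightarrow> r) F \<Longrightarrow> nrm z = r"
  using wlim_eq_ereal[OF ultra, of "N z" r] by (simp add: nrm_def)

lemma nrm_tendsto: "Hd z \<Longrightarrow> (N z \<longlongrightarrow> nrm z) F"
  using nrm_eqI[of z] unfolding Hd_iff by auto

lemma nrm_nonneg: "0 \<le> nrm z"
  unfolding nrm_def by (rule real_of_ereal_pos[OF wlim_N_nonneg])

lemma Hz_iff_nrm: "Hd z \<Longrightarrow> Hz z \<longleftrightarrow> nrm z = 0"
  using nrm_tendsto[of z] nrm_eqI[of z 0] unfolding Hz_iff by auto

text \<open>Along an ultrafilter a bounded real sequence converges, so finiteness of the norm is
  mere boundedness.\<close>

lemma Hd_bound_iff: "Hd z \<longleftrightarrow> (\<exists>C. ev (\<lambda>n. N z n \<le> C))"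
proof
  assume "Hd z"
  then have "ev (\<lambda>n. N z n < nrm z + 1)"
    by (intro order_tendstoD(2)[OF nrm_tendsto]) auto
  then show "\<exists>C. ev (\<lambda>n. N z n \<le> C)"
    by (auto elim!: eventually_mono intro!: exI[of _ "nrm z + 1"])
next
  assume "\<exists>C. ev (\<lambda>n. N z n \<le> C)"
  then obtain C where "ev (\<lambda>n. \<bar>N z n\<bar> \<le> C)" by auto
  from ultra_bounded_tendsto[OF ultra this] show "Hd z" unfolding Hd_iff by blast
qed

lemma N_mult: "N (\<lambda>n. x n * y n) n = N x n * N y n"
  by (simp add: N_def norm_mult powr_mult)

lemma Hd_mult: "Hd x \<Longrightarrow> Hd y \<Longrightarrow> Hd (\<lambda>n. x n * y n)"
  and nrm_mult: "Hd x \<Longrightarrow> Hd y \<Longrightarrow> nrm (\<lambda>n. x n * y n) = nrm x * nrm y"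
proof -
  assume "Hd x" "Hd y"
  then have "(N (\<lambda>n. x n * y n) \<longlongrightarrow> nrm x * nrm y) F"
    unfolding N_mult[abs_def] by (intro tendsto_mult nrm_tendsto)
  then show "Hd (\<lambda>n. x n * y n)" "nrm (\<lambda>n. x n * y n) = nrm x * nrm y"
    using Hd_iff nrm_eqI by blast+
qed

text \<open>The constant \<open>2 powr \<eta> n\<close> is bounded because \<eta> is, which makes
  the domain closed under sums; it tends to 1 when \<eta> tends to 0, which makes the norm
  ultrametric.\<close>

lemma N_add_le: "N (\<lambda>n. x n + y n) n \<le> 2 powr \<eta> n * max (N x n) (N y n)"
proof -
  have "cmod (x n + y n) \<le> 2 * max (cmod (x n)) (cmod (y n))"
    using norm_triangle_ineq[of "x n" "y n"] by linarith
  then have "N (\<lambda>n. x n + y n) n \<le> (2 * max (cmod (x n)) (cmod (y n))) powr \<eta> n"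
    unfolding N_def using eta_pos[of n] by (intro powr_mono2) auto
  also have "\<dots> = 2 powr \<eta> n * max (cmod (x n)) (cmod (y n)) powr \<eta> n"
    by (subst powr_mult) (auto simp: le_max_iff_disj)
  also have "max (cmod (x n)) (cmod (y n)) powr \<eta> n = max (N x n) (N y n)"
  proof (cases "cmod (x n) \<le> cmod (y n)")
    case True
    then have "N x n \<le> N y n" unfolding N_def using eta_pos[of n] by (intro powr_mono2) auto
    then show ?thesis using True by (simp add: max_absorb2 N_def)
  next
    case False
    then have "N y n \<le> N x n" unfolding N_def using eta_pos[of n] by (intro powr_mono2) auto
    then show ?thesis using False by (simp add: max_absorb1 N_def)
  qed
  finally show ?thesis .
qed

lemma Hd_add:
  assumes "Hd x" "Hd y"
  shows "Hd (\<lambda>n. x n + y n)"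
proof -
  obtain A B where AB: "ev (\<lambda>n. N x n \<le> A)" "ev (\<lambda>n. N y n \<le> B)"
    using assms Hd_bound_iff by blast
  obtain C where C: "\<And>n. \<eta> n \<le> C" using eta_bound by blast
  from AB have "ev (\<lambda>n. N (\<lambda>n. x n + y n) n \<le> 2 powr C * max A B)"
  proof eventually_elim
    case (elim n)
    have "2 powr \<eta> n * max (N x n) (N y n) \<le> 2 powr C * max A B"
      using elim C[of n] by (intro mult_mono) (auto simp: le_max_iff_disj)
    then show ?case using N_add_le[of x y n] by linarith
  qed
  then show ?thesis using Hd_bound_iff by blast
qed

lemma Hz_add:
  assumes "Hz x" "Hz y"
  shows "Hz (\<lambda>n. x n + y n)"
proof -
  obtain C where C: "\<And>n. \<eta> n \<le> C" using eta_bound by blast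
  have "((\<lambda>n. 2 powr C * max (N x n) (N y n)) \<longlongrightarrow> 2 powr C * max 0 0) F"
    using assms by (intro tendsto_mult tendsto_max tendsto_const) (auto simp: Hz_iff)
  moreover have "ev (\<lambda>n. N (\<lambda>n. x n + y n) n \<le> 2 powr C * max (N x n) (N y n))"
  proof (intro always_eventually allI)
    fix n
    have "2 powr \<eta> n * max (N x n) (N y n) \<le> 2 powr C * max (N x n) (N y n)"
      using C[of n] by (intro mult_right_mono) (auto simp: le_max_iff_disj)
    then show "N (\<lambda>n. x n + y n) n \<le> 2 powr C * max (N x n) (N y n)"
      using N_add_le[of x y n] by linarith
  qed
  ultimately have "(N (\<lambda>n. x n + y n) \<longlongrightarrow> 0) F"
    by (intro tendsto_sandwich[of "\<lambda>_. 0" "N (\<lambda>n. x n + y n)" F "\<lambda>n. 2 powr C * max (N x n) (N y n)" 0]) auto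
  then show ?thesis by (simp add: Hz_iff)
qed

lemma Hz_mult: "Hz x \<Longrightarrow> Hd y \<Longrightarrow> Hz (\<lambda>n. x n * y n)"
  using Hd_mult[of x y] nrm_mult[of x y] Hz_imp_Hd[of x] Hz_iff_nrm[of x] Hz_iff_nrm[of "\<lambda>n. x n * y n"] by simp

lemma N_minus: "N (\<lambda>n. - x n) = N x"
  by (simp add: N_def fun_eq_iff)

lemma Hd_minus: "Hd (\<lambda>n. - x n) \<longleftrightarrow> Hd x" and Hz_minus: "Hz (\<lambda>n. - x n) \<longleftrightarrow> Hz x"
  by (simp_all add: Hd_iff Hz_iff N_minus)

lemma Hd_diff: "Hd x \<Longrightarrow> Hd y \<Longrightarrow> Hd (\<lambda>n. x n - y n)"
  using Hd_add[of x "\<lambda>n. - y n"] by (simp add: Hd_minus)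

lemma Hz_diff: "Hz x \<Longrightarrow> Hz y \<Longrightarrow> Hz (\<lambda>n. x n - y n)"
  using Hz_add[of x "\<lambda>n. - y n"] by (simp add: Hz_minus)

lemma N_cong: "ev (\<lambda>n. x n = y n) \<Longrightarrow> ev (\<lambda>n. N x n = N y n)"
  by (auto elim!: eventually_mono simp: N_def)

lemma N_tendsto_cong: "ev (\<lambda>n. x n = y n) \<Longrightarrow> (N x \<longlongrightarrow> r) F \<longleftrightarrow> (N y \<longlongrightarrow> r) F"
  by (intro tendsto_cong N_cong)

lemma Hd_cong: "ev (\<lambda>n. x n = y n) \<Longrightarrow> Hd x \<longleftrightarrow> Hd y"
  using N_tendsto_cong by (simp add: Hd_iff)

lemma Hz_cong: "ev (\<lambda>n. x n = y n) \<Longrightarrow> Hz x \<longleftrightarrow> Hz y"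
  using N_tendsto_cong by (simp add: Hz_iff)

lemma Hz_zero [simp]: "Hz (\<lambda>n. 0)"
  by (simp add: Hz_iff N_def[abs_def])

lemma Hd_bounded:
  assumes "ev (\<lambda>n. cmod (x n) \<le> C)"
  shows "Hd x"
proof -
  obtain B where B: "\<And>n. \<eta> n \<le> B" using eta_bound by blast
  have "ev (\<lambda>n. N x n \<le> max 1 C powr B)"
    using assms
  proof eventually_elim
    case (elim n)
    then have "N x n \<le> max 1 C powr \<eta> n"
      unfolding N_def using eta_pos[of n] by (intro powr_mono2) auto
    also have "\<dots> \<le> max 1 C powr B" using B[of n] by (intro powr_mono) auto
    finally show ?case .
  qed
  then show ?thesis using Hd_bound_iff by blast
qed

lemma Hd_const [simp]: "Hd (\<lambda>n. c)"
  by (rule Hd_bounded[of _ "cmod c"]) simp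

lemma Hd_mono:
  assumes "ev (\<lambda>n. cmod (x n) \<le> cmod (y n))" "Hd y"
  shows "Hd x"
proof -
  obtain C where "ev (\<lambda>n. N y n \<le> C)" using assms Hd_bound_iff by blast
  with assms(1) have "ev (\<lambda>n. N x n \<le> C)"
  proof eventually_elim
    case (elim n)
    have "N x n \<le> N y n" unfolding N_def using elim eta_pos[of n] by (intro powr_mono2) auto
    then show ?case using elim by simp
  qed
  then show ?thesis using Hd_bound_iff by blast
qed

lemma Hd_sum: "(\<And>i. i \<in> A \<Longrightarrow> Hd (f i)) \<Longrightarrow> Hd (\<lambda>n. \<Sum>i\<in>A. f i n)"
  by (induction A rule: infinite_finite_induct) (auto intro: Hd_add)

lemma Hd_prod: "(\<And>i. i \<in> A \<Longrightarrow> Hd (f i)) \<Longrightarrow> Hd (\<lambda>n. \<Prod>i\<in>A. f i n)"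
  by (induction A rule: infinite_finite_induct) (auto intro: Hd_mult)

lemma Hd_power: "Hd x \<Longrightarrow> Hd (\<lambda>n. x n ^ k)"
  by (induction k) (auto intro: Hd_mult)

lemma Hd_inverse:
  assumes "Hd x" "\<not> Hz x"
  shows "Hd (\<lambda>n. inverse (x n))" "nrm (\<lambda>n. inverse (x n)) = inverse (nrm x)"
proof -
  have "nrm x \<noteq> 0" using assms Hz_iff_nrm by blast
  then have "((\<lambda>n. inverse (N x n)) \<longlongrightarrow> inverse (nrm x)) F"
    by (intro tendsto_inverse nrm_tendsto assms)
  moreover have "(\<lambda>n. inverse (N x n)) = N (\<lambda>n. inverse (x n))"
    by (auto simp: N_def fun_eq_iff norm_inverse powr_divide inverse_eq_divide norm_divide)
  ultimately show "Hd (\<lambda>n. inverse (x n))" "nrm (\<lambda>n. inverse (x n)) = inverse (nrm x)"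
    using Hd_iff nrm_eqI by auto
qed

lemma Hz_one: "\<not> Hz (\<lambda>n. 1)"
proof
  assume "Hz (\<lambda>n. 1)"
  then have "((\<lambda>n. 1 :: real) \<longlongrightarrow> 0) F" by (simp add: Hz_iff N_def[abs_def])
  then show False using tendsto_unique[OF ultra_bot[OF ultra], of "\<lambda>n. 1 :: real" 0 1] by simp
qed

lemma not_Hz_nonzero:
  assumes "\<not> Hz x"
  shows "ev (\<lambda>n. x n \<noteq> 0)"
proof (rule ccontr)
  assume "\<not> ?thesis"
  then have "ev (\<lambda>n. x n = 0)" using ultra_not[OF ultra] by simp
  then show False using Hz_cong[of x "\<lambda>_. 0"] assms by simp
qed

end

locale small_scaled = scaled +
  assumes small: "(\<eta> \<longlongrightarrow> 0) F"
begin

lemma nrm_add_le: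
  assumes "Hd x" "Hd y"
  shows "nrm (\<lambda>n. x n + y n) \<le> max (nrm x) (nrm y)"
proof -
  have "((\<lambda>n. 2 powr \<eta> n * max (N x n) (N y n)) \<longlongrightarrow> 2 powr 0 * max (nrm x) (nrm y)) F"
    using assms small by (intro tendsto_mult tendsto_max tendsto_powr nrm_tendsto tendsto_const) auto
  then show ?thesis
    using tendsto_le[OF ultra_bot[OF ultra] _ nrm_tendsto[OF Hd_add[OF assms]]] N_add_le by auto
qed

lemma Hnorm_eq: "Hnorm F \<eta> z = wlim F (N z)"
proof -
  have "ev (\<lambda>n. \<eta> n < 1)" using small by (intro order_tendstoD(2)[where a = 1]) auto
  then show ?thesis unfolding Hnorm_def by (intro wlim_cong) (auto elim!: eventually_mono simp: N_def)
qed

lemma Hnorm_ereal: "Hd z \<Longrightarrow> Hnorm F \<eta> z = ereal (nrm z)"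
  unfolding Hnorm_eq using wlim_eq_ereal[OF ultra] nrm_tendsto by blast

text \<open>Because \<open>cmod c powr \<eta> n\<close> tends to 1, the complex numbers form a
  trivially valued subfield.\<close>

lemma nrm_const:
  assumes "c \<noteq> 0"
  shows "nrm (\<lambda>n. c) = 1"
proof -
  have "((\<lambda>n. cmod c powr \<eta> n) \<longlongrightarrow> cmod c powr 0) F"
    using assms small by (intro tendsto_powr tendsto_const) auto
  then show ?thesis using assms by (intro nrm_eqI) (simp add: N_def[abs_def])
qed

lemma nrm_mono:
  assumes "ev (\<lambda>n. cmod (x n) \<le> cmod (y n))" "Hd y"
  shows "nrm x \<le> nrm y"
  by (rule tendsto_le[OF ultra_bot[OF ultra] nrm_tendsto[OF assms(2)] nrm_tendsto[OF Hd_mono[OF assms]]])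
     (use assms(1) eta_pos in \<open>auto elim!: eventually_mono simp: N_def intro!: powr_mono2 less_imp_le[OF eta_pos]\<close>)

end

lemma scale_less_one: "ultra F \<Longrightarrow> scale_less F e one_scale \<longleftrightarrow> (e \<longlongrightarrow> 0) F"
  using wlim_eq_ereal[of F e 0] by (simp add: scale_less_def one_scale_def zero_ereal_def)

section \<open>The field of a place\<close>

definition mapp :: "'a::comm_ring_1 \<times> 'a \<times> 'a \<times> 'a \<Rightarrow> 'a \<times> 'a \<Rightarrow> 'a \<times> 'a" where
  "mapp m v = (case m of (a, b, c, d) \<Rightarrow> (a * fst v + b * snd v, c * fst v + d * snd v))"

text \<open>The adjugate takes the place of the inverse matrix: it needs no division, and the
  resulting factor \<open>gdet m\<close> is harmless in homogeneous coordinates.\<close>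

definition madj :: "'a::comm_ring_1 \<times> 'a \<times> 'a \<times> 'a \<Rightarrow> 'a \<times> 'a \<times> 'a \<times> 'a" where
  "madj m = (case m of (a, b, c, d) \<Rightarrow> (d, - b, - c, a))"

text \<open>A subfield of the ultrapower, encoded as a set of sequences saturated under equality
  along \<open>F\<close>. The last clause makes it algebraically closed in the ultrapower, and hence
  algebraically closed.\<close>

definition acl_field :: "nat filter \<Rightarrow> (nat \<Rightarrow> complex) set \<Rightarrow> bool" where
  "acl_field F L \<longleftrightarrow>
     (\<forall>c. (\<lambda>_. c) \<in> L) \<and>
     (\<forall>x\<in>L. \<forall>y\<in>L. (\<lambda>n. x n + y n) \<in> L \<and> (\<lambda>n. x n * y n) \<in> L) \<and>
     (\<forall>x\<in>L. (\<lambda>n. inverse (x n)) \<in> L) \<and>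
     (\<forall>x\<in>L. \<forall>y. eventually (\<lambda>n. x n = y n) F \<longrightarrow> y \<in> L) \<and>
     (\<forall>m c x. (\<forall>i\<le>m. c i \<in> L) \<and> eventually (\<lambda>n. \<exists>i\<le>m. c i n \<noteq> 0) F \<and>
        eventually (\<lambda>n. (\<Sum>i\<le>m. c i n * x n ^ i) = 0) F \<longrightarrow> x \<in> L)"

definition trivially_valued :: "nat filter \<Rightarrow> (nat \<Rightarrow> real) \<Rightarrow> (nat \<Rightarrow> complex) set \<Rightarrow> bool" where
  "trivially_valued F \<eta> L \<longleftrightarrow> (\<forall>x\<in>L. Hdom F \<eta> x \<longrightarrow> scaled.nrm F \<eta> x \<in> {0, 1})"

text \<open>The claim about one pair \<open>(F, \<eta>)\<close>, stated on sequences only, so that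
  it can be compared between pairs. \<open>G\<close> is a map over L, in the application an iterate
  of the normal form, and \<open>W\<close> is the rescaling \<open>M\<close> composed with the
  change of coordinates leading to that form. The scalar \<open>s\<close> appears because maps are
  homogeneous pairs.\<close>

definition never_adapted :: "nat filter \<Rightarrow> (nat \<Rightarrow> real) \<Rightarrow> bool" where
  "never_adapted F \<eta> \<longleftrightarrow> ((\<eta> \<longlongrightarrow> 0) F \<longrightarrow>
     (\<forall>L K h M W G. acl_field F L \<and> trivially_valued F \<eta> L \<and>
        (\<forall>n. mob_det (W n) \<noteq> 0) \<and>
        (\<forall>n. degree (fst (G n)) \<le> K \<and> degree (snd (G n)) \<le> K) \<and>
        (\<forall>i. (\<lambda>n. coeff (fst (G n)) i) \<in> L \<and> (\<lambda>n. coeff (snd (G n)) i) \<in> L) \<and>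
        (\<forall>n. degree (fst (h n)) \<le> K \<and> degree (snd (h n)) \<le> K) \<and>
        eventually (\<lambda>n. \<exists>s. s \<noteq> 0 \<and> (\<forall>v. hev2 K (conj K (M n) (h n)) v =
            cmul s (mapp (W n) (hev2 K (G n) (mapp (madj (W n)) v))))) F
        \<longrightarrow> \<not> adapted F K h M \<eta>))"

text \<open>A type cannot depend on the pair \<open>(F, \<eta>)\<close>. The field \<open>H\<^sub>\<eta>\<close> is therefore built for one
  particular pair, chosen to violate \<open>never_adapted\<close> if any pair does; a theorem proved
  for this pair holds for all of them.\<close>

definition cex_place :: "nat filter \<times> (nat \<Rightarrow> real)" where
  "cex_place = (if \<exists>p. ultra (fst p) \<and> scale (snd p) \<and> \<not> never_adapted (fst p) (snd p)
     then SOME p. ultra (fst p) \<and> scale (snd p) \<and> \<not> never_adapted (fst p) (snd p)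
     else (principal {0}, \<lambda>_. 1))"

abbreviation "cexF \<equiv> fst cex_place"
abbreviation "cexS \<equiv> snd cex_place"

text \<open>The default place is evaluation at n = 0 with the trivial scale, so a field is obtained
  in either case.\<close>

lemma scaled_cex: "scaled cexF cexS"
proof (cases "\<exists>p. ultra (fst p) \<and> scale (snd p) \<and> \<not> never_adapted (fst p) (snd p)")
  case True
  from someI_ex[OF this] show ?thesis
    using True unfolding scaled_def cex_place_def by simp
next
  case False
  then have eq: "cex_place = (principal {0}, \<lambda>_. 1)"
    unfolding cex_place_def by (simp only: if_False)
  have "principal {0::nat} \<noteq> bot" by (simp add: principal_eq_bot_iff)
  then show ?thesis
    unfolding eq by (simp add: scaled_def ultra_def eventually_principal Defs.scale_def)
qed

lemma never_adapted_cex: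
  assumes "never_adapted cexF cexS" "ultra F" "scale \<eta>"
  shows "never_adapted F \<eta>"
proof (rule ccontr)
  assume "\<not> never_adapted F \<eta>"
  then have *: "\<exists>p. ultra (fst p) \<and> scale (snd p) \<and> \<not> never_adapted (fst p) (snd p)"
    using assms by (intro exI[of _ "(F, \<eta>)"]) simp
  from someI_ex[OF this] show False
    using * assms(1) unfolding cex_place_def by simp
qed

interpretation cex: scaled cexF cexS by (rule scaled_cex)

section \<open>The field of the chosen place\<close>

definition hrel :: "(nat \<Rightarrow> complex) \<Rightarrow> (nat \<Rightarrow> complex) \<Rightarrow> bool" where
  "hrel x y \<longleftrightarrow> Hdom cexF cexS x \<and> Hdom cexF cexS y \<and> Hzero cexF cexS (\<lambda>n. x n - y n)"

lemma hrel_refl: "hrel x x \<longleftrightarrow> Hdom cexF cexS x"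
  by (simp add: hrel_def)

lemma part_equivp_hrel: "part_equivp hrel"
proof (rule part_equivpI)
  show "\<exists>x. hrel x x" by (rule exI[of _ "\<lambda>_. 0"]) (simp add: hrel_refl)
  show "symp hrel"
  proof (rule sympI)
    fix x y assume "hrel x y"
    then show "hrel y x" using cex.Hz_minus[of "\<lambda>n. x n - y n"] by (simp add: hrel_def)
  qed
  show "transp hrel"
  proof (rule transpI)
    fix x y z assume "hrel x y" "hrel y z"
    then show "hrel x z"
      using cex.Hz_add[of "\<lambda>n. x n - y n" "\<lambda>n. y n - z n"] by (simp add: hrel_def)
  qed
qed

quotient_type hfield = "nat \<Rightarrow> complex" / partial: hrel
  by (rule part_equivp_hrel)

lemma hrel_Hz:
  assumes "hrel x y"
  shows "Hzero cexF cexS x \<longleftrightarrow> Hzero cexF cexS y"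
  using assms cex.Hz_add[of "\<lambda>n. x n - y n" y] cex.Hz_diff[of x "\<lambda>n. x n - y n"] by (auto simp: hrel_def)

lemma hrel_mult:
  assumes "hrel x x'" "hrel y y'"
  shows "hrel (\<lambda>n. x n * y n) (\<lambda>n. x' n * y' n)"
proof -
  have "Hzero cexF cexS (\<lambda>n. (x n - x' n) * y n + (y n - y' n) * x' n)"
    using assms by (intro cex.Hz_add cex.Hz_mult) (auto simp: hrel_def)
  then show ?thesis
    using assms by (simp add: hrel_def cex.Hd_mult algebra_simps)
qed

lemma hrel_add:
  assumes "hrel x x'" "hrel y y'"
  shows "hrel (\<lambda>n. x n + y n) (\<lambda>n. x' n + y' n)"
  using assms cex.Hz_add[of "\<lambda>n. x n - x' n" "\<lambda>n. y n - y' n"]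
  by (simp add: hrel_def cex.Hd_add algebra_simps)

lemma hrel_minus: "hrel x x' \<Longrightarrow> hrel (\<lambda>n. - x n) (\<lambda>n. - x' n)"
  using cex.Hz_minus[of "\<lambda>n. x n - x' n"] by (simp add: hrel_def cex.Hd_minus)

text \<open>The class of 0 must have inverse 0 while its representatives need not vanish termwise,
  hence the case distinction on the whole sequence.\<close>

lemma hrel_inverse:
  assumes "hrel x y"
  shows "hrel (\<lambda>n. if Hzero cexF cexS x then 0 else inverse (x n))
              (\<lambda>n. if Hzero cexF cexS y then 0 else inverse (y n))"
proof (cases "Hzero cexF cexS x")
  case True
  then show ?thesis using hrel_Hz[OF assms] by (simp add: hrel_refl)
next
  case False
  then have ny: "\<not> Hzero cexF cexS y" using hrel_Hz[OF assms] by simp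
  have d: "Hdom cexF cexS (\<lambda>n. inverse (x n))" "Hdom cexF cexS (\<lambda>n. inverse (y n))"
    using False ny assms by (auto simp: hrel_def intro!: cex.Hd_inverse)
  have "Hzero cexF cexS (\<lambda>n. (x n - y n) * (inverse (x n) * inverse (y n)))"
    using assms d by (intro cex.Hz_mult cex.Hd_mult) (auto simp: hrel_def)
  then have "Hzero cexF cexS (\<lambda>n. inverse (y n) - inverse (x n))"
  proof (rule iffD1[OF cex.Hz_cong, rotated])
    show "cex.ev (\<lambda>n. (x n - y n) * (inverse (x n) * inverse (y n)) = inverse (y n) - inverse (x n))"
      using cex.not_Hz_nonzero[OF False] cex.not_Hz_nonzero[OF ny]
      by eventually_elim (simp add: field_simps)
  qed
  then have "Hzero cexF cexS (\<lambda>n. inverse (x n) - inverse (y n))"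
    using cex.Hz_minus[of "\<lambda>n. inverse (y n) - inverse (x n)"] by simp
  then show ?thesis using False ny d by (simp add: hrel_def)
qed

instantiation hfield :: field
begin

lift_definition zero_hfield :: hfield is "\<lambda>_. 0" by (simp add: hrel_refl)
lift_definition one_hfield :: hfield is "\<lambda>_. 1" by (simp add: hrel_refl)
lift_definition plus_hfield :: "hfield \<Rightarrow> hfield \<Rightarrow> hfield" is "\<lambda>x y n. x n + y n"
  by (rule hrel_add)
lift_definition times_hfield :: "hfield \<Rightarrow> hfield \<Rightarrow> hfield" is "\<lambda>x y n. x n * y n"
  by (rule hrel_mult)
lift_definition uminus_hfield :: "hfield \<Rightarrow> hfield" is "\<lambda>x n. - x n"
  by (rule hrel_minus)
lift_definition inverse_hfield :: "hfield \<Rightarrow> hfield" is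
  "\<lambda>x n. if Hzero cexF cexS x then 0 else inverse (x n)"
  by (rule hrel_inverse)
definition minus_hfield :: "hfield \<Rightarrow> hfield \<Rightarrow> hfield" where "minus_hfield x y = x + - y"
definition divide_hfield :: "hfield \<Rightarrow> hfield \<Rightarrow> hfield" where "divide_hfield x y = x * inverse y"

instance
proof
  fix a b c :: hfield
  show "a + b + c = a + (b + c)"
    by transfer (auto simp: hrel_refl add.assoc intro!: cex.Hd_add)
  show "a + b = b + a"
    by transfer (auto simp: hrel_refl add.commute intro!: cex.Hd_add)
  show "0 + a = a" by transfer (simp add: hrel_refl)
  show "- a + a = 0" by transfer (simp add: hrel_refl)
  show "a - b = a + - b" by (simp add: minus_hfield_def)
  show "a * b * c = a * (b * c)"
    by transfer (auto simp: hrel_refl mult.assoc intro!: cex.Hd_mult)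
  show "a * b = b * a"
    by transfer (auto simp: hrel_refl mult.commute intro!: cex.Hd_mult)
  show "1 * a = a" by transfer (simp add: hrel_refl)
  show "(a + b) * c = a * c + b * c"
    by transfer (auto simp: hrel_refl distrib_right intro!: cex.Hd_mult cex.Hd_add)
  show "(0::hfield) \<noteq> 1"
    by transfer (use cex.Hz_one cex.Hz_minus[of "\<lambda>_. 1"] in \<open>simp add: hrel_def\<close>)
  show "inverse (0::hfield) = 0" by transfer (simp add: hrel_refl)
  show "divide a b = a * inverse b" by (simp add: divide_hfield_def)
  show "inverse a * a = 1" if "a \<noteq> 0"
    using that
  proof transfer
    fix a assume a: "hrel a a" "\<not> hrel a (\<lambda>_. 0)"
    then have na: "\<not> Hzero cexF cexS a" and da: "Hdom cexF cexS a" by (auto simp: hrel_def)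
    have "Hzero cexF cexS (\<lambda>n. inverse (a n) * a n - 1)"
      using cex.Hz_zero
    proof (rule iffD1[OF cex.Hz_cong, rotated])
      show "cex.ev (\<lambda>n. 0 = inverse (a n) * a n - 1)"
        using cex.not_Hz_nonzero[OF na] by eventually_elim simp
    qed
    then show "hrel (\<lambda>n. (if Hzero cexF cexS a then 0 else inverse (a n)) * a n) (\<lambda>_. 1)"
      using na da cex.Hd_inverse[OF da na] by (simp add: hrel_def cex.Hd_mult)
  qed
qed

end

lemma abs_hfield_eq_iff:
  assumes "Hdom cexF cexS x" "Hdom cexF cexS y"
  shows "abs_hfield x = abs_hfield y \<longleftrightarrow> Hzero cexF cexS (\<lambda>n. x n - y n)"
  using Quotient_rel[OF Quotient_hfield, of x y] assms by (auto simp: hrel_def)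

lemma abs_hfield_zero: "abs_hfield (\<lambda>_. 0) = 0"
  by (simp add: zero_hfield.abs_eq)

lemma abs_hfield_one: "abs_hfield (\<lambda>_. 1) = 1"
  by (simp add: one_hfield.abs_eq)

lemma abs_hfield_add:
  "Hdom cexF cexS x \<Longrightarrow> Hdom cexF cexS y \<Longrightarrow> abs_hfield (\<lambda>n. x n + y n) = abs_hfield x + abs_hfield y"
  by (simp add: plus_hfield.abs_eq hrel_refl)

lemma abs_hfield_mult:
  "Hdom cexF cexS x \<Longrightarrow> Hdom cexF cexS y \<Longrightarrow> abs_hfield (\<lambda>n. x n * y n) = abs_hfield x * abs_hfield y"
  by (simp add: times_hfield.abs_eq hrel_refl)

lemma abs_hfield_surj: "\<exists>x. Hdom cexF cexS x \<and> abs_hfield x = h"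
  by (metis Quotient_abs_rep[OF Quotient_hfield] Quotient_rep_reflp[OF Quotient_hfield] hrel_refl)

text \<open>What the proof needs to know about \<open>x \<mapsto>\<close> class of \<open>x\<close>, as a partial map from sequences.\<close>

locale place_map = scaled +
  fixes \<phi> :: "(nat \<Rightarrow> complex) \<Rightarrow> 'h::field"
  assumes phi_add: "Hd x \<Longrightarrow> Hd y \<Longrightarrow> \<phi> (\<lambda>n. x n + y n) = \<phi> x + \<phi> y"
    and phi_mult: "Hd x \<Longrightarrow> Hd y \<Longrightarrow> \<phi> (\<lambda>n. x n * y n) = \<phi> x * \<phi> y"
    and phi_one: "\<phi> (\<lambda>_. 1) = 1"
    and phi_zero_iff: "Hd x \<Longrightarrow> \<phi> x = 0 \<longleftrightarrow> Hz x"
    and phi_surj: "\<exists>x. Hd x \<and> \<phi> x = h"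
begin

lemma phi_zero [simp]: "\<phi> (\<lambda>_. 0) = 0"
  by (simp add: phi_zero_iff)

lemma phi_minus: "Hd x \<Longrightarrow> \<phi> (\<lambda>n. - x n) = - \<phi> x"
  using phi_add[of x "\<lambda>n. - x n"] by (simp add: Hd_minus add_eq_0_iff)

lemma phi_diff: "Hd x \<Longrightarrow> Hd y \<Longrightarrow> \<phi> (\<lambda>n. x n - y n) = \<phi> x - \<phi> y"
  using phi_add[of x "\<lambda>n. - y n"] by (simp add: Hd_minus phi_minus)

lemma phi_eq_iff: "Hd x \<Longrightarrow> Hd y \<Longrightarrow> \<phi> x = \<phi> y \<longleftrightarrow> Hz (\<lambda>n. x n - y n)"
  using phi_zero_iff[OF Hd_diff[of x y]] by (simp add: phi_diff)

lemma phi_sum: "(\<And>i. i \<in> A \<Longrightarrow> Hd (f i)) \<Longrightarrow> \<phi> (\<lambda>n. \<Sum>i\<in>A. f i n) = (\<Sum>i\<in>A. \<phi> (f i))"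
  by (induction A rule: infinite_finite_induct) (auto simp: phi_add Hd_sum)

lemma phi_prod: "(\<And>i. i \<in> A \<Longrightarrow> Hd (f i)) \<Longrightarrow> \<phi> (\<lambda>n. \<Prod>i\<in>A. f i n) = (\<Prod>i\<in>A. \<phi> (f i))"
  by (induction A rule: infinite_finite_induct) (auto simp: phi_mult Hd_prod phi_one)

lemma phi_power: "Hd x \<Longrightarrow> \<phi> (\<lambda>n. x n ^ k) = \<phi> x ^ k"
  by (induction k) (auto simp: phi_mult Hd_power phi_one)

lemma phi_cong: "Hd x \<Longrightarrow> ev (\<lambda>n. x n = y n) \<Longrightarrow> \<phi> x = \<phi> y"
  using phi_eq_iff[of x y] Hd_cong[of x y] Hz_cong[of "\<lambda>n. x n - y n" "\<lambda>_. 0"]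
  by (auto elim: eventually_mono)

text \<open>Lift the monic polynomial to a sequence of monic complex polynomials and take a root of
  each. Their coefficients bound the roots, so the sequence of roots has finite norm and its class
  is a root.\<close>

lemma poly_has_root:
  fixes p :: "'h poly"
  assumes "degree p > 0" "lead_coeff p = 1"
  shows "\<exists>x. poly p x = 0"
proof -
  define m where "m = degree p"
  have "\<exists>x. Hd x \<and> \<phi> x = coeff p i" for i using phi_surj by blast
  then obtain a where a: "\<And>i. Hd (a i)" "\<And>i. \<phi> (a i) = coeff p i" by metis
  have "\<exists>z. z ^ m + (\<Sum>i<m. a i n * z ^ i) = 0" for n
  proof -
    have "\<exists>z. (\<Sum>i\<le>m. (if i = m then 1 else a i n) * z ^ i) = 0"
      using assms(1) by (intro alg_closed) (auto simp: m_def)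
    moreover have "(\<Sum>i\<le>m. (if i = m then 1 else a i n) * z ^ i) = z ^ m + (\<Sum>i<m. a i n * z ^ i)" for z
      by (simp add: lessThan_Suc_atMost[symmetric])
    ultimately show ?thesis by simp
  qed
  then obtain z where z: "\<And>n. z n ^ m + (\<Sum>i<m. a i n * z n ^ i) = 0" by metis
  \<comment> \<open>Cauchy's bound for the roots of a monic polynomial.\<close>
  have bound: "cmod (z n) \<le> 1 + (\<Sum>i<m. cmod (a i n))" for n
  proof (cases "cmod (z n) \<le> 1")
    case True
    then show ?thesis by (simp add: add_increasing2 sum_nonneg)
  next
    case False
    then have z1: "cmod (z n) > 1" by simp
    have "cmod (z n) ^ m = cmod (\<Sum>i<m. a i n * z n ^ i)"
      using z[of n] by (metis add_eq_0_iff norm_minus_cancel norm_power)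
    also have "\<dots> \<le> (\<Sum>i<m. cmod (a i n * z n ^ i))" by (rule norm_sum)
    also have "\<dots> \<le> (\<Sum>i<m. cmod (a i n) * cmod (z n) ^ (m - 1))"
      using z1 by (intro sum_mono) (auto simp: norm_mult norm_power intro!: mult_left_mono power_increasing)
    also have "\<dots> = (\<Sum>i<m. cmod (a i n)) * cmod (z n) ^ (m - 1)"
      by (simp add: sum_distrib_right)
    finally have "cmod (z n) * cmod (z n) ^ (m - 1) \<le> (\<Sum>i<m. cmod (a i n)) * cmod (z n) ^ (m - 1)"
      using assms(1) by (metis m_def power_minus_mult mult.commute)
    then have "cmod (z n) \<le> (\<Sum>i<m. cmod (a i n))"
      by (rule mult_right_le_imp_le) (rule zero_less_power, use z1 in linarith)
    then show ?thesis by simp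
  qed
  have Hdabs: "Hd (\<lambda>n. complex_of_real (cmod (a i n)))" for i
    by (rule Hd_mono[OF _ a(1)[of i]]) simp
  have "Hd (\<lambda>n. complex_of_real (1 + (\<Sum>i<m. cmod (a i n))))"
    unfolding of_real_add of_real_sum
    by (intro Hd_add Hd_sum Hdabs) simp
  then have Hz: "Hd z"
    by (rule Hd_mono[rotated]) (use bound in \<open>auto intro!: always_eventually simp: sum_nonneg simp del: of_real_add\<close>)
  have "poly p (\<phi> z) = (\<Sum>i\<le>m. coeff p i * \<phi> z ^ i)"
    by (simp add: poly_altdef m_def)
  also have "\<dots> = \<phi> z ^ m + (\<Sum>i<m. coeff p i * \<phi> z ^ i)"
    using assms(2) by (simp add: lessThan_Suc_atMost[symmetric] m_def)
  also have "\<dots> = \<phi> (\<lambda>n. z n ^ m + (\<Sum>i<m. a i n * z n ^ i))"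
    using Hz a by (simp add: phi_add phi_sum phi_mult phi_power Hd_power Hd_mult Hd_sum)
  also have "\<dots> = 0" by (simp add: z)
  finally show ?thesis by blast
qed

end

interpretation cex: place_map cexF cexS abs_hfield
  by unfold_locales
     (auto simp: abs_hfield_add abs_hfield_mult abs_hfield_one abs_hfield_surj
        abs_hfield_eq_iff[where y = "\<lambda>_. 0", simplified abs_hfield_zero, simplified])

instance hfield :: alg_closed_field
  by (rule alg_closedI) (rule cex.poly_has_root)

section \<open>Relative algebraic closure in the ultrapower\<close>

locale seq_ring =
  fixes F :: "nat filter" and R :: "(nat \<Rightarrow> complex) set"
  assumes ultra: "ultra F"
    and const: "(\<lambda>_. c) \<in> R"
    and add: "x \<in> R \<Longrightarrow> y \<in> R \<Longrightarrow> (\<lambda>n. x n + y n) \<in> R"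
    and mult: "x \<in> R \<Longrightarrow> y \<in> R \<Longrightarrow> (\<lambda>n. x n * y n) \<in> R"
begin

abbreviation "ev P \<equiv> eventually P F"

lemma minus: "x \<in> R \<Longrightarrow> (\<lambda>n. - x n) \<in> R"
  using mult[OF const[of "-1"], of x] by simp

lemma sum: "(\<And>i. i \<in> A \<Longrightarrow> f i \<in> R) \<Longrightarrow> (\<lambda>n. \<Sum>i\<in>A. f i n) \<in> R"
  by (induction A rule: infinite_finite_induct) (auto intro: const add)

lemma power: "x \<in> R \<Longrightarrow> (\<lambda>n. x n ^ k) \<in> R"
  by (induction k) (auto intro: const mult)

definition algebraics :: "(nat \<Rightarrow> complex) set" where
  "algebraics = {x. \<exists>m c. (\<forall>i\<le>m. c i \<in> R) \<and> ev (\<lambda>n. \<exists>i\<le>m. c i n \<noteq> 0) \<and>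
      ev (\<lambda>n. (\<Sum>i\<le>m. c i n * x n ^ i) = 0)}"

text \<open>Which coefficients vanish may depend on n, but the ultrafilter decides it for each
  index: the largest index with a coefficient non-zero along \<open>F\<close> is an honest degree.
  It is positive, since a lone constant term would have to vanish.\<close>

lemma top_coeff:
  assumes "ev (\<lambda>n. \<exists>i\<le>m. c i n \<noteq> 0)" "ev (\<lambda>n. (\<Sum>i\<le>m. c i n * x n ^ i) = (0::complex))"
  obtains k where "0 < k" "k \<le> m" "ev (\<lambda>n. c k n \<noteq> 0)"
    "ev (\<lambda>n. c k n * x n ^ k = - (\<Sum>i<k. c i n * x n ^ i))"
proof -
  define S where "S = {i. i \<le> m \<and> ev (\<lambda>n. c i n \<noteq> 0)}"
  have "\<exists>i\<in>{..m}. ev (\<lambda>n. c i n \<noteq> 0)"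
    using assms(1) ultra_bex[OF ultra, of "{..m}" "\<lambda>i n. c i n \<noteq> 0"]
    by (auto elim!: eventually_mono simp: Bex_def)
  then have S: "finite S" "S \<noteq> {}" by (auto simp: S_def)
  define k where "k = Max S"
  have k: "k \<in> S" using Max_in[OF S] by (simp add: k_def)
  have "ev (\<lambda>n. c i n = 0)" if "i \<in> {k<..m}" for i
  proof -
    have "i \<notin> S" using Max_ge[OF S(1), of i] that by (auto simp: k_def)
    then show ?thesis using that ultra_not[OF ultra, of "\<lambda>n. c i n \<noteq> 0"] by (auto simp: S_def)
  qed
  then have "ev (\<lambda>n. \<forall>i\<in>{k<..m}. c i n = 0)" by (intro eventually_ball_finite) auto
  with assms(2) have *: "ev (\<lambda>n. (\<Sum>i\<le>k. c i n * x n ^ i) = 0)"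
  proof eventually_elim
    case (elim n)
    have "(\<Sum>i\<le>m. c i n * x n ^ i) = (\<Sum>i\<le>k. c i n * x n ^ i)"
      using k elim(2) by (intro sum.mono_neutral_right) (auto simp: S_def)
    then show ?case using elim by simp
  qed
  then have **: "ev (\<lambda>n. c k n * x n ^ k = - (\<Sum>i<k. c i n * x n ^ i))"
    by (rule eventually_mono) (simp add: lessThan_Suc_atMost[symmetric] eq_neg_iff_add_eq_0 add.commute)
  have ck: "ev (\<lambda>n. c k n \<noteq> 0)" using k by (simp add: S_def)
  have "k \<noteq> 0"
  proof
    assume "k = 0"
    from ** ck have "ev (\<lambda>n. False)" by eventually_elim (simp add: \<open>k = 0\<close>)
    then show False using ultra_bot[OF ultra] by simp
  qed
  then show ?thesis using that[of k] ck ** k by (auto simp: S_def)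
qed

text \<open>\<open>x\<close> is algebraic iff, up to a denominator \<open>b\<close>, it acts on a non-zero finitely generated
  \<open>R\<close>-module of sequences; a single module can serve finitely many \<open>x\<close>, which makes closure
  under the field operations immediate.\<close>

definition rspan :: "(nat \<Rightarrow> complex) set \<Rightarrow> (nat \<Rightarrow> complex) set" where
  "rspan V = {w. \<exists>r. (\<forall>v\<in>V. r v \<in> R) \<and> ev (\<lambda>n. w n = (\<Sum>v\<in>V. r v n * v n))}"

lemma rspan_zero: "(\<lambda>_. 0) \<in> rspan V"
  unfolding rspan_def by (auto intro!: exI[of _ "\<lambda>_ _. 0"] const)

lemma rspan_add:
  assumes "w \<in> rspan V" "u \<in> rspan V"
  shows "(\<lambda>n. w n + u n) \<in> rspan V"
proof -
  obtain r s where r: "\<forall>v\<in>V. r v \<in> R" "ev (\<lambda>n. w n = (\<Sum>v\<in>V. r v n * v n))"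
    and s: "\<forall>v\<in>V. s v \<in> R" "ev (\<lambda>n. u n = (\<Sum>v\<in>V. s v n * v n))"
    using assms by (auto simp: rspan_def)
  from r(2) s(2) have "ev (\<lambda>n. w n + u n = (\<Sum>v\<in>V. (r v n + s v n) * v n))"
    by eventually_elim (simp add: sum.distrib algebra_simps)
  then show ?thesis
    unfolding rspan_def using r(1) s(1) by (auto intro!: exI[of _ "\<lambda>v n. r v n + s v n"] add)
qed

lemma rspan_mult:
  assumes "w \<in> rspan V" "a \<in> R"
  shows "(\<lambda>n. a n * w n) \<in> rspan V"
proof -
  obtain r where r: "\<forall>v\<in>V. r v \<in> R" "ev (\<lambda>n. w n = (\<Sum>v\<in>V. r v n * v n))"
    using assms by (auto simp: rspan_def)
  from r(2) have "ev (\<lambda>n. a n * w n = (\<Sum>v\<in>V. (a n * r v n) * v n))"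
    by eventually_elim (simp add: sum_distrib_left algebra_simps)
  then show ?thesis
    unfolding rspan_def using r(1) assms(2) by (auto intro!: exI[of _ "\<lambda>v n. a n * r v n"] mult)
qed

lemma rspan_gen:
  assumes "v \<in> V" "finite V"
  shows "v \<in> rspan V"
proof -
  have "v n = (\<Sum>u\<in>V. (if u = v then 1 else 0) * u n)" for n
    using assms by (simp add: if_distrib[of "\<lambda>x. x * _"] sum.delta cong: if_cong)
  then show ?thesis
    unfolding rspan_def by (auto intro!: exI[of _ "\<lambda>u n. if u = v then 1 else 0"] always_eventually const)
qed

lemma rspan_cong: "w \<in> rspan V \<Longrightarrow> ev (\<lambda>n. w n = u n) \<Longrightarrow> u \<in> rspan V"
proof -
  assume "w \<in> rspan V" and eq: "ev (\<lambda>n. w n = u n)"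
  then obtain r where r: "\<forall>v\<in>V. r v \<in> R" "ev (\<lambda>n. w n = (\<Sum>v\<in>V. r v n * v n))"
    by (auto simp: rspan_def)
  from r(2) eq have "ev (\<lambda>n. u n = (\<Sum>v\<in>V. r v n * v n))" by eventually_elim simp
  with r(1) show ?thesis unfolding rspan_def by blast
qed

lemma rspan_sum: "(\<And>i. i \<in> A \<Longrightarrow> f i \<in> rspan V) \<Longrightarrow> (\<lambda>n. \<Sum>i\<in>A. f i n) \<in> rspan V"
  by (induction A rule: infinite_finite_induct) (auto intro: rspan_zero rspan_add)

definition acts :: "(nat \<Rightarrow> complex) set \<Rightarrow> (nat \<Rightarrow> complex) \<Rightarrow> (nat \<Rightarrow> complex) set \<Rightarrow> bool" where
  "acts V b X \<longleftrightarrow> finite V \<and> ev (\<lambda>n. \<exists>v\<in>V. v n \<noteq> 0) \<and> b \<in> R \<and> ev (\<lambda>n. b n \<noteq> 0) \<and>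
     (\<forall>x\<in>X. \<forall>v\<in>V. (\<lambda>n. b n * x n * v n) \<in> rspan V)"

lemma acts_rspan:
  assumes "acts V b X" "x \<in> X" "w \<in> rspan V"
  shows "(\<lambda>n. b n * x n * w n) \<in> rspan V"
proof -
  obtain r where r: "\<forall>v\<in>V. r v \<in> R" "ev (\<lambda>n. w n = (\<Sum>v\<in>V. r v n * v n))"
    using assms by (auto simp: rspan_def)
  have "(\<lambda>n. \<Sum>v\<in>V. r v n * (b n * x n * v n)) \<in> rspan V"
  proof (rule rspan_sum)
    fix v assume "v \<in> V"
    then show "(\<lambda>n. r v n * (b n * x n * v n)) \<in> rspan V"
      using assms r by (intro rspan_mult[of "\<lambda>n. b n * x n * v n"]) (auto simp: acts_def)
  qed
  then show ?thesis
    by (rule rspan_cong) (use r(2) in \<open>auto elim!: eventually_mono simp: sum_distrib_left algebra_simps\<close>)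
qed

text \<open>Leibniz expansion, carried out in the ring \<open>P\<close> of sequences of polynomials
  with coefficients in \<open>R\<close>.\<close>

lemma coeff_char_poly_mem:
  assumes "\<And>i j. i < m \<Longrightarrow> j < m \<Longrightarrow> C i j \<in> R"
  shows "(\<lambda>n. coeff (char_poly (mat m m (\<lambda>(i, j). C i j n))) k) \<in> R"
proof -
  define P where "P = {p :: nat \<Rightarrow> complex poly. \<forall>k. (\<lambda>n. coeff (p n) k) \<in> R}"
  have Pmult: "(\<lambda>n. p n * q n) \<in> P" if "p \<in> P" "q \<in> P" for p q
    using that unfolding P_def by (auto simp: coeff_mult intro!: sum mult)
  have Pconst: "(\<lambda>n. p) \<in> P" for p unfolding P_def by (auto intro: const)
  have Pprod: "(\<lambda>n. \<Prod>i\<in>A. f i n) \<in> P" if "\<And>i. i \<in> A \<Longrightarrow> f i \<in> P" for A and f :: "nat \<Rightarrow> _"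
    using that by (induction A rule: infinite_finite_induct) (auto intro: Pmult Pconst)
  have Psum: "(\<lambda>n. \<Sum>i\<in>A. f i n) \<in> P" if "\<And>i. i \<in> A \<Longrightarrow> f i \<in> P" for A and f :: "(nat \<Rightarrow> nat) \<Rightarrow> _"
    using that unfolding P_def by (auto simp: coeff_sum intro!: sum)
  have entry: "(\<lambda>n. char_poly_matrix (mat m m (\<lambda>(i, j). C i j n)) $$ (i, j)) \<in> P"
    if "i < m" "j < m" for i j
  proof -
    have "char_poly_matrix (mat m m (\<lambda>(i, j). C i j n)) $$ (i, j) =
        (if i = j then [:0, 1:] else 0) + [:- C i j n:]" for n
      using that by (auto simp: char_poly_matrix_def)
    moreover have "(\<lambda>n. [:- C i j n:]) \<in> P"
      unfolding P_def
    proof (intro CollectI allI)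
      fix k show "(\<lambda>n. coeff [:- C i j n:] k) \<in> R"
        using assms[OF that] by (cases k) (auto intro: minus const)
    qed
    ultimately show ?thesis
      using Pconst[of "if i = j then [:0, 1:] else 0"] unfolding P_def by (auto intro!: add)
  qed
  have "(\<lambda>n. char_poly (mat m m (\<lambda>(i, j). C i j n))) \<in> P"
    unfolding char_poly_def
  proof (subst det_def')
    show "char_poly_matrix (mat m m (\<lambda>(i, j). C i j n)) \<in> carrier_mat m m" for n
      by (simp add: char_poly_matrix_def)
    show "(\<lambda>n. \<Sum>p | p permutes {0..<m}. signof p *
        (\<Prod>i = 0..<m. char_poly_matrix (mat m m (\<lambda>(i, j). C i j n)) $$ (i, p i))) \<in> P"
      by (intro Psum Pmult Pprod Pconst entry) (auto simp: permutes_in_image)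
  qed
  then show ?thesis by (simp add: P_def)
qed

text \<open>The determinant argument of Cayley and Hamilton: the generators form an eigenvector of
  the matrix of multiplication by \<open>b x\<close>, so \<open>b x\<close> is a root of its
  characteristic polynomial. The eigenvector is non-zero because some generator is non-zero at
  n.\<close>

lemma acts_imp_algebraic:
  assumes "acts V b {x}"
  shows "x \<in> algebraics"
proof -
  have fin: "finite V" and nz: "ev (\<lambda>n. \<exists>v\<in>V. v n \<noteq> 0)" and b: "b \<in> R" "ev (\<lambda>n. b n \<noteq> 0)"
    and act: "\<And>v. v \<in> V \<Longrightarrow> (\<lambda>n. b n * x n * v n) \<in> rspan V"
    using assms by (auto simp: acts_def)
  define m where "m = card V"
  obtain e where e: "bij_betw e {0..<m} V" using ex_bij_betw_nat_finite[OF fin] by (auto simp: m_def)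
  have eV: "e i \<in> V" if "i < m" for i using e that by (auto simp: bij_betw_def)
  have "\<forall>i\<in>{..<m}. \<exists>r. (\<forall>v\<in>V. r v \<in> R) \<and> ev (\<lambda>n. b n * x n * e i n = (\<Sum>v\<in>V. r v n * v n))"
    using act[OF eV] by (simp add: rspan_def)
  from bchoice[OF this] obtain r
    where r': "\<forall>i\<in>{..<m}. (\<forall>v\<in>V. r i v \<in> R) \<and> ev (\<lambda>n. b n * x n * e i n = (\<Sum>v\<in>V. r i v n * v n))" ..
  have r: "\<And>i v. i < m \<Longrightarrow> v \<in> V \<Longrightarrow> r i v \<in> R"
    "\<And>i. i < m \<Longrightarrow> ev (\<lambda>n. b n * x n * e i n = (\<Sum>v\<in>V. r i v n * v n))"
    using r' by auto
  define A where "A n = mat m m (\<lambda>(i, j). r i (e j) n)" for n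
  have A: "A n \<in> carrier_mat m m" for n by (simp add: A_def)
  \<comment> \<open>Absorbing the powers of \<open>b\<close> turns a relation for \<open>b x\<close>
    into one for \<open>x\<close> over \<open>R\<close>; its top coefficient is
    \<open>b ^ m\<close>, since the characteristic polynomial is monic.\<close>
  define c where "c k n = coeff (char_poly (A n)) k * b n ^ k" for k n
  have "ev (\<lambda>n. \<forall>i\<in>{..<m}. b n * x n * e i n = (\<Sum>v\<in>V. r i v n * v n))"
    using r(2) by (intro eventually_ball_finite) auto
  with nz have "ev (\<lambda>n. (\<Sum>i\<le>m. c i n * x n ^ i) = 0)"
  proof eventually_elim
    case (elim n)
    define w where "w = vec m (\<lambda>i. e i n)"
    have "A n *\<^sub>v w = (b n * x n) \<cdot>\<^sub>v w"
    proof
      fix i assume "i < dim_vec ((b n * x n) \<cdot>\<^sub>v w)"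
      then have i: "i < m" by (simp add: w_def)
      have "(A n *\<^sub>v w) $ i = (\<Sum>j = 0..<m. r i (e j) n * e j n)"
        using i by (simp add: A_def w_def scalar_prod_def)
      also have "\<dots> = (\<Sum>v\<in>V. r i v n * v n)"
        using sum.reindex_bij_betw[OF e, of "\<lambda>v. r i v n * v n"] by simp
      finally show "(A n *\<^sub>v w) $ i = ((b n * x n) \<cdot>\<^sub>v w) $ i"
        using elim(2) i by (simp add: w_def)
    qed (simp add: A_def w_def)
    moreover have "w \<noteq> 0\<^sub>v m"
    proof
      assume "w = 0\<^sub>v m"
      then have "e i n = 0" if "i < m" for i
        using that by (metis index_vec index_zero_vec(1) w_def)
      then have "v n = 0" if "v \<in> V" for v
        using e that by (force simp: bij_betw_def)
      with elim(1) show False by blast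
    qed
    ultimately have "eigenvalue (A n) (b n * x n)"
      unfolding eigenvalue_def eigenvector_def by (intro exI[of _ w]) (auto simp: w_def A_def)
    then have "poly (char_poly (A n)) (b n * x n) = 0"
      using eigenvalue_root_char_poly[OF A] by blast
    moreover have "degree (char_poly (A n)) = m"
      using degree_monic_char_poly[OF A] by simp
    ultimately show ?case
      by (simp add: poly_altdef c_def power_mult_distrib algebra_simps)
  qed
  moreover have "ev (\<lambda>n. \<exists>i\<le>m. c i n \<noteq> 0)"
    using b(2)
  proof eventually_elim
    case (elim n)
    then have "c m n \<noteq> 0" using degree_monic_char_poly[OF A, of n] by (auto simp: c_def)
    then show ?case by blast
  qed
  moreover have "c i \<in> R" for i
    unfolding c_def[abs_def] A_def using r(1) eV
    by (intro mult power b coeff_char_poly_mem) auto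
  ultimately show ?thesis unfolding algebraics_def by blast
qed

text \<open>Adjoins a root to the module. The coefficients \<open>g i\<close> need not lie in
  \<open>R\<close>, only to act on \<open>V\<close> with denominator \<open>b\<close>; thus the
  lemma serves both for elements algebraic over \<open>R\<close> and for elements algebraic over
  \<open>algebraics\<close>.\<close>

lemma acts_extend:
  assumes act: "acts V b X" and k: "0 < k" and e: "e \<in> R" "ev (\<lambda>n. e n \<noteq> 0)"
    and rel: "ev (\<lambda>n. e n * x n ^ k = (\<Sum>i<k. g i n * x n ^ i))"
    and g: "\<And>i v. i < k \<Longrightarrow> v \<in> V \<Longrightarrow> (\<lambda>n. b n * g i n * v n) \<in> rspan V"
  shows "\<exists>V' b'. acts V' b' (insert x X)"
proof -
  have fin: "finite V" and nz: "ev (\<lambda>n. \<exists>v\<in>V. v n \<noteq> 0)" and b: "b \<in> R" "ev (\<lambda>n. b n \<noteq> 0)"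
    and act': "\<And>y v. y \<in> X \<Longrightarrow> v \<in> V \<Longrightarrow> (\<lambda>n. b n * y n * v n) \<in> rspan V"
    using act by (auto simp: acts_def)
  \<comment> \<open>Generators \<open>v x^j\<close> with \<open>j < k\<close>. Multiplication by
    \<open>x\<close> raises \<open>j\<close>, and at \<open>j = k - 1\<close> the relation brings it
    back down, at the price of the extra denominator \<open>e\<close>.\<close>
  define V' where "V' = (\<lambda>(v, j) n. v n * x n ^ j) ` (V \<times> {..<k})"
  have V': "finite V'" using fin by (simp add: V'_def)
  have up: "(\<lambda>n. w n * x n ^ j) \<in> rspan V'" if w: "w \<in> rspan V" and j: "j < k" for w j
  proof -
    obtain r where r: "\<forall>v\<in>V. r v \<in> R" "ev (\<lambda>n. w n = (\<Sum>v\<in>V. r v n * v n))"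
      using w by (auto simp: rspan_def)
    have "(\<lambda>n. \<Sum>v\<in>V. r v n * (v n * x n ^ j)) \<in> rspan V'"
    proof (rule rspan_sum)
      fix v assume v: "v \<in> V"
      then have "(\<lambda>n. v n * x n ^ j) \<in> V'" using j by (auto simp: V'_def)
      then show "(\<lambda>n. r v n * (v n * x n ^ j)) \<in> rspan V'"
        using r(1) v by (intro rspan_mult rspan_gen V') auto
    qed
    then show ?thesis
    proof (rule rspan_cong)
      show "ev (\<lambda>n. (\<Sum>v\<in>V. r v n * (v n * x n ^ j)) = w n * x n ^ j)"
        using r(2) by eventually_elim (simp add: sum_distrib_right mult.assoc)
    qed
  qed
  have "(\<lambda>n. b n * e n * y n * (v n * x n ^ j)) \<in> rspan V'" if "y \<in> insert x X" "v \<in> V" "j < k" for y v j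
  proof (cases "y \<in> X")
    case True
    then have "(\<lambda>n. e n * (b n * y n * v n * x n ^ j)) \<in> rspan V'"
      using that by (intro rspan_mult[OF up e(1)] act') auto
    then show ?thesis by (rule rspan_cong) (simp add: algebra_simps)
  next
    case False
    then have y: "y = x" using that by simp
    show ?thesis
    proof (cases "Suc j < k")
      case True
      have "(\<lambda>n. (b n * e n) * (v n * x n ^ Suc j)) \<in> rspan V'"
        using that True fin by (intro rspan_mult[OF up mult[OF b(1) e(1)]] rspan_gen) auto
      then show ?thesis by (rule rspan_cong) (simp add: algebra_simps y)
    next
      case False
      then have j: "k = Suc j" using that by simp
      have "(\<lambda>n. \<Sum>i<k. (b n * g i n * v n) * x n ^ i) \<in> rspan V'"
        using that by (intro rspan_sum up g) auto
      then show ?thesis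
      proof (rule rspan_cong)
        show "ev (\<lambda>n. (\<Sum>i<k. (b n * g i n * v n) * x n ^ i) = b n * e n * y n * (v n * x n ^ j))"
          using rel
        proof eventually_elim
          case (elim n)
          have "(\<Sum>i<k. (b n * g i n * v n) * x n ^ i) = b n * v n * (\<Sum>i<k. g i n * x n ^ i)"
            by (simp add: sum_distrib_left algebra_simps)
          also have "\<dots> = b n * v n * (e n * x n ^ k)" by (simp only: elim)
          finally show ?case by (simp add: j y algebra_simps)
        qed
      qed
    qed
  qed
  then have "\<forall>y\<in>insert x X. \<forall>v\<in>V'. (\<lambda>n. b n * e n * y n * v n) \<in> rspan V'"
    by (auto simp: V'_def)
  moreover have "ev (\<lambda>n. \<exists>v\<in>V'. v n \<noteq> 0)"
    using nz
  proof eventually_elim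
    case (elim n)
    then obtain v where "v \<in> V" "v n \<noteq> 0" by blast
    moreover have "(\<lambda>n. v n * x n ^ 0) \<in> V'"
      unfolding V'_def by (rule image_eqI[of _ _ "(v, 0)"]) (use k \<open>v \<in> V\<close> in auto)
    ultimately show ?case by (intro bexI[of _ "\<lambda>n. v n * x n ^ 0"]) auto
  qed
  moreover have "ev (\<lambda>n. b n * e n \<noteq> 0)" using b(2) e(2) by eventually_elim simp
  ultimately have "acts V' (\<lambda>n. b n * e n) (insert x X)"
    using V' mult[OF b(1) e(1)] unfolding acts_def by simp
  then show ?thesis by blast
qed

lemma algebraics_acts:
  assumes "finite X" "X \<subseteq> algebraics"
  shows "\<exists>V b. acts V b X"
  using assms
proof induction
  case empty
  have "acts {\<lambda>_. 1} (\<lambda>_. 1) {}" by (simp add: acts_def const)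
  then show ?case by blast
next
  case (insert x X)
  then obtain V b where act: "acts V b X" by auto
  then have fin: "finite V" and b: "b \<in> R" by (auto simp: acts_def)
  obtain m c where c: "\<forall>i\<le>m. c i \<in> R" "ev (\<lambda>n. \<exists>i\<le>m. c i n \<noteq> 0)"
      "ev (\<lambda>n. (\<Sum>i\<le>m. c i n * x n ^ i) = 0)"
    using insert.prems by (auto simp: algebraics_def)
  obtain k where k: "0 < k" "k \<le> m" "ev (\<lambda>n. c k n \<noteq> 0)"
    "ev (\<lambda>n. c k n * x n ^ k = - (\<Sum>i<k. c i n * x n ^ i))"
    using top_coeff[OF c(2,3)] .
  show ?case
  proof (rule acts_extend[OF act k(1), of "c k" x "\<lambda>i n. - c i n"])
    show "ev (\<lambda>n. c k n * x n ^ k = (\<Sum>i<k. - c i n * x n ^ i))"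
      using k(4) by (simp add: sum_negf)
    show "(\<lambda>n. b n * - c i n * v n) \<in> rspan V" if "i < k" "v \<in> V" for i v
      using that c(1) k(2) fin by (intro rspan_mult[OF rspan_gen mult[OF b minus]]) auto
  qed (use c k in auto)
qed

lemma base_algebraic: "x \<in> R \<Longrightarrow> x \<in> algebraics"
  unfolding algebraics_def
  by (auto intro!: exI[of _ 1] exI[of _ "\<lambda>i. if i = 0 then \<lambda>n. - x n else (\<lambda>_. 1)"] minus const
        always_eventually)

lemma algebraics_cong:
  assumes "x \<in> algebraics" "ev (\<lambda>n. x n = y n)"
  shows "y \<in> algebraics"
proof -
  obtain m c where c: "\<forall>i\<le>m. c i \<in> R" "ev (\<lambda>n. \<exists>i\<le>m. c i n \<noteq> 0)"
      "ev (\<lambda>n. (\<Sum>i\<le>m. c i n * x n ^ i) = 0)"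
    using assms by (auto simp: algebraics_def)
  have "ev (\<lambda>n. (\<Sum>i\<le>m. c i n * y n ^ i) = 0)"
    using c(3) assms(2) by eventually_elim simp
  then show ?thesis using c unfolding algebraics_def by blast
qed

lemma algebraics_add_mult:
  assumes "x \<in> algebraics" "y \<in> algebraics"
  shows "(\<lambda>n. x n + y n) \<in> algebraics" "(\<lambda>n. x n * y n) \<in> algebraics"
proof -
  obtain V b where act: "acts V b {x, y}"
    using algebraics_acts[of "{x, y}"] assms by auto
  then have V: "finite V" "ev (\<lambda>n. \<exists>v\<in>V. v n \<noteq> 0)" and b: "b \<in> R" "ev (\<lambda>n. b n \<noteq> 0)"
    by (auto simp: acts_def)
  have "(\<lambda>n. b n * (x n + y n) * v n) \<in> rspan V" if "v \<in> V" for v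
    by (rule rspan_cong[OF rspan_add[of "\<lambda>n. b n * x n * v n" _ "\<lambda>n. b n * y n * v n"]])
       (use act that in \<open>auto simp: acts_def algebra_simps\<close>)
  then have "acts V b {\<lambda>n. x n + y n}" using V b by (simp add: acts_def)
  then show "(\<lambda>n. x n + y n) \<in> algebraics" by (rule acts_imp_algebraic)
  \<comment> \<open>The factors \<open>y\<close> and \<open>x\<close> are applied one after the
    other, each using up one denominator \<open>b\<close>.\<close>
  have "(\<lambda>n. b n * b n * (x n * y n) * v n) \<in> rspan V" if "v \<in> V" for v
    by (rule rspan_cong[OF acts_rspan[OF act, of x "\<lambda>n. b n * y n * v n"]])
       (use act that in \<open>auto simp: acts_def algebra_simps\<close>)
  moreover have "ev (\<lambda>n. b n * b n \<noteq> 0)" using b(2) by eventually_elim simp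
  ultimately have "acts V (\<lambda>n. b n * b n) {\<lambda>n. x n * y n}"
    using V mult[OF b(1) b(1)] by (simp add: acts_def)
  then show "(\<lambda>n. x n * y n) \<in> algebraics" by (rule acts_imp_algebraic)
qed

text \<open>Reverse the order of the coefficients. A sequence vanishing along \<open>F\<close> has
  inverse 0 there.\<close>

lemma algebraics_inverse:
  assumes "x \<in> algebraics"
  shows "(\<lambda>n. inverse (x n)) \<in> algebraics"
proof (cases "ev (\<lambda>n. x n = 0)")
  case True
  show ?thesis
    by (rule algebraics_cong[OF base_algebraic[OF const[of 0]]])
       (use True in \<open>auto elim: eventually_mono\<close>)
next
  case False
  then have nz: "ev (\<lambda>n. x n \<noteq> 0)" using ultra_not[OF ultra] by simp
  obtain m c where c: "\<forall>i\<le>m. c i \<in> R" "ev (\<lambda>n. \<exists>i\<le>m. c i n \<noteq> 0)"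
      "ev (\<lambda>n. (\<Sum>i\<le>m. c i n * x n ^ i) = 0)"
    using assms by (auto simp: algebraics_def)
  have "ev (\<lambda>n. (\<Sum>i\<le>m. c (m - i) n * inverse (x n) ^ i) = 0)"
    using c(3) nz
  proof eventually_elim
    case (elim n)
    have "(\<Sum>i\<le>m. c (m - i) n * inverse (x n) ^ i) = (\<Sum>i\<le>m. c i n * inverse (x n) ^ (m - i))"
      by (rule sum.reindex_bij_witness[of _ "\<lambda>i. m - i" "\<lambda>i. m - i"]) auto
    also have "\<dots> = inverse (x n) ^ m * (\<Sum>i\<le>m. c i n * x n ^ i)"
      unfolding sum_distrib_left using elim(2)
      by (intro sum.cong) (auto simp: power_diff field_simps)
    finally show ?case using elim by simp
  qed
  moreover have "ev (\<lambda>n. \<exists>i\<le>m. c (m - i) n \<noteq> 0)"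
    using c(2) by eventually_elim (metis diff_diff_cancel diff_le_self)
  ultimately show ?thesis
    using c(1) unfolding algebraics_def by (intro CollectI exI[of _ m] exI[of _ "\<lambda>i. c (m - i)"]) auto
qed

text \<open>Transitivity of algebraicity: after division by the leading coefficient, the finitely
  many coefficients act on a common module, and this module is enlarged by the powers of
  \<open>x\<close>.\<close>

lemma algebraics_closed:
  assumes c: "\<forall>i\<le>m. c i \<in> algebraics" "ev (\<lambda>n. \<exists>i\<le>m. c i n \<noteq> 0)"
    "ev (\<lambda>n. (\<Sum>i\<le>m. c i n * x n ^ i) = 0)"
  shows "x \<in> algebraics"
proof -
  obtain k where k: "0 < k" "k \<le> m" "ev (\<lambda>n. c k n \<noteq> 0)"
    "ev (\<lambda>n. c k n * x n ^ k = - (\<Sum>i<k. c i n * x n ^ i))"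
    using top_coeff[OF c(2,3)] .
  define g where "g i n = (-1) * c i n * inverse (c k n)" for i n
  have "g i \<in> algebraics" if "i < k" for i
    unfolding g_def[abs_def] using that c(1) k(2)
    by (intro algebraics_add_mult algebraics_inverse base_algebraic[OF const]) auto
  then obtain V b where act: "acts V b (g ` {..<k})"
    using algebraics_acts[of "g ` {..<k}"] by auto
  have "\<exists>V' b'. acts V' b' (insert x (g ` {..<k}))"
  proof (rule acts_extend[OF act k(1), of "\<lambda>_. 1" x g])
    show "ev (\<lambda>n. 1 * x n ^ k = (\<Sum>i<k. g i n * x n ^ i))"
      using k(3,4)
    proof eventually_elim
      case (elim n)
      have "(\<Sum>i<k. g i n * x n ^ i) = inverse (c k n) * - (\<Sum>i<k. c i n * x n ^ i)"
        by (simp add: g_def sum_distrib_left sum_negf algebra_simps)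
      also have "\<dots> = inverse (c k n) * (c k n * x n ^ k)" by (simp only: elim)
      finally show ?case using elim(1) by simp
    qed
  qed (use act const in \<open>auto simp: acts_def\<close>)
  then obtain V' b' where "acts V' b' {x}" by (auto simp: acts_def)
  then show ?thesis by (rule acts_imp_algebraic)
qed

lemma acl_field_algebraics: "acl_field F algebraics"
  unfolding acl_field_def
proof (intro conjI allI ballI impI; (elim conjE)?)
  show "x \<in> algebraics"
    if "\<forall>i\<le>m. c i \<in> algebraics" "ev (\<lambda>n. \<exists>i\<le>m. c i n \<noteq> 0)" "ev (\<lambda>n. (\<Sum>i\<le>m. c i n * x n ^ i) = 0)"
    for m c x using that by (rule algebraics_closed)
qed (auto intro: base_algebraic[OF const] algebraics_add_mult algebraics_inverse algebraics_cong)

end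

section \<open>Counting scales\<close>

lemma homogeneous_system_solution:
  fixes c :: "'a \<Rightarrow> 'b \<Rightarrow> 'c :: field"
  assumes "finite B" "finite Y" "card B < card Y"
  shows "\<exists>l. (\<exists>y\<in>Y. l y \<noteq> 0) \<and> (\<forall>b\<in>B. (\<Sum>y\<in>Y. l y * c y b) = 0)"
  using assms
proof (induction B arbitrary: Y c rule: finite_induct)
  case empty
  then have "Y \<noteq> {}" by auto
  then show ?case by (intro exI[of _ "\<lambda>_. 1"]) auto
next
  case (insert b B)
  show ?case
  proof (cases "\<forall>y\<in>Y. c y b = 0")
    case True
    have "card B < card Y" using insert by simp
    with insert.IH[OF insert.prems(1), of c] obtain l
      where "\<exists>y\<in>Y. l y \<noteq> 0" "\<forall>b\<in>B. (\<Sum>y\<in>Y. l y * c y b) = 0" by blast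
    then show ?thesis using True by (intro exI[of _ l]) auto
  next
    case False
    then obtain z where z: "z \<in> Y" "c z b \<noteq> 0" by auto
    \<comment> \<open>Gauss elimination: the pivot \<open>z\<close> clears the equation
      \<open>b\<close> from the other unknowns, and its own value is recovered in \<open>m\<close>
      below.\<close>
    define c' where "c' y b' = c y b' - c y b / c z b * c z b'" for y b'
    have "card B < card (Y - {z})" using insert z by simp
    with insert.IH[of "Y - {z}" c'] insert.prems(1) obtain l
      where l: "\<exists>y\<in>Y - {z}. l y \<noteq> 0" "\<forall>b\<in>B. (\<Sum>y\<in>Y - {z}. l y * c' y b) = 0" by auto
    define m where "m y = (if y = z then - (\<Sum>y\<in>Y - {z}. l y * (c y b / c z b)) else l y)" for y
    have split: "(\<Sum>y\<in>Y. m y * c y b') =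
        - (\<Sum>y\<in>Y - {z}. l y * (c y b / c z b)) * c z b' + (\<Sum>y\<in>Y - {z}. l y * c y b')" for b'
    proof -
      have "(\<Sum>y\<in>Y. m y * c y b') = m z * c z b' + (\<Sum>y\<in>Y - {z}. m y * c y b')"
        using insert.prems(1) z(1) by (rule sum.remove)
      also have "(\<Sum>y\<in>Y - {z}. m y * c y b') = (\<Sum>y\<in>Y - {z}. l y * c y b')"
        by (intro sum.cong) (auto simp: m_def)
      finally show ?thesis by (simp add: m_def)
    qed
    have "(\<Sum>y\<in>Y. m y * c y b') = 0" if "b' \<in> insert b B" for b'
    proof (cases "b' = b")
      case True
      then show ?thesis using z(2) unfolding split by (simp add: sum_distrib_right)
    next
      case False
      then have "(\<Sum>y\<in>Y - {z}. l y * c' y b') = 0" using l(2) that by auto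
      then show ?thesis
        unfolding split c'_def
        by (simp add: right_diff_distrib sum_subtractf sum_distrib_right mult.assoc)
    qed
    moreover have "\<exists>y\<in>Y. m y \<noteq> 0" using l(1) by (auto simp: m_def)
    ultimately show ?thesis by blast
  qed
qed

lemma finite_argmax:
  fixes f :: "'a \<Rightarrow> real"
  assumes "finite A" "A \<noteq> {}"
  obtains a where "a \<in> A" "\<forall>b\<in>A. f b \<le> f a"
proof -
  have "Max (f ` A) \<in> f ` A" using assms by (intro Max_in) auto
  then obtain a where a: "a \<in> A" "Max (f ` A) = f a" by auto
  moreover have "f b \<le> f a" if "b \<in> A" for b
    using assms(1) that by (simp flip: a(2))
  ultimately show ?thesis using that by blast
qed

section \<open>Polynomials in the parameters and the independence of scales\<close>

locale seq_poly =
  fixes F :: "nat filter" and T :: "nat \<Rightarrow> nat \<Rightarrow> complex" and k :: nat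
  assumes ultra: "ultra F"
begin

text \<open>The degree is bounded in each variable separately, which makes the number of monomials
  the exact power \<open>(D + 1) ^ k\<close>.\<close>

definition expo :: "nat \<Rightarrow> (nat \<Rightarrow> nat) set" where
  "expo D = PiE {..<k} (\<lambda>_. {..D})"

definition mon :: "(nat \<Rightarrow> nat) \<Rightarrow> nat \<Rightarrow> complex" where
  "mon a n = (\<Prod>i<k. T i n ^ a i)"

definition spoly :: "nat \<Rightarrow> (nat \<Rightarrow> complex) set" where
  "spoly D = {x. \<exists>c. \<forall>n. x n = (\<Sum>a\<in>expo D. c a * mon a n)}"

lemma finite_expo [simp]: "finite (expo D)"
  by (simp add: expo_def finite_PiE)

lemma card_expo: "card (expo D) = (D + 1) ^ k"
  by (simp add: expo_def card_PiE)

lemma spoly_mon: "a \<in> expo D \<Longrightarrow> mon a \<in> spoly D"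
  unfolding spoly_def
  by (auto intro!: exI[of _ "\<lambda>b. if b = a then 1 else 0"] simp: if_distrib[of "\<lambda>x. x * _"] sum.delta cong: if_cong)

lemma spoly_zero: "(\<lambda>_. 0) \<in> spoly D"
  unfolding spoly_def by (auto intro!: exI[of _ "\<lambda>_. 0"])

lemma spoly_add: "x \<in> spoly D \<Longrightarrow> y \<in> spoly D \<Longrightarrow> (\<lambda>n. x n + y n) \<in> spoly D"
proof -
  assume "x \<in> spoly D" "y \<in> spoly D"
  then obtain c d where "\<forall>n. x n = (\<Sum>a\<in>expo D. c a * mon a n)" "\<forall>n. y n = (\<Sum>a\<in>expo D. d a * mon a n)"
    by (auto simp: spoly_def)
  then show ?thesis
    unfolding spoly_def by (intro CollectI exI[of _ "\<lambda>a. c a + d a"]) (simp add: sum.distrib distrib_right)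
qed

lemma spoly_cmult: "x \<in> spoly D \<Longrightarrow> (\<lambda>n. c * x n) \<in> spoly D"
proof -
  assume "x \<in> spoly D"
  then obtain d where "\<forall>n. x n = (\<Sum>a\<in>expo D. d a * mon a n)"
    by (auto simp: spoly_def)
  then show ?thesis
    unfolding spoly_def by (intro CollectI exI[of _ "\<lambda>a. c * d a"]) (simp add: sum_distrib_left mult.assoc)
qed

lemma spoly_sum: "(\<And>i. i \<in> A \<Longrightarrow> f i \<in> spoly D) \<Longrightarrow> (\<lambda>n. \<Sum>i\<in>A. f i n) \<in> spoly D"
  by (induction A rule: infinite_finite_induct) (auto intro: spoly_zero spoly_add)

lemma spoly_mono: "x \<in> spoly D \<Longrightarrow> D \<le> D' \<Longrightarrow> x \<in> spoly D'"
proof -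
  assume "x \<in> spoly D" "D \<le> D'"
  then obtain c where c: "\<And>n. x n = (\<Sum>a\<in>expo D. c a * mon a n)" by (auto simp: spoly_def)
  have "expo D \<subseteq> expo D'" unfolding expo_def using \<open>D \<le> D'\<close> by (intro PiE_mono) auto
  then have "(\<lambda>n. \<Sum>a\<in>expo D. c a * mon a n) \<in> spoly D'"
    by (intro spoly_sum spoly_cmult spoly_mon) auto
  moreover have "x = (\<lambda>n. \<Sum>a\<in>expo D. c a * mon a n)" using c by (intro ext)
  ultimately show ?thesis by (simp only:)
qed

lemma spoly_mult:
  assumes "x \<in> spoly D" "y \<in> spoly D'"
  shows "(\<lambda>n. x n * y n) \<in> spoly (D + D')"
proof -
  obtain c d where c: "\<And>n. x n = (\<Sum>a\<in>expo D. c a * mon a n)"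
    and d: "\<And>n. y n = (\<Sum>a\<in>expo D'. d a * mon a n)"
    using assms by (auto simp: spoly_def)
  have mm: "mon a n * mon b n = mon (restrict (\<lambda>i. a i + b i) {..<k}) n" for a b n
    by (simp add: mon_def power_add prod.distrib)
  have "(\<lambda>n. \<Sum>a\<in>expo D. \<Sum>b\<in>expo D'. (c a * d b) * mon (restrict (\<lambda>i. a i + b i) {..<k}) n) \<in> spoly (D + D')"
    by (intro spoly_sum spoly_cmult spoly_mon) (auto simp: expo_def intro!: add_mono)
  moreover have "(\<lambda>n. x n * y n) = (\<lambda>n. \<Sum>a\<in>expo D. \<Sum>b\<in>expo D'. (c a * d b) * mon (restrict (\<lambda>i. a i + b i) {..<k}) n)"
    by (auto simp: fun_eq_iff c d sum_product mm[symmetric] algebra_simps intro!: sum.cong)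
  ultimately show ?thesis by simp
qed

lemma spoly_const: "(\<lambda>_. c) \<in> spoly 0"
proof -
  have "restrict (\<lambda>_. 0) {..<k} \<in> expo 0" by (simp add: expo_def)
  moreover have "mon (restrict (\<lambda>_. 0) {..<k}) = (\<lambda>_. 1)" by (simp add: mon_def fun_eq_iff)
  ultimately show ?thesis using spoly_cmult[OF spoly_mon, of "restrict (\<lambda>_. 0) {..<k}" 0 c] by simp
qed

lemma spoly_var: "j < k \<Longrightarrow> T j \<in> spoly 1"
proof -
  assume j: "j < k"
  define a where "a = restrict (\<lambda>i. if i = j then 1 else 0 :: nat) {..<k}"
  have "mon a n = T j n" for n
  proof -
    have "mon a n = (\<Prod>i<k. if i = j then T i n else 1)"
      unfolding mon_def by (intro prod.cong) (auto simp: a_def)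
    then show ?thesis using j by (simp add: prod.delta)
  qed
  then have "mon a = T j" by auto
  moreover have "a \<in> expo 1" by (auto simp: expo_def a_def)
  ultimately show ?thesis using spoly_mon by metis
qed

lemma spoly_prod:
  "finite A \<Longrightarrow> (\<And>i. i \<in> A \<Longrightarrow> f i \<in> spoly D) \<Longrightarrow> (\<lambda>n. \<Prod>i\<in>A. f i n) \<in> spoly (card A * D)"
proof (induction A rule: finite_induct)
  case empty
  then show ?case using spoly_const[of 1] by simp
next
  case (insert x A)
  then show ?case using spoly_mult[of "f x" D "\<lambda>n. \<Prod>i\<in>A. f i n" "card A * D"] by (simp add: add.commute)
qed

lemma spoly_power: "x \<in> spoly D \<Longrightarrow> (\<lambda>n. x n ^ j) \<in> spoly (j * D)"
proof (induction j)
  case 0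
  then show ?case using spoly_const[of 1] by simp
next
  case (Suc j)
  then show ?case using spoly_mult[of x D "\<lambda>n. x n ^ j" "j * D"] by (simp add: add.commute)
qed

definition spolys :: "(nat \<Rightarrow> complex) set" where
  "spolys = (\<Union>D. spoly D)"

lemma spoly_common:
  assumes "finite A" "\<And>i. i \<in> A \<Longrightarrow> f i \<in> spolys"
  shows "\<exists>D. \<forall>i\<in>A. f i \<in> spoly D"
  using assms
proof (induction A rule: finite_induct)
  case (insert x A)
  then obtain D where D: "\<forall>i\<in>A. f i \<in> spoly D" by blast
  have "f x \<in> spolys" using insert.prems by blast
  then obtain D' where "f x \<in> spoly D'" unfolding spolys_def by blast
  then have "\<forall>i\<in>insert x A. f i \<in> spoly (max D D')"
    using D spoly_mono[OF _ max.cobounded1[of D D']] spoly_mono[OF _ max.cobounded2[of D' D]] by blast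
  then show ?case by blast
qed blast

sublocale seq_ring F spolys
proof
  show "ultra F" by (rule ultra)
  show "(\<lambda>_. c) \<in> spolys" for c using spoly_const by (auto simp: spolys_def)
  show "(\<lambda>n. x n + y n) \<in> spolys" "(\<lambda>n. x n * y n) \<in> spolys" if xy: "x \<in> spolys" "y \<in> spolys" for x y
  proof -
    obtain D D' where D: "x \<in> spoly D" "y \<in> spoly D'"
      using xy unfolding spolys_def by blast
    then have "x \<in> spoly (max D D')" "y \<in> spoly (max D D')"
      by (blast intro: spoly_mono max.cobounded1 max.cobounded2)+
    from spoly_add[OF this] spoly_mult[OF D]
    show "(\<lambda>n. x n + y n) \<in> spolys" "(\<lambda>n. x n * y n) \<in> spolys"
      unfolding spolys_def by blast+
  qed
qed

text \<open>The number \<open>l\<close> is the logarithm of the norm of \<open>p / q\<close> at the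
  scale \<open>e\<close>, so \<open>l \<noteq> 0\<close> says that this norm is none of 0, 1,
  \<infinity>; neither \<open>p\<close> nor \<open>q\<close> has to have a finite norm. Working with
  pairs avoids the fraction field.\<close>

definition jump :: "(nat \<Rightarrow> real) \<Rightarrow> (nat \<Rightarrow> complex) \<Rightarrow> (nat \<Rightarrow> complex) \<Rightarrow> real \<Rightarrow> bool" where
  "jump e p q l \<longleftrightarrow> ev (\<lambda>n. p n \<noteq> 0) \<and> ev (\<lambda>n. q n \<noteq> 0) \<and>
     ((\<lambda>n. e n * (ln (cmod (p n)) - ln (cmod (q n)))) \<longlongrightarrow> l) F"

text \<open>The Newton polygon argument: in the equation of \<open>x\<close> the largest term is
  balanced by another one of comparable size. Hence \<open>c j / c i\<close> has the size of
  \<open>x ^ (i - j)\<close> up to a bounded factor, and its norm inherits non-triviality from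
  \<open>x\<close>.\<close>

lemma jump_exists:
  assumes e: "scale e" "(e \<longlongrightarrow> 0) F" and nt: "\<not> trivially_valued F e algebraics"
  shows "\<exists>p\<in>spolys. \<exists>q\<in>spolys. \<exists>l. l \<noteq> 0 \<and> jump e p q l"
proof -
  interpret E: small_scaled F e by unfold_locales (use ultra e in auto)
  obtain x where x: "x \<in> algebraics" "E.Hd x" "E.nrm x \<noteq> 0" "E.nrm x \<noteq> 1"
    using nt by (auto simp: trivially_valued_def)
  define r where "r = ln (E.nrm x)"
  have pos: "0 < E.nrm x" using E.nrm_nonneg[of x] x by simp
  then have r: "r \<noteq> 0" using x by (simp add: r_def)
  have xnz: "ev (\<lambda>n. x n \<noteq> 0)" using E.not_Hz_nonzero[of x] E.Hz_iff_nrm[OF x(2)] x(3) by simp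
  have "((\<lambda>n. ln (E.N x n)) \<longlongrightarrow> r) F"
    unfolding r_def using tendsto_ln[OF E.nrm_tendsto[OF x(2)]] pos by simp
  moreover have "ev (\<lambda>n. ln (E.N x n) = e n * ln (cmod (x n)))"
    using xnz by eventually_elim (simp add: E.N_def ln_powr)
  ultimately have lim: "((\<lambda>n. e n * ln (cmod (x n))) \<longlongrightarrow> r) F"
    using tendsto_cong[of "\<lambda>n. ln (E.N x n)" "\<lambda>n. e n * ln (cmod (x n))" F r] by simp
  obtain m c where c: "\<forall>i\<le>m. c i \<in> spolys" "ev (\<lambda>n. \<exists>i\<le>m. c i n \<noteq> 0)"
      "ev (\<lambda>n. (\<Sum>i\<le>m. c i n * x n ^ i) = 0)"
    using x(1) by (auto simp: algebraics_def)
  define near where "near = (\<lambda>(i, j) n. i \<noteq> j \<and> c i n \<noteq> 0 \<and> c j n \<noteq> 0 \<and>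
     cmod (c j n * x n ^ j) \<le> cmod (c i n * x n ^ i) \<and>
     cmod (c i n * x n ^ i) \<le> real (Suc m) * cmod (c j n * x n ^ j))"
  have "ev (\<lambda>n. \<exists>ij\<in>{..m} \<times> {..m}. near ij n)"
    using c(2,3) xnz
  proof eventually_elim
    case (elim n)
    define t where "t i = c i n * x n ^ i" for i
    obtain i where i: "i \<le> m" "\<And>j. j \<le> m \<Longrightarrow> cmod (t j) \<le> cmod (t i)"
      using finite_argmax[of "{..m}" "\<lambda>i. cmod (t i)"] by (metis finite_atMost atMost_iff empty_iff le0)
    obtain i' where i': "i' \<le> m" "c i' n \<noteq> 0" using elim(1) by auto
    then have "t i' \<noteq> 0" using elim(3) by (simp add: t_def)
    then have ti: "cmod (t i) > 0" using i(2)[OF i'(1)] by (metis less_le_trans zero_less_norm_iff)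
    \<comment> \<open>Otherwise the \<open>m\<close> other terms, each at most
      \<open>1 / (m + 1)\<close> of the largest, could not cancel it.\<close>
    have "\<exists>j\<in>{..m} - {i}. cmod (t i) \<le> real (Suc m) * cmod (t j)"
    proof (rule ccontr)
      assume "\<not> ?thesis"
      then have *: "cmod (t j) \<le> cmod (t i) / real (Suc m)" if "j \<in> {..m} - {i}" for j
        using that by (auto simp: field_simps not_le intro: less_imp_le)
      have "t i = - (\<Sum>j\<in>{..m} - {i}. t j)"
        using elim(2) i(1) by (simp add: t_def sum.remove[of "{..m}" i] eq_neg_iff_add_eq_0)
      then have "cmod (t i) \<le> (\<Sum>j\<in>{..m} - {i}. cmod (t j))"
        using norm_sum[of t "{..m} - {i}"] by simp
      also have "\<dots> \<le> (\<Sum>j\<in>{..m} - {i}. cmod (t i) / real (Suc m))"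
        by (intro sum_mono *)
      also have "\<dots> = real m * cmod (t i) / real (Suc m)"
        using i(1) by simp
      also have "\<dots> < cmod (t i)" using ti by (simp add: field_simps)
      finally show False by simp
    qed
    then obtain j where j: "j \<le> m" "j \<noteq> i" "cmod (t i) \<le> real (Suc m) * cmod (t j)" by auto
    then have "t j \<noteq> 0" using ti by auto
    then show ?case using i j ti unfolding near_def t_def by (intro bexI[of _ "(i, j)"]) auto
  qed
  then obtain i j where ij: "i \<le> m" "j \<le> m" "ev (near (i, j))"
    using ultra_bex[OF ultra, of "{..m} \<times> {..m}" near] by auto
  have inj: "i \<noteq> j"
  proof
    assume "i = j"
    then have "ev (\<lambda>n. False)" using ij(3) by (simp add: near_def)
    then show False using ultra_bot[OF ultra] by simp
  qed
  \<comment> \<open>The logarithm of the ratio of the two comparable terms \<open>c j x^j\<close>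
    and \<open>c i x^i\<close>, hence bounded.\<close>
  define Z where "Z n = ln (cmod (c j n)) - ln (cmod (c i n)) - (real i - real j) * ln (cmod (x n))" for n
  have Zb: "ev (\<lambda>n. \<bar>Z n\<bar> \<le> ln (real (Suc m)))"
    using ij(3) xnz
  proof eventually_elim
    case (elim n)
    have nz: "c i n \<noteq> 0" "c j n \<noteq> 0" using elim by (auto simp: near_def)
    have Z: "Z n = ln (cmod (c j n * x n ^ j)) - ln (cmod (c i n * x n ^ i))"
      using nz elim(2) by (simp add: Z_def norm_mult norm_power ln_mult ln_realpow algebra_simps)
    have "ln (cmod (c j n * x n ^ j)) \<le> ln (cmod (c i n * x n ^ i))"
      using nz elim unfolding near_def by (subst ln_le_cancel_iff) auto
    moreover have "ln (cmod (c i n * x n ^ i)) \<le> ln (real (Suc m) * cmod (c j n * x n ^ j))"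
      using nz elim unfolding near_def by (subst ln_le_cancel_iff) auto
    moreover have "ln (real (Suc m) * cmod (c j n * x n ^ j)) = ln (real (Suc m)) + ln (cmod (c j n * x n ^ j))"
      using nz elim by (subst ln_mult) auto
    ultimately show ?case unfolding Z by linarith
  qed
  \<comment> \<open>A bounded discrepancy is invisible at a scale tending to 0.\<close>
  have "((\<lambda>n. e n * Z n) \<longlongrightarrow> 0) F"
  proof (rule tendsto_0_le[OF e(2)])
    show "ev (\<lambda>n. norm (e n * Z n) \<le> norm (e n) * ln (real (Suc m)))"
      using Zb
    proof eventually_elim
      case (elim n)
      then show ?case using E.eta_pos[of n] by (simp add: abs_mult)
    qed
  qed
  then have "((\<lambda>n. e n * Z n + (real i - real j) * (e n * ln (cmod (x n)))) \<longlongrightarrow> 0 + (real i - real j) * r) F"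
    by (intro tendsto_add tendsto_mult tendsto_const lim)
  moreover have "e n * Z n + (real i - real j) * (e n * ln (cmod (x n))) =
      e n * (ln (cmod (c j n)) - ln (cmod (c i n)))" for n
    by (simp add: Z_def algebra_simps)
  ultimately have "jump e (c j) (c i) ((real i - real j) * r)"
    unfolding jump_def using ij(3) by (auto simp: near_def elim: eventually_mono)
  moreover have "(real i - real j) * r \<noteq> 0" using inj r by simp
  ultimately show ?thesis using c(1) ij by blast
qed

text \<open>The pointwise minimum is attained by one and the same scale along the ultrafilter. Its
  ratios to the others are bounded by 1, and a non-zero limit would make two scales
  equivalent.\<close>

lemma scales_separate:
  assumes fin: "finite E" and ne: "E \<noteq> {}" and sc: "\<And>e. e \<in> E \<Longrightarrow> scale e"
    and ineq: "\<And>e e'. e \<in> E \<Longrightarrow> e' \<in> E \<Longrightarrow> e \<noteq> e' \<Longrightarrow> \<not> scale_equiv F e e'"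
  shows "\<exists>s\<in>E. \<forall>e\<in>E - {s}. ((\<lambda>n. s n / e n) \<longlongrightarrow> 0) F"
proof -
  have "ev (\<lambda>n. \<exists>s\<in>E. \<forall>e\<in>E. s n \<le> e n)"
  proof (intro always_eventually allI)
    fix n
    show "\<exists>s\<in>E. \<forall>e\<in>E. s n \<le> e n"
      using finite_argmax[OF fin ne, of "\<lambda>e. - e n"] by (metis neg_le_iff_le)
  qed
  then obtain s where s: "s \<in> E" "ev (\<lambda>n. \<forall>e\<in>E. s n \<le> e n)"
    using ultra_bex[OF ultra fin, of "\<lambda>s n. \<forall>e\<in>E. s n \<le> e n"] by blast
  have "((\<lambda>n. s n / e n) \<longlongrightarrow> 0) F" if e: "e \<in> E - {s}" for e
  proof -
    have "ev (\<lambda>n. \<bar>s n / e n\<bar> \<le> 1)"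
      using s(2)
    proof eventually_elim
      case (elim n)
      then have "s n \<le> e n" "0 < s n" "0 < e n" using e s(1) sc by (auto simp: scale_def)
      then show ?case by simp
    qed
    then obtain r where r: "((\<lambda>n. s n / e n) \<longlongrightarrow> r) F"
      using ultra_bounded_tendsto[OF ultra] by metis
    then have w: "wlim F (\<lambda>n. s n / e n) = ereal r" using wlim_eq_ereal[OF ultra] by blast
    have "0 \<le> s n / e n" for n using sc[of s] sc[of e] s(1) e by (simp add: scale_def less_imp_le)
    then have "0 \<le> wlim F (\<lambda>n. s n / e n)" by (intro wlim_nonneg ultra) simp
    moreover have "\<not> scale_equiv F s e" using ineq s(1) e by auto
    ultimately have "r = 0" unfolding scale_equiv_def w by auto
    then show ?thesis using r by simp
  qed
  then show ?thesis using s(1) by blast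
qed

text \<open>Suitable products of the witnesses \<open>p\<close>, \<open>q\<close> have pairwise incomparable moduli, so they
  are linearly independent over the constants; there are more of them than monomials of the
  corresponding degree in the parameters.\<close>

theorem card_jump_scales:
  assumes fin: "finite E" and sc: "\<And>e. e \<in> E \<Longrightarrow> scale e" and small: "\<And>e. e \<in> E \<Longrightarrow> (e \<longlongrightarrow> 0) F"
    and ineq: "\<And>e e'. e \<in> E \<Longrightarrow> e' \<in> E \<Longrightarrow> e \<noteq> e' \<Longrightarrow> \<not> scale_equiv F e e'"
    and w: "\<And>e. e \<in> E \<Longrightarrow> \<exists>p\<in>spolys. \<exists>q\<in>spolys. \<exists>l. l \<noteq> 0 \<and> jump e p q l"
  shows "card E \<le> k"
proof (rule ccontr)
  assume "\<not> card E \<le> k"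
  then have cE: "Suc k \<le> card E" by simp
  obtain p q l where pq: "\<And>e. e \<in> E \<Longrightarrow> p e \<in> spolys" "\<And>e. e \<in> E \<Longrightarrow> q e \<in> spolys"
    "\<And>e. e \<in> E \<Longrightarrow> l e \<noteq> 0" "\<And>e. e \<in> E \<Longrightarrow> jump e (p e) (q e) (l e)"
    using w by metis
  obtain D1 where D1: "\<forall>e\<in>E. p e \<in> spoly D1" using spoly_common[OF fin, of p] pq by blast
  obtain D2 where D2: "\<forall>e\<in>E. q e \<in> spoly D2" using spoly_common[OF fin, of q] pq by blast
  \<comment> \<open>The successor keeps \<open>s * D\<close> positive, which the estimate of the
    number of monomials uses.\<close>
  define D where "D = Suc (max D1 D2)"
  have D: "p e \<in> spoly D" "q e \<in> spoly D" if "e \<in> E" for e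
    using that D1 D2 by (auto simp: D_def intro: spoly_mono)
  define s where "s = card E"
  \<comment> \<open>Chosen so that \<open>(s * K * D + 1) ^ k \<le> (s * D) ^ k * (K + 1) ^ k = K *
    (K + 1) ^ k < (K + 1) ^ Suc k\<close>: fewer monomials than the \<open>(K + 1) ^ s\<close>
    products.\<close>
  define K where "K = (s * D) ^ k"
  define Y where "Y = PiE E (\<lambda>_. {..K})"
  \<comment> \<open>The complementary exponent on \<open>q\<close> avoids denominators:
    \<open>y b / y a\<close> is the product of the powers
    \<open>(p e / q e) ^ (b e - a e)\<close>.\<close>
  define y where "y a n = (\<Prod>e\<in>E. p e n ^ a e * q e n ^ (K - a e))" for a :: "(nat \<Rightarrow> real) \<Rightarrow> nat" and n
  have finY: "finite Y" using fin by (simp add: Y_def finite_PiE)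
  have "y a \<in> spoly (s * (K * D))" if "a \<in> Y" for a
  proof -
    have "(\<lambda>n. p e n ^ a e * q e n ^ (K - a e)) \<in> spoly (K * D)" if "e \<in> E" for e
    proof -
      have "a e \<le> K" using \<open>a \<in> Y\<close> that by (auto simp: Y_def)
      then have "a e * D + (K - a e) * D = K * D" by (simp flip: distrib_right)
      then show ?thesis
        using spoly_mult[OF spoly_power[OF D(1)[OF that]] spoly_power[OF D(2)[OF that]], of "a e" "K - a e"] by simp
    qed
    then show ?thesis unfolding y_def[abs_def] s_def by (intro spoly_prod fin) auto
  qed
  then have "\<forall>a\<in>Y. \<exists>c. \<forall>n. y a n = (\<Sum>b\<in>expo (s * (K * D)). c b * mon b n)"
    by (auto simp: spoly_def)
  then obtain c where c: "\<And>a n. a \<in> Y \<Longrightarrow> y a n = (\<Sum>b\<in>expo (s * (K * D)). c a b * mon b n)" by metis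
  have "card (expo (s * (K * D))) < card Y"
  proof -
    have "1 \<le> s * D" using cE by (simp add: s_def D_def)
    then have "(s * (K * D) + 1) \<le> (s * D) * (K + 1)" by (simp add: algebra_simps)
    then have "(s * (K * D) + 1) ^ k \<le> ((s * D) * (K + 1)) ^ k" by (rule power_mono) simp
    also have "\<dots> = K * (K + 1) ^ k" unfolding power_mult_distrib[of "s * D"] K_def ..
    also have "\<dots> < (K + 1) ^ Suc k" by simp
    also have "\<dots> \<le> (K + 1) ^ s" using cE by (intro power_increasing) (auto simp: s_def)
    finally show ?thesis using fin by (simp add: card_expo Y_def card_PiE s_def)
  qed
  from homogeneous_system_solution[OF finite_expo finY this, of c] obtain h
    where h: "\<exists>a\<in>Y. h a \<noteq> 0" "\<forall>b\<in>expo (s * (K * D)). (\<Sum>a\<in>Y. h a * c a b) = 0" by blast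
  have rel: "(\<Sum>a\<in>Y. h a * y a n) = 0" for n
  proof -
    have "(\<Sum>a\<in>Y. h a * y a n) = (\<Sum>a\<in>Y. \<Sum>b\<in>expo (s * (K * D)). h a * c a b * mon b n)"
      using c by (simp add: sum_distrib_left mult.assoc)
    also have "\<dots> = (\<Sum>b\<in>expo (s * (K * D)). (\<Sum>a\<in>Y. h a * c a b) * mon b n)"
      by (subst sum.swap) (simp add: sum_distrib_right)
    finally show ?thesis using h(2) by simp
  qed
  define S where "S = {a\<in>Y. h a \<noteq> 0}"
  have S: "finite S" "S \<noteq> {}" using finY h(1) by (auto simp: S_def)
  have "ev (\<lambda>n. \<exists>a\<in>S. \<forall>b\<in>S. cmod (y b n) \<le> cmod (y a n))"
  proof (intro always_eventually allI)
    fix n show "\<exists>a\<in>S. \<forall>b\<in>S. cmod (y b n) \<le> cmod (y a n)"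
      using finite_argmax[OF S, of "\<lambda>a. cmod (y a n)"] by metis
  qed
  \<comment> \<open>Among the products that occur in the linear relation with a non-zero
    coefficient, one has the largest modulus along the filter.\<close>
  then obtain a where a: "a \<in> S" "ev (\<lambda>n. \<forall>b\<in>S. cmod (y b n) \<le> cmod (y a n))"
    using ultra_bex[OF ultra S(1), of "\<lambda>a n. \<forall>b\<in>S. cmod (y b n) \<le> cmod (y a n)"] by blast
  have "ev (\<lambda>n. \<forall>e\<in>E. p e n \<noteq> 0 \<and> q e n \<noteq> 0)"
    using pq(4) fin by (intro eventually_ball_finite) (auto simp: jump_def intro: eventually_conj)
  then have ynz: "ev (\<lambda>n. \<forall>e\<in>E. p e n \<noteq> 0 \<and> q e n \<noteq> 0)" .
  define X where "X e n = ln (cmod (p e n)) - ln (cmod (q e n))" for e n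
  have ratio: "((\<lambda>n. y b n / y a n) \<longlongrightarrow> 0) F" if b: "b \<in> S - {a}" for b
  proof -
    define \<delta> where "\<delta> e = real (b e) - real (a e)" for e
    define Z where "Z n = (\<Sum>e\<in>E. \<delta> e * X e n)" for n
    have bY: "b e \<le> K" "a e \<le> K" if "e \<in> E" for e
      using a(1) b that by (auto simp: S_def Y_def)
    have lny: "ev (\<lambda>n. cmod (y b n / y a n) = exp (Z n))"
      using ynz
    proof eventually_elim
      case (elim n)
      have ln: "ln (cmod (y d n)) = (\<Sum>e\<in>E. real (d e) * X e n + real K * ln (cmod (q e n)))"
        if "\<And>e. e \<in> E \<Longrightarrow> d e \<le> K" for d
      proof -
        have "ln (cmod (y d n)) = (\<Sum>e\<in>E. ln (cmod (p e n ^ d e * q e n ^ (K - d e))))"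
          unfolding y_def prod_norm[symmetric] using elim fin by (intro ln_prod) auto
        also have "\<dots> = (\<Sum>e\<in>E. real (d e) * X e n + real K * ln (cmod (q e n)))"
          using elim that
          by (intro sum.cong) (auto simp: norm_mult norm_power ln_mult ln_realpow X_def of_nat_diff algebra_simps)
        finally show ?thesis .
      qed
      have nz: "y a n \<noteq> 0" "y b n \<noteq> 0" using elim fin by (auto simp: y_def)
      have "ln (cmod (y b n / y a n)) = ln (cmod (y b n)) - ln (cmod (y a n))"
        using nz by (simp add: norm_divide ln_div)
      also have "\<dots> = Z n"
        using ln[of b] ln[of a] bY
        by (simp add: Z_def \<delta>_def left_diff_distrib sum_subtractf[symmetric] sum.distrib)
      finally show ?case using nz by (metis exp_ln zero_less_norm_iff divide_eq_0_iff)
    qed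
    \<comment> \<open>Only scales at which the exponents differ contribute to \<open>Z\<close>. As
      \<open>X e\<close> grows like \<open>l e / e\<close>, the smallest of these scales,
      \<open>t\<close>, governs the size of the ratio.\<close>
    define E' where "E' = {e\<in>E. \<delta> e \<noteq> 0}"
    have "E' \<noteq> {}"
    proof
      assume "E' = {}"
      then have "\<forall>e\<in>E. b e = a e" by (auto simp: E'_def \<delta>_def)
      then have "b = a" using a(1) b by (intro PiE_ext[of b E "\<lambda>_. {..K}" a]) (auto simp: S_def Y_def)
      then show False using b by simp
    qed
    then obtain t where t: "t \<in> E'" "\<forall>e\<in>E' - {t}. ((\<lambda>n. t n / e n) \<longlongrightarrow> 0) F"
      using scales_separate[of E'] fin sc ineq by (auto simp: E'_def)
    have tE: "t \<in> E" "\<delta> t \<noteq> 0" using t by (auto simp: E'_def)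
    have tpos: "0 < t n" for n using sc[OF tE(1)] by (simp add: scale_def)
    have XL: "((\<lambda>n. e n * X e n) \<longlongrightarrow> l e) F" if "e \<in> E" for e
      using pq(4)[OF that] by (simp add: jump_def X_def)
    have "((\<lambda>n. \<Sum>e\<in>E. t n * (\<delta> e * X e n)) \<longlongrightarrow> (\<Sum>e\<in>E. if e = t then \<delta> t * l t else 0)) F"
    proof (intro tendsto_sum)
      fix e assume e: "e \<in> E"
      show "((\<lambda>n. t n * (\<delta> e * X e n)) \<longlongrightarrow> (if e = t then \<delta> t * l t else 0)) F"
      proof (cases "e = t")
        case True
        then show ?thesis using tendsto_mult_left[OF XL[OF e], of "\<delta> e"] by (simp add: algebra_simps)
      next
        case False
        show ?thesis
        proof (cases "\<delta> e = 0")
          case True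
          then show ?thesis using False by simp
        next
          case ne: False
          then have "e \<in> E' - {t}" using e False by (simp add: E'_def)
          then have "((\<lambda>n. \<delta> e * ((t n / e n) * (e n * X e n))) \<longlongrightarrow> \<delta> e * (0 * l e)) F"
            using t(2) by (intro tendsto_mult tendsto_const XL e) auto
          moreover have "e n \<noteq> 0" for n using sc[OF e] by (simp add: scale_def less_imp_neq[THEN not_sym])
          ultimately show ?thesis using False by (simp add: field_simps)
        qed
      qed
    qed
    then have lim: "((\<lambda>n. t n * Z n) \<longlongrightarrow> \<delta> t * l t) F"
      using fin tE by (simp add: Z_def sum_distrib_left sum.delta)
    have "ev (\<lambda>n. Z n \<le> 0)"
      using a(2) lny ynz
    proof eventually_elim
      case (elim n)
      have "y a n \<noteq> 0" using elim(3) fin by (simp add: y_def)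
      then have "cmod (y b n / y a n) \<le> 1" using elim(1) b by (simp add: norm_divide)
      then show ?case using elim(2) by simp
    qed
    then have "ev (\<lambda>n. t n * Z n \<le> 0)"
      using tpos by (auto elim!: eventually_mono simp: mult_nonneg_nonpos less_imp_le)
    then have "\<delta> t * l t \<le> 0" by (intro tendsto_upperbound[OF lim _ ultra_bot[OF ultra]])
    \<comment> \<open>By maximality of \<open>y a\<close> the limit is not positive, and it is not
      zero; so \<open>Z\<close> itself, of order \<open>\<delta> t * l t / t\<close>, tends to minus
      infinity and the ratio of the two products to 0.\<close>
    then have neg: "\<delta> t * l t < 0" using tE pq(3) by (auto simp: le_less)
    have "filterlim t (at_right 0) F"
      using small[OF tE(1)] tpos by (auto simp: filterlim_at intro!: always_eventually less_imp_neq[THEN not_sym])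
    then have "filterlim (\<lambda>n. inverse (t n)) at_top F"
      by (rule filterlim_compose[OF filterlim_inverse_at_top_right])
    then have "filterlim (\<lambda>n. t n * Z n * inverse (t n)) at_bot F"
      using lim neg by (intro filterlim_tendsto_neg_mult_at_bot)
    moreover have "t n * Z n * inverse (t n) = Z n" for n using tpos[of n] by simp
    ultimately have "((\<lambda>n. exp (Z n)) \<longlongrightarrow> 0) F"
      using filterlim_compose[OF exp_at_bot, of Z F] by simp
    then have "((\<lambda>n. cmod (y b n / y a n)) \<longlongrightarrow> 0) F"
      using lny tendsto_cong[OF lny] by blast
    then show ?thesis by (rule tendsto_norm_zero_cancel)
  qed
  \<comment> \<open>Dividing the linear relation by its dominant product leaves only the coefficient
    \<open>h a\<close> in the limit, which was non-zero.\<close>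
  have "((\<lambda>n. \<Sum>b\<in>S - {a}. h b * (y b n / y a n)) \<longlongrightarrow> (\<Sum>b\<in>S - {a}. h b * 0)) F"
    by (intro tendsto_sum tendsto_mult tendsto_const ratio)
  moreover have "ev (\<lambda>n. (\<Sum>b\<in>S - {a}. h b * (y b n / y a n)) = - h a)"
    using ynz
  proof eventually_elim
    case (elim n)
    have nz: "y a n \<noteq> 0" using elim fin by (simp add: y_def)
    have "(\<Sum>b\<in>S. h b * y b n) = 0"
      using rel[of n] finY by (subst sum.mono_neutral_left[of Y]) (auto simp: S_def)
    then have "h a * y a n + (\<Sum>b\<in>S - {a}. h b * y b n) = 0"
      using sum.remove[OF S(1) a(1), of "\<lambda>b. h b * y b n"] by simp
    then have "(\<Sum>b\<in>S - {a}. h b * y b n) / y a n = - h a"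
      using nz by (simp add: field_simps eq_neg_iff_add_eq_0)
    then show ?case by (simp add: sum_divide_distrib)
  qed
  ultimately have "((\<lambda>n. - h a) \<longlongrightarrow> 0) F" 
    using tendsto_cong[of "\<lambda>n. \<Sum>b\<in>S - {a}. h b * (y b n / y a n)" "\<lambda>n. - h a" F 0] by simp
  then have "h a = 0" using tendsto_unique[OF ultra_bot[OF ultra], of "\<lambda>n. - h a" "- h a" 0] by simp
  then show False using a(1) by (simp add: S_def)
qed

end

section \<open>Coprime pairs over a subfield\<close>

definition subfield_set :: "'a::field set \<Rightarrow> bool" where
  "subfield_set S \<longleftrightarrow> 0 \<in> S \<and> 1 \<in> S \<and> (\<forall>x\<in>S. \<forall>y\<in>S. x + y \<in> S \<and> x * y \<in> S) \<and>
     (\<forall>x\<in>S. - x \<in> S \<and> inverse x \<in> S)"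

definition polys_over :: "'a::zero set \<Rightarrow> 'a poly set" where
  "polys_over S = {p. \<forall>i. coeff p i \<in> S}"

context
  fixes S :: "'a::field set"
  assumes S: "subfield_set S"
begin

lemma sub_sum: "(\<And>i. i \<in> A \<Longrightarrow> f i \<in> S) \<Longrightarrow> (\<Sum>i\<in>A. f i) \<in> S"
  using S by (induction A rule: infinite_finite_induct) (auto simp: subfield_set_def)

lemma sub_prod: "(\<And>i. i \<in> A \<Longrightarrow> f i \<in> S) \<Longrightarrow> (\<Prod>i\<in>A. f i) \<in> S"
  using S by (induction A rule: infinite_finite_induct) (auto simp: subfield_set_def)

lemma polys_over_0: "0 \<in> polys_over S" and polys_over_1: "1 \<in> polys_over S"
  using S by (auto simp: polys_over_def subfield_set_def coeff_1)

lemma polys_over_add: "p \<in> polys_over S \<Longrightarrow> q \<in> polys_over S \<Longrightarrow> p + q \<in> polys_over S"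
  using S by (auto simp: polys_over_def subfield_set_def)

lemma polys_over_uminus: "p \<in> polys_over S \<Longrightarrow> - p \<in> polys_over S"
  using S by (auto simp: polys_over_def subfield_set_def)

lemma polys_over_diff: "p \<in> polys_over S \<Longrightarrow> q \<in> polys_over S \<Longrightarrow> p - q \<in> polys_over S"
  using polys_over_add[OF _ polys_over_uminus, of p q] by simp

lemma polys_over_mult: "p \<in> polys_over S \<Longrightarrow> q \<in> polys_over S \<Longrightarrow> p * q \<in> polys_over S"
  using S unfolding polys_over_def coeff_mult by (auto intro!: sub_sum simp: coeff_mult subfield_set_def)

lemma polys_over_division:
  assumes "p \<in> polys_over S" "q \<in> polys_over S" "q \<noteq> 0"
  shows "\<exists>a r. a \<in> polys_over S \<and> r \<in> polys_over S \<and> p = a * q + r \<and> (r = 0 \<or> degree r < degree q)"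
  using assms(1)
proof (induction "degree p" arbitrary: p rule: less_induct)
  case less
  show ?case
  proof (cases "p = 0 \<or> degree p < degree q")
    case True
    then show ?thesis using less.prems polys_over_0 by (intro exI[of _ 0] exI[of _ p]) auto
  next
    case False
    then have p: "p \<noteq> 0" "degree q \<le> degree p" by auto
    define m where "m = monom (lead_coeff p * inverse (lead_coeff q)) (degree p - degree q)"
    have m: "m \<in> polys_over S"
      using S less.prems assms(2) by (auto simp: m_def polys_over_def subfield_set_def)
    define p' where "p' = p - m * q"
    have p': "p' \<in> polys_over S" unfolding p'_def using less.prems m assms(2) by (intro polys_over_diff polys_over_mult)
    have nz: "lead_coeff p * inverse (lead_coeff q) \<noteq> 0" using p assms(3) by simp
    have dm0: "degree m = degree p - degree q" "m \<noteq> 0"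
      unfolding m_def using degree_monom_eq[OF nz] nz by auto
    have dm: "degree (m * q) = degree p"
      using degree_mult_eq[OF dm0(2) assms(3)] dm0(1) p by simp
    have lc: "lead_coeff (m * q) = lead_coeff p"
      using assms(3) by (simp add: lead_coeff_mult dm0(1)) (simp add: m_def)
    have "\<exists>a r. a \<in> polys_over S \<and> r \<in> polys_over S \<and> p' = a * q + r \<and> (r = 0 \<or> degree r < degree q)"
    proof (cases "p' = 0")
      case True
      then show ?thesis using polys_over_0 by (intro exI[of _ 0]) auto
    next
      case False
      have "degree p' \<le> degree p" unfolding p'_def using dm by (intro degree_diff_le) auto
      moreover have "coeff p' (degree p) = 0" using lc dm by (simp add: p'_def)
      ultimately have "degree p' < degree p"
        using False by (metis leading_coeff_0_iff le_less)
      then show ?thesis using less.hyps p' by blast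
    qed
    then obtain a r where ar: "a \<in> polys_over S" "r \<in> polys_over S" "p' = a * q + r" "r = 0 \<or> degree r < degree q"
      by blast
    then have "p = (a + m) * q + r" by (simp add: p'_def algebra_simps)
    then show ?thesis using ar m by (intro exI[of _ "a + m"] exI[of _ r]) (auto intro: polys_over_add)
  qed
qed

text \<open>Euclid's algorithm never leaves \<open>S\<close>. What matters is that dividing a pair
  over \<open>S\<close> by its common factor gives a coprime pair which is again over
  \<open>S\<close>.\<close>

lemma polys_over_bezout:
  assumes "p \<in> polys_over S" "q \<in> polys_over S" "p \<noteq> 0 \<or> q \<noteq> 0"
  shows "\<exists>d p' q' x y. p' \<in> polys_over S \<and> q' \<in> polys_over S \<and> d \<noteq> 0 \<and>
     p = d * p' \<and> q = d * q' \<and> x * p' + y * q' = 1"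
  using assms
proof (induction "if q = 0 then 0 else Suc (degree q)" arbitrary: p q rule: less_induct)
  case less
  show ?case
  proof (cases "q = 0")
    case True
    then show ?thesis using less.prems polys_over_0 polys_over_1
      by (intro exI[of _ p] exI[of _ 1] exI[of _ 0] exI[of _ 1] exI[of _ 0]) auto
  next
    case False
    obtain a r where ar: "a \<in> polys_over S" "r \<in> polys_over S" "p = a * q + r" "r = 0 \<or> degree r < degree q"
      using polys_over_division[OF less.prems(1,2) False] by blast
    have "(if r = 0 then 0 else Suc (degree r)) < (if q = 0 then 0 else Suc (degree q))"
      using ar(4) False by auto
    from less.hyps[OF this less.prems(2) ar(2)] False obtain d q' r' x y where
      *: "q' \<in> polys_over S" "r' \<in> polys_over S" "d \<noteq> 0" "q = d * q'" "r = d * r'" "x * q' + y * r' = 1" by blast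
    have "p = d * (a * q' + r')" using ar(3) * by (simp add: algebra_simps)
    moreover have "y * (a * q' + r') + (x - y * a) * q' = 1"
      using *(6) by (simp add: algebra_simps)
    moreover have "a * q' + r' \<in> polys_over S" using * ar by (intro polys_over_add polys_over_mult)
    ultimately show ?thesis using * by blast
  qed
qed

end

text \<open>Each row lists, from the top, the coefficients of a monomial times \<open>p\<close> or
  \<open>q\<close>. A linear relation between the rows is therefore a syzygy
  \<open>u * p + v * q = 0\<close> with \<open>u\<close> and \<open>v\<close> of degree below
  \<open>k\<close>.\<close>

lemma sylvester_row:
  fixes p q :: "'a :: comm_ring_1 poly"
  assumes "degree p \<le> k" "degree q \<le> k" "i < 2 * k" "j < 2 * k"
  shows "sylvester_mat_sub k k p q $$ (i, j) =
    coeff (if i < k then monom 1 (k - 1 - i) * p else monom 1 (2 * k - 1 - i) * q) (2 * k - 1 - j)"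
proof -
  have "i < k + k" "j < k + k" using assms by auto
  note idx = sylvester_mat_sub_index[OF this, of p q]
  show ?thesis
  proof (cases "i < k")
    case True
    consider "i \<le> j" "j - i \<le> k" | "j < i" | "j - i > k" by linarith
    then show ?thesis
    proof cases
      case 1
      then have "\<not> 2 * k - 1 - j < k - 1 - i" "2 * k - 1 - j - (k - 1 - i) = k + i - j" using True assms by auto
      then show ?thesis using True 1 by (simp add: idx coeff_monom_mult)
    next
      case 2
      then have "k < 2 * k - 1 - j - (k - 1 - i)" using True assms by auto
      then show ?thesis using True 2 assms by (simp add: idx coeff_monom_mult coeff_eq_0)
    next
      case 3
      then have "2 * k - 1 - j < k - 1 - i" using True assms by auto
      then show ?thesis using True 3 by (simp add: idx coeff_monom_mult)
    qed
  next
    case False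
    consider "i - k \<le> j" "j \<le> i" | "j < i - k" | "i < j" by linarith
    then show ?thesis
    proof cases
      case 1
      then have "\<not> 2 * k - 1 - j < 2 * k - 1 - i" "2 * k - 1 - j - (2 * k - 1 - i) = i - j" using False assms by auto
      then show ?thesis using False 1 by (simp add: idx coeff_monom_mult)
    next
      case 2
      then have "k < 2 * k - 1 - j - (2 * k - 1 - i)" using False assms by auto
      then show ?thesis using False 2 assms by (simp add: idx coeff_monom_mult coeff_eq_0)
    next
      case 3
      then have "2 * k - 1 - j < 2 * k - 1 - i" using False assms by auto
      then show ?thesis using False 3 by (simp add: idx coeff_monom_mult)
    qed
  qed
qed

text \<open>By coprimality \<open>p\<close> divides \<open>v\<close>, whose degree is
  smaller.\<close>

lemma coprime_small_syzygy:
  fixes p q u v :: "'a :: field poly"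
  assumes "x * p + y * q = 1" "degree p = k" "v = 0 \<or> degree v < k" "u * p + v * q = 0" "p \<noteq> 0"
  shows "u = 0 \<and> v = 0"
proof -
  have "v = v * (x * p + y * q)" using assms(1) by simp
  also have "\<dots> = p * (v * x - y * u) + y * (u * p + v * q)" by (simp add: algebra_simps)
  also have "\<dots> = p * (v * x - y * u)" by (simp add: assms(4))
  finally have v: "v = p * (v * x - y * u)" .
  have "v = 0"
  proof (rule ccontr)
    assume "v \<noteq> 0"
    then have "degree v = degree p + degree (v * x - y * u)"
      using v degree_mult_eq[of p "v * x - y * u"] by (metis mult_eq_0_iff)
    then show False using assms(2,3) \<open>v \<noteq> 0\<close> by simp
  qed
  then show ?thesis using assms(4,5) by simp
qed

lemma degree_sum_monom_less:
  fixes c :: "nat \<Rightarrow> 'a :: comm_ring_1"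
  assumes "0 < k"
  shows "degree (\<Sum>i<k. smult (c i) (monom 1 (k - 1 - i))) < k"
proof -
  have "degree (\<Sum>i<k. smult (c i) (monom 1 (k - 1 - i))) \<le> k - 1"
    by (intro degree_sum_le) (auto intro!: le_trans[OF degree_smult_le] le_trans[OF degree_monom_le])
  then show ?thesis using assms by simp
qed

lemma sum_monom_eq_0:
  fixes c :: "nat \<Rightarrow> 'a :: comm_ring_1"
  assumes "(\<Sum>i<k. smult (c i) (monom 1 (k - 1 - i))) = 0" "i < k"
  shows "c i = 0"
proof -
  have "(\<Sum>j<k. if j = i then c j else 0) = (\<Sum>j<k. coeff (smult (c j) (monom 1 (k - 1 - j))) (k - 1 - i))"
    using assms(2) by (intro sum.cong) auto
  also have "\<dots> = coeff (\<Sum>i<k. smult (c i) (monom 1 (k - 1 - i))) (k - 1 - i)"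
    by (simp only: coeff_sum)
  also have "\<dots> = 0" by (simp only: assms(1) coeff_0)
  finally have "(\<Sum>j<k. if j = i then c j else 0) = 0" .
  moreover have "(\<Sum>j<k. if j = i then c j else 0) = c i" using assms(2) by (subst sum.delta) auto
  ultimately show ?thesis by (simp only:)
qed

text \<open>A vector annihilated by the transposed matrix is a syzygy of small degree; it vanishes
  by \<open>coprime_small_syzygy\<close>, applied to whichever of the two polynomials has exact
  degree \<open>k\<close>.\<close>

lemma sylvester_nonzero:
  fixes p q :: "'a :: field poly"
  assumes deg: "degree p \<le> k" "degree q \<le> k" and eq: "degree p = k \<or> degree q = k" and k: "0 < k"
    and bez: "x * p + y * q = 1"
  shows "det (sylvester_mat_sub k k p q) \<noteq> 0"
proof
  let ?S = "sylvester_mat_sub k k p q"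
  assume "det ?S = 0"
  have cS: "?S \<in> carrier_mat (2 * k) (2 * k)" 
    using sylvester_mat_sub_carrier[of k k p q] by (simp only: mult_2)
  then have "det (transpose_mat ?S) = 0" using \<open>det ?S = 0\<close> by (simp add: det_transpose)
  then obtain w where w: "w \<in> carrier_vec (2 * k)" "w \<noteq> 0\<^sub>v (2 * k)" "transpose_mat ?S *\<^sub>v w = 0\<^sub>v (2 * k)"
    using det_0_iff_vec_prod_zero_field[of "transpose_mat ?S" "2 * k"] cS by auto
  define R where "R i = (if i < k then monom 1 (k - 1 - i) * p else monom 1 (2 * k - 1 - i) * q)" for i
  have col: "(\<Sum>i<2 * k. w $ i * coeff (R i) (2 * k - 1 - j)) = 0" if j: "j < 2 * k" for j
  proof -
    have "(transpose_mat ?S *\<^sub>v w) $ j = (\<Sum>i<2 * k. ?S $$ (i, j) * w $ i)"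
      using j w(1) cS by (auto simp: scalar_prod_def lessThan_atLeast0 intro!: sum.cong)
    also have "\<dots> = (\<Sum>i<2 * k. w $ i * coeff (R i) (2 * k - 1 - j))"
      using j deg by (intro sum.cong) (auto simp: sylvester_row R_def)
    finally show ?thesis using w(3) j by simp
  qed
  define u where "u = (\<Sum>i<k. smult (w $ i) (monom 1 (k - 1 - i)))"
  define v where "v = (\<Sum>i<k. smult (w $ (k + i)) (monom 1 (k - 1 - i)))"
  have du: "degree u < k" and dv: "degree v < k"
    unfolding u_def v_def
    using degree_sum_monom_less[OF k, of "\<lambda>i. w $ i"] degree_sum_monom_less[OF k, of "\<lambda>i. w $ (k + i)"]
    by auto
  have uv: "u * p + v * q = (\<Sum>i<2 * k. smult (w $ i) (R i))"
  proof -
    have "(\<Sum>i<2 * k. smult (w $ i) (R i)) = (\<Sum>i<k. smult (w $ i) (R i)) + (\<Sum>i<k. smult (w $ (k + i)) (R (k + i)))"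
      unfolding mult_2 lessThan_atLeast0 sum.atLeastLessThan_concat[of 0 k "k + k", symmetric, simplified]
      using sum.shift_bounds_nat_ivl[of "\<lambda>i. smult (w $ i) (R i)" 0 k k] by (simp add: add.commute)
    also have "(\<Sum>i<k. smult (w $ i) (R i)) = u * p"
      unfolding u_def sum_distrib_right by (intro sum.cong) (auto simp: R_def)
    also have "(\<Sum>i<k. smult (w $ (k + i)) (R (k + i))) = v * q"
      unfolding v_def sum_distrib_right by (intro sum.cong) (auto simp: R_def mult_2)
    finally show ?thesis by simp
  qed
  have "u * p + v * q = 0"
  proof (rule poly_eqI)
    fix m
    show "coeff (u * p + v * q) m = coeff 0 m"
    proof (cases "m < 2 * k")
      case True
      then have "2 * k - 1 - (2 * k - 1 - m) = m" by simp
      then show ?thesis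
        using col[of "2 * k - 1 - m"] True k unfolding uv by (simp add: coeff_sum)
    next
      case False
      have "degree (u * p) < 2 * k" "degree (v * q) < 2 * k"
        using degree_mult_le[of u p] degree_mult_le[of v q] du dv deg by linarith+
      then show ?thesis using False by (simp add: coeff_eq_0)
    qed
  qed
  moreover have "u = 0 \<and> v = 0"
  proof (cases "degree p = k")
    case True
    then have "p \<noteq> 0" using k by auto
    then show ?thesis using coprime_small_syzygy[OF bez True _ \<open>u * p + v * q = 0\<close>] dv by blast
  next
    case False
    then have dq: "degree q = k" using eq by blast
    then have "q \<noteq> 0" using k by auto
    moreover have "y * q + x * p = 1" "v * q + u * p = 0" using bez \<open>u * p + v * q = 0\<close> by (simp_all add: add.commute)
    ultimately show ?thesis using coprime_small_syzygy[of y q x p k u v] dq du by blast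
  qed
  ultimately have "w $ i = 0" if "i < 2 * k" for i
  proof (cases "i < k")
    case True
    show ?thesis
      by (rule sum_monom_eq_0[of "\<lambda>i. w $ i", OF _ True]) (use \<open>u = 0 \<and> v = 0\<close> in \<open>simp only: u_def\<close>)
  next
    case False
    then have i: "i - k < k" "k + (i - k) = i" using that by auto
    have "w $ (k + (i - k)) = 0"
      by (rule sum_monom_eq_0[of "\<lambda>i. w $ (k + i)", OF _ i(1)]) (use \<open>u = 0 \<and> v = 0\<close> in \<open>simp only: v_def\<close>)
    then show ?thesis by (simp only: i(2))
  qed
  then have "w = 0\<^sub>v (2 * k)" using w(1) by (intro eq_vecI) auto
  then show False using w(2) by blast
qed

lemma nondegD:
  assumes "nondeg k g"
  shows "degree (fst g) \<le> k" "degree (snd g) \<le> k" "v \<noteq> (0, 0) \<Longrightarrow> hev2 k g v \<noteq> (0, 0)"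
  using assms unfolding nondeg_def by blast+

text \<open>Two coprime descriptions of one map differ by a scalar. Cross multiplication and the
  Bezout relation give \<open>a = p * e\<close> and \<open>b = q * e\<close>; a zero of
  \<open>e\<close> would be a common zero of \<open>a\<close> and \<open>b\<close>.\<close>

lemma alg_closed_coprime_scalar:
  fixes a b p q c d :: "'a :: alg_closed_field poly"
  assumes bez: "x * p + y * q = 1" and ab: "nondeg k (a, b)" "1 \<le> k" and cd: "c \<noteq> 0" "d \<noteq> 0"
    and eq: "c * a = d * p" "c * b = d * q"
  obtains u where "u \<noteq> 0" "a = smult u p" "b = smult u q"
proof -
  define e where "e = x * a + y * b"
  have "c * (a * q) = d * p * q" by (simp only: mult.assoc[symmetric] eq)
  also have "\<dots> = d * q * p" by (simp only: ac_simps)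
  also have "\<dots> = c * (b * p)" by (simp only: mult.assoc[symmetric] eq)
  finally have cross: "a * q = b * p" using cd(1) by (metis mult_left_cancel)
  have "a = a * (x * p + y * q)" using bez by simp
  also have "\<dots> = p * e" using cross by (simp add: e_def algebra_simps)
  finally have a: "a = p * e" .
  have "b = b * (x * p + y * q)" using bez by simp
  also have "\<dots> = q * e" using cross by (simp add: e_def algebra_simps)
  finally have b: "b = q * e" .
  have "degree e = 0"
  proof (rule ccontr)
    assume "degree e \<noteq> 0"
    then obtain z where "poly e z = 0" using alg_closed_imp_poly_has_root[of e] by auto
    then have "poly a z = 0" "poly b z = 0" using a b by auto
    then have "hev k a (z, 1) = 0" "hev k b (z, 1) = 0"
      using nondegD(1,2)[OF ab(1)] by (simp_all add: hev_poly)
    then have "hev2 k (a, b) (z, 1) = (0, 0)" by (simp add: hev2_def)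
    moreover have "(z, 1) \<noteq> (0 :: 'a, 0 :: 'a)" by simp
    ultimately show False using nondegD(3)[OF ab(1), of "(z, 1)"] by blast
  qed
  then obtain u where u: "e = [:u:]" by (rule degree_eq_zeroE)
  moreover have "u \<noteq> 0"
  proof
    assume "u = 0"
    then have "a = 0" "b = 0" using a b u by auto
    then have "hev2 k (a, b) (1, 0) = (0, 0)" by (simp add: hev2_def)
    moreover have "(1, 0) \<noteq> (0 :: 'a, 0 :: 'a)" by simp
    ultimately show False using nondegD(3)[OF ab(1), of "(1, 0)"] by blast
  qed
  ultimately show ?thesis using that[of u] a b by (simp add: mult.commute)
qed

lemma nondeg_degree:
  assumes "nondeg k (a, b :: 'a :: field poly)"
  shows "degree a = k \<or> degree b = k"
proof (rule ccontr)
  assume n: "\<not> ?thesis"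
  have "degree a \<le> k" "degree b \<le> k" using nondegD(1,2)[OF assms] by simp_all
  with n have "coeff a k = 0" "coeff b k = 0" by (simp_all add: coeff_eq_0)
  then have "hev2 k (a, b) (1, 0) = (0, 0)" by (simp add: hev2_def hev_infinity)
  moreover have "(1, 0) \<noteq> (0 :: 'a, 0 :: 'a)" by simp
  ultimately show False using nondegD(3)[OF assms, of "(1, 0)"] by blast
qed

section \<open>Reduction of sequences of forms\<close>

lemma hev_prod_lin_nat:
  fixes w :: "nat \<Rightarrow> 'a :: field \<times> 'a"
  shows "degree (\<Prod>i<k. lin (w i)) \<le> k" "hev k (\<Prod>i<k. lin (w i)) v = (\<Prod>i<k. wedge v (w i))"
proof (induction k)
  case (Suc k)
  have "degree ((\<Prod>i<k. lin (w i)) * lin (w k)) \<le> degree (\<Prod>i<k. lin (w i)) + degree (lin (w k))"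
    by (rule degree_mult_le)
  also have "\<dots> \<le> Suc k" using Suc(1) degree_lin[of "w k"] by linarith
  finally show "degree (\<Prod>i<Suc k. lin (w i)) \<le> Suc k" by simp
  show "hev (Suc k) (\<Prod>i<Suc k. lin (w i)) v = (\<Prod>i<Suc k. wedge v (w i))"
    using hev_mult[OF Suc(1) degree_lin[of "w k"], of v] hev_lin[of "w k" v] Suc(2) by simp
qed (simp_all add: hev_one)

lemma form_eqI:
  fixes p q :: "'a :: field_char_0 poly"
  assumes "degree p \<le> k" "degree q \<le> k" "\<And>v. hev k p v = hev k q v"
  shows "p = q"
proof -
  have "poly p x = poly q x" for x
    using assms(3)[of "(x, 1)"] assms(1,2) by (simp add: hev_poly)
  then show ?thesis by (simp add: poly_eq_poly_eq_iff[symmetric] fun_eq_iff)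
qed

lemma complex_normalize:
  fixes w :: "complex \<times> complex"
  assumes "w \<noteq> (0, 0)"
  obtains s w' where "s \<noteq> 0" "w = cmul s w'" "max (cmod (fst w')) (cmod (snd w')) = 1"
proof -
  define r where "r = max (cmod (fst w)) (cmod (snd w))"
  have r: "r > 0" using assms by (cases w) (auto simp: r_def less_max_iff_disj)
  have "max (cmod (fst w) / r) (cmod (snd w) / r) = r / r"
    using r divide_right_mono[of "cmod (fst w)" "cmod (snd w)" r] divide_right_mono[of "cmod (snd w)" "cmod (fst w)" r]
    by (auto simp: r_def max_def)
  then have "max (cmod (fst (cmul (of_real (1 / r)) w))) (cmod (snd (cmul (of_real (1 / r)) w))) = 1"
    using r by (simp add: cmul_def norm_divide)
  moreover have "w = cmul (of_real r) (cmul (of_real (1 / r)) w)" using r by (simp add: cmul_def)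
  ultimately show ?thesis using that[of "of_real r"] r by (metis less_numeral_extra(3) of_real_eq_0_iff)
qed

definition normalized :: "(nat \<Rightarrow> complex \<times> complex) \<Rightarrow> bool" where
  "normalized w \<longleftrightarrow> (\<forall>n. max (cmod (fst (w n))) (cmod (snd (w n))) = 1)"

lemma factor_normalized:
  fixes p :: "complex poly"
  assumes "degree p \<le> k"
  shows "\<exists>c w. p = smult c (\<Prod>i<k. lin (w i)) \<and> (\<forall>i. max (cmod (fst (w i))) (cmod (snd (w i))) = 1)"
proof (cases "p = 0")
  case True
  then show ?thesis by (intro exI[of _ 0] exI[of _ "\<lambda>_. (1, 0)"]) simp
next
  case False
  obtain c ws where ws: "c \<noteq> 0" "length ws = k" "\<And>w. w \<in> set ws \<Longrightarrow> w \<noteq> (0, 0)"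
    "p = smult c (\<Prod>w\<leftarrow>ws. lin w)" using form_factor[OF False assms] by metis
  have "\<exists>s w'. i < k \<longrightarrow> ws ! i = cmul s w' \<and> max (cmod (fst w')) (cmod (snd w')) = 1" for i
  proof (cases "i < k")
    case True
    then have "ws ! i \<noteq> (0, 0)" using ws(2,3) by (metis nth_mem)
    from complex_normalize[OF this] show ?thesis by metis
  qed blast
  then obtain s w where sw: "\<And>i. i < k \<Longrightarrow> ws ! i = cmul (s i) (w i)"
    "\<And>i. i < k \<Longrightarrow> max (cmod (fst (w i))) (cmod (snd (w i))) = 1" by metis
  define w' where "w' i = (if i < k then w i else (1, 0))" for i
  have "lin (cmul a v) = smult a (lin v)" for a and v :: "complex \<times> complex"
    by (simp add: lin_def cmul_def)
  then have "(\<Prod>w\<leftarrow>ws. lin w) = (\<Prod>i<k. smult (s i) (lin (w i)))"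
    using ws(2) sw(1) by (auto simp: prod.list_conv_set_nth lessThan_atLeast0 intro!: prod.cong)
  also have "\<dots> = smult (\<Prod>i<k. s i) (\<Prod>i<k. lin (w' i))"
    by (simp add: prod_smult w'_def)
  finally have "p = smult (c * (\<Prod>i<k. s i)) (\<Prod>i<k. lin (w' i))" using ws(4) by simp
  moreover have "max (cmod (fst (w' i))) (cmod (snd (w' i))) = 1" for i
    using sw(2) by (simp add: w'_def)
  ultimately show ?thesis by blast
qed

text \<open>Zeros normalised to modulus 1 always have a reduction; all growth of the form is
  collected in the constant \<open>c\<close>.\<close>

lemma factor_normalized_seq:
  assumes "\<And>n. degree (E n) \<le> k"
  obtains c w where "\<And>n. E n = smult (c n) (\<Prod>i<k. lin (w i n))" "\<And>i. normalized (w i)"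
proof -
  have "\<forall>n. \<exists>c w. E n = smult c (\<Prod>i<k. lin (w i)) \<and> (\<forall>i. max (cmod (fst (w i))) (cmod (snd (w i))) = 1)"
    using factor_normalized[OF assms] by blast
  then obtain c w where "\<And>n. E n = smult (c n) (\<Prod>i<k. lin (w n i))"
    "\<And>n i. max (cmod (fst (w n i))) (cmod (snd (w n i))) = 1" by metis
  then show ?thesis using that[of c "\<lambda>i n. w n i"] by (simp add: normalized_def)
qed

section \<open>Forms over H as reductions of sequences\<close>

locale place = small_scaled F \<eta> + place_map F \<eta> \<phi>
  for F :: "nat filter" and \<eta> :: "nat \<Rightarrow> real" and \<phi> :: "(nat \<Rightarrow> complex) \<Rightarrow> 'h::alg_closed_field"
begin

definition vHd :: "(nat \<Rightarrow> complex \<times> complex) \<Rightarrow> bool" where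
  "vHd v \<longleftrightarrow> Hd (\<lambda>n. fst (v n)) \<and> Hd (\<lambda>n. snd (v n))"

definition phiv :: "(nat \<Rightarrow> complex \<times> complex) \<Rightarrow> 'h \<times> 'h" where
  "phiv v = (\<phi> (\<lambda>n. fst (v n)), \<phi> (\<lambda>n. snd (v n)))"

text \<open>The form over H represented by the coefficient sequences. It translates
  \<open>feq\<close>, \<open>fzero\<close> and \<open>fcoprime\<close> into statements about
  polynomials over an algebraically closed field.\<close>

definition rp :: "nat \<Rightarrow> (nat \<Rightarrow> complex poly) \<Rightarrow> 'h poly" where
  "rp k p = (\<Sum>i\<le>k. monom (\<phi> (\<lambda>n. coeff (p n) i)) i)"

abbreviation "Hform \<equiv> form Hd"

lemma coeff_rp: "coeff (rp k p) i = (if i \<le> k then \<phi> (\<lambda>n. coeff (p n) i) else 0)"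
proof -
  have "coeff (rp k p) i = (\<Sum>j\<le>k. if j = i then \<phi> (\<lambda>n. coeff (p n) i) else 0)"
    unfolding rp_def coeff_sum by (intro sum.cong) auto
  then show ?thesis by (simp add: sum.delta)
qed

lemma degree_rp: "degree (rp k p) \<le> k"
  by (rule degree_le) (simp add: coeff_rp)

lemma Hform_coeff: "Hform k p \<Longrightarrow> Hd (\<lambda>n. coeff (p n) i)"
  and Hform_degree: "Hform k p \<Longrightarrow> degree (p n) \<le> k"
  and Hform_zero: "Hform k p \<Longrightarrow> k < i \<Longrightarrow> coeff (p n) i = 0"
  by (auto simp: form_def intro!: coeff_eq_0 intro: le_less_trans)

lemma Hform_rp_coeff: "Hform k p \<Longrightarrow> coeff (rp k p) i = \<phi> (\<lambda>n. coeff (p n) i)"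
  using Hform_zero[of k p i] by (auto simp: coeff_rp not_le)

lemma HformI: "(\<And>n. degree (p n) \<le> k) \<Longrightarrow> (\<And>i. Hd (\<lambda>n. coeff (p n) i)) \<Longrightarrow> Hform k p"
  by (simp add: form_def)

lemma Hform_mult:
  assumes "Hform k p" "Hform m q"
  shows "Hform (k + m) (\<lambda>n. p n * q n)" "rp (k + m) (\<lambda>n. p n * q n) = rp k p * rp m q"
proof -
  show f: "Hform (k + m) (\<lambda>n. p n * q n)"
  proof (rule HformI)
    show "degree (p n * q n) \<le> k + m" for n
      using degree_mult_le[of "p n" "q n"] Hform_degree[OF assms(1), of n] Hform_degree[OF assms(2), of n] by linarith
    show "Hd (\<lambda>n. coeff (p n * q n) i)" for i
      unfolding coeff_mult by (intro Hd_sum Hd_mult Hform_coeff[OF assms(1)] Hform_coeff[OF assms(2)])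
  qed
  show "rp (k + m) (\<lambda>n. p n * q n) = rp k p * rp m q"
  proof (rule poly_eqI)
    fix i
    have "coeff (rp (k + m) (\<lambda>n. p n * q n)) i = \<phi> (\<lambda>n. \<Sum>j\<le>i. coeff (p n) j * coeff (q n) (i - j))"
      unfolding Hform_rp_coeff[OF f] coeff_mult ..
    also have "\<dots> = (\<Sum>j\<le>i. \<phi> (\<lambda>n. coeff (p n) j * coeff (q n) (i - j)))"
      by (intro phi_sum Hd_mult Hform_coeff[OF assms(1)] Hform_coeff[OF assms(2)])
    also have "\<dots> = (\<Sum>j\<le>i. coeff (rp k p) j * coeff (rp m q) (i - j))"
      by (intro sum.cong refl)
         (simp add: phi_mult Hform_coeff[OF assms(1)] Hform_coeff[OF assms(2)] Hform_rp_coeff assms)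
    finally show "coeff (rp (k + m) (\<lambda>n. p n * q n)) i = coeff (rp k p * rp m q) i"
      by (simp add: coeff_mult)
  qed
qed

lemma Hform_diff:
  assumes "Hform k p" "Hform k q"
  shows "Hform k (\<lambda>n. p n - q n)" "rp k (\<lambda>n. p n - q n) = rp k p - rp k q"
proof -
  show "Hform k (\<lambda>n. p n - q n)"
    using assms by (intro HformI degree_diff_le) (auto simp: form_def intro: Hd_diff)
  show "rp k (\<lambda>n. p n - q n) = rp k p - rp k q"
    by (rule poly_eqI) (simp add: coeff_rp phi_diff Hform_coeff[OF assms(1)] Hform_coeff[OF assms(2)])
qed

lemma Hform_smult:
  assumes "Hform k p" "Hd c"
  shows "Hform k (\<lambda>n. smult (c n) (p n))" "rp k (\<lambda>n. smult (c n) (p n)) = smult (\<phi> c) (rp k p)"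
proof -
  show "Hform k (\<lambda>n. smult (c n) (p n))"
    using assms by (intro HformI le_trans[OF degree_smult_le]) (auto simp: form_def intro: Hd_mult)
  show "rp k (\<lambda>n. smult (c n) (p n)) = smult (\<phi> c) (rp k p)"
    by (rule poly_eqI) (simp add: coeff_rp phi_mult Hform_coeff[OF assms(1)] assms(2))
qed

lemma Hform_pCons:
  assumes "Hform k p"
  shows "Hform (Suc k) (\<lambda>n. pCons 0 (p n))" "rp (Suc k) (\<lambda>n. pCons 0 (p n)) = pCons 0 (rp k p)"
proof -
  show f: "Hform (Suc k) (\<lambda>n. pCons 0 (p n))"
  proof (rule HformI)
    show "degree (pCons 0 (p n)) \<le> Suc k" for n
      using degree_pCons_le[of 0 "p n"] Hform_degree[OF assms, of n] by linarith
    show "Hd (\<lambda>n. coeff (pCons 0 (p n)) i)" for i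
      by (cases i) (auto simp: Hform_coeff[OF assms])
  qed
  show "rp (Suc k) (\<lambda>n. pCons 0 (p n)) = pCons 0 (rp k p)"
  proof (rule poly_eqI)
    fix i show "coeff (rp (Suc k) (\<lambda>n. pCons 0 (p n))) i = coeff (pCons 0 (rp k p)) i"
      by (cases i) (simp_all add: coeff_rp)
  qed
qed

lemma Hform_Suc:
  assumes "Hform k p"
  shows "Hform (Suc k) p" "rp (Suc k) p = rp k p"
proof -
  show f: "Hform (Suc k) p" using assms by (auto simp: form_def intro: le_SucI)
  show "rp (Suc k) p = rp k p"
    by (rule poly_eqI) (simp add: Hform_rp_coeff[OF f] Hform_rp_coeff[OF assms])
qed

lemma Hform_fixform:
  assumes "Hform k (\<lambda>n. fst (g n))" "Hform k (\<lambda>n. snd (g n))"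
  shows "Hform (Suc k) (\<lambda>n. fixform (g n))"
    "rp (Suc k) (\<lambda>n. fixform (g n)) = fixform (rp k (\<lambda>n. fst (g n)), rp k (\<lambda>n. snd (g n)))"
  unfolding fixform_def
  using Hform_diff[OF Hform_pCons(1)[OF assms(2)] Hform_Suc(1)[OF assms(1)]]
  by (simp_all add: Hform_pCons[OF assms(2)] Hform_Suc[OF assms(1)])

lemma Hform_preform:
  assumes "Hform k (\<lambda>n. fst (g n))" "Hform k (\<lambda>n. snd (g n))" "vHd w"
  shows "Hform k (\<lambda>n. preform (w n) (g n))"
    "rp k (\<lambda>n. preform (w n) (g n)) = preform (phiv w) (rp k (\<lambda>n. fst (g n)), rp k (\<lambda>n. snd (g n)))"
proof -
  have w: "Hd (\<lambda>n. fst (w n))" "Hd (\<lambda>n. snd (w n))" using assms(3) by (auto simp: vHd_def)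
  note * = Hform_smult[OF assms(1) w(2)] Hform_smult[OF assms(2) w(1)]
  show "Hform k (\<lambda>n. preform (w n) (g n))"
    "rp k (\<lambda>n. preform (w n) (g n)) = preform (phiv w) (rp k (\<lambda>n. fst (g n)), rp k (\<lambda>n. snd (g n)))"
    unfolding preform_def using Hform_diff[OF *(1) *(3)] by (simp_all add: * phiv_def)
qed

lemma Hform_lin:
  assumes "vHd w"
  shows "Hform 1 (\<lambda>n. lin (w n))" "rp 1 (\<lambda>n. lin (w n)) = lin (phiv w)"
proof -
  have w: "Hd (\<lambda>n. fst (w n))" "Hd (\<lambda>n. snd (w n))" using assms by (auto simp: vHd_def)
  have c: "coeff (lin (w n)) i = (if i = 0 then - fst (w n) else if i = 1 then snd (w n) else 0)" for n i
    by (simp add: lin_def coeff_pCons split: nat.split)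
  have "Hd (\<lambda>n. coeff (lin (w n)) i)" for i
    unfolding c using w by (cases "i = 0"; cases "i = 1") (auto simp: Hd_minus)
  then show f: "Hform 1 (\<lambda>n. lin (w n))" by (intro HformI degree_lin)
  show "rp 1 (\<lambda>n. lin (w n)) = lin (phiv w)"
  proof (rule poly_eqI)
    fix i
    show "coeff (rp 1 (\<lambda>n. lin (w n))) i = coeff (lin (phiv w)) i"
      unfolding Hform_rp_coeff[OF f] c using w
      by (cases "i = 0"; cases "i = 1") (auto simp: lin_def phiv_def phi_minus coeff_pCons split: nat.split)
  qed
qed

lemma Hform_prod_lin:
  assumes "\<And>i. vHd (w i)"
  shows "Hform k (\<lambda>n. \<Prod>i<k. lin (w i n))" "rp k (\<lambda>n. \<Prod>i<k. lin (w i n)) = (\<Prod>i<k. lin (phiv (w i)))"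
proof (induction k)
  case 0
  have c: "Hd (\<lambda>n. coeff 1 i)" for i by simp
  show "Hform 0 (\<lambda>n. \<Prod>i<0. lin (w i n))" by (rule HformI) (simp_all add: c)
  show "rp 0 (\<lambda>n. \<Prod>i<0. lin (w i n)) = (\<Prod>i<0. lin (phiv (w i)))"
    by (rule poly_eqI) (auto simp: coeff_rp coeff_1 phi_one)
next
  case (Suc k)
  note m = Hform_mult[OF Suc(1) Hform_lin(1)[OF assms]]
  show "Hform (Suc k) (\<lambda>n. \<Prod>i<Suc k. lin (w i n))" using m(1) by simp
  show "rp (Suc k) (\<lambda>n. \<Prod>i<Suc k. lin (w i n)) = (\<Prod>i<Suc k. lin (phiv (w i)))"
    using m(2) Suc(2) Hform_lin(2)[OF assms] by simp
qed

lemma feq_iff_rp: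
  assumes "Hform k p" "Hform k q"
  shows "feq Hz k p q \<longleftrightarrow> rp k p = rp k q"
proof -
  have "Hz (\<lambda>n. coeff (p n) i - coeff (q n) i) \<longleftrightarrow> coeff (rp k p) i = coeff (rp k q) i" if "i \<le> k" for i
    using that phi_eq_iff[OF Hform_coeff[OF assms(1)] Hform_coeff[OF assms(2)]] by (simp add: coeff_rp)
  moreover have "coeff (rp k p) i = coeff (rp k q) i" if "\<not> i \<le> k" for i using that by (simp add: coeff_rp)
  ultimately show ?thesis unfolding feq_def poly_eq_iff by blast
qed

lemma fzero_iff_rp: "Hform k p \<Longrightarrow> fzero Hz k p \<longleftrightarrow> rp k p = 0"
proof -
  assume p: "Hform k p"
  have z: "Hform k (\<lambda>_. 0)" by (rule HformI) simp_all
  have "rp k (\<lambda>_. 0) = 0" by (rule poly_eqI) (simp add: coeff_rp)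
  then show ?thesis unfolding fzero_def using feq_iff_rp[OF p z] by simp
qed

lemma hev_rp:
  assumes "Hform k p" "vHd v"
  shows "Hd (\<lambda>n. hev k (p n) (v n))" "hev k (rp k p) (phiv v) = \<phi> (\<lambda>n. hev k (p n) (v n))"
proof -
  have v: "Hd (\<lambda>n. fst (v n))" "Hd (\<lambda>n. snd (v n))" using assms(2) by (auto simp: vHd_def)
  have t: "Hd (\<lambda>n. coeff (p n) i * fst (v n) ^ i * snd (v n) ^ (k - i))" for i
    by (intro Hd_mult Hd_power v Hform_coeff[OF assms(1)])
  show "Hd (\<lambda>n. hev k (p n) (v n))" unfolding hev_def by (intro Hd_sum t)
  have "\<phi> (\<lambda>n. hev k (p n) (v n)) = (\<Sum>i\<le>k. \<phi> (\<lambda>n. coeff (p n) i * fst (v n) ^ i * snd (v n) ^ (k - i)))"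
    unfolding hev_def by (intro phi_sum t)
  also have "\<dots> = hev k (rp k p) (phiv v)"
    unfolding hev_def
    by (intro sum.cong refl)
       (simp add: coeff_rp phiv_def phi_mult phi_power Hd_mult Hd_power v Hform_coeff[OF assms(1)])
  finally show "hev k (rp k p) (phiv v) = \<phi> (\<lambda>n. hev k (p n) (v n))" by simp
qed

lemma lift_form:
  assumes "degree p \<le> k"
  obtains P where "Hform k P" "rp k P = p"
proof -
  have "\<forall>i. \<exists>x. Hd x \<and> \<phi> x = coeff p i" using phi_surj by blast
  then obtain a where a: "\<And>i. Hd (a i)" "\<And>i. \<phi> (a i) = coeff p i" by metis
  define P where "P n = (\<Sum>i\<le>k. monom (a i n) i)" for n
  have c: "coeff (P n) i = (if i \<le> k then a i n else 0)" for n i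
  proof -
    have "coeff (P n) i = (\<Sum>j\<le>k. if j = i then a i n else 0)"
      unfolding P_def coeff_sum by (intro sum.cong) auto
    then show ?thesis by (simp add: sum.delta)
  qed
  have "Hform k P"
  proof (rule HformI)
    show "degree (P n) \<le> k" for n by (rule degree_le) (simp add: c)
    show "Hd (\<lambda>n. coeff (P n) i)" for i unfolding c using a(1) by (cases "i \<le> k") auto
  qed
  moreover have "rp k P = p"
  proof (rule poly_eqI)
    fix i
    show "coeff (rp k P) i = coeff p i"
      using assms a(2) by (cases "i \<le> k") (auto simp: coeff_rp c coeff_eq_0)
  qed
  ultimately show ?thesis using that by blast
qed

lemma lift_vec:
  obtains v where "vHd v" "phiv v = h"
proof -
  obtain x y where "Hd x" "\<phi> x = fst h" "Hd y" "\<phi> y = snd h" using phi_surj by metis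
  then show ?thesis using that[of "\<lambda>n. (x n, y n)"] by (simp add: vHd_def phiv_def)
qed

lemma normalized_vHd: "normalized w \<Longrightarrow> vHd w"
proof -
  assume "normalized w"
  then have m: "max (cmod (fst (w n))) (cmod (snd (w n))) = 1" for n by (simp add: normalized_def)
  have "cmod (fst (w n)) \<le> 1" "cmod (snd (w n)) \<le> 1" for n
    using m[of n] max.cobounded1[of "cmod (fst (w n))" "cmod (snd (w n))"]
      max.cobounded2[of "cmod (snd (w n))" "cmod (fst (w n))"] by linarith+
  then show ?thesis
    unfolding vHd_def
    using Hd_bounded[of "\<lambda>n. fst (w n)" 1] Hd_bounded[of "\<lambda>n. snd (w n)" 1] by simp
qed

text \<open>The ultrafilter selects one coordinate that has modulus 1, hence norm 1.\<close>

lemma normalized_phiv: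
  assumes "normalized w"
  shows "phiv w \<noteq> (0, 0)"
proof
  assume "phiv w = (0, 0)"
  then have hz: "Hz (\<lambda>n. fst (w n))" "Hz (\<lambda>n. snd (w n))"
    using normalized_vHd[OF assms] phi_zero_iff by (auto simp: phiv_def vHd_def)
  have one: "\<not> Hz x" if "ev (\<lambda>n. cmod (x n) = 1)" for x
  proof
    assume "Hz x"
    then have "(N x \<longlongrightarrow> 0) F" by (simp add: Hz_iff)
    moreover have "ev (\<lambda>n. N x n = 1)" using that by eventually_elim (simp add: N_def)
    ultimately have "((\<lambda>n. 1 :: real) \<longlongrightarrow> 0) F" using tendsto_cong[of "N x" "\<lambda>_. 1" F 0] by simp
    then show False using tendsto_unique[OF ultra_bot[OF ultra], of "\<lambda>n. 1 :: real" 0 1] by simp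
  qed
  have "ev (\<lambda>n. cmod (fst (w n)) = 1 \<or> cmod (snd (w n)) = 1)"
  proof (intro always_eventually allI)
    fix n show "cmod (fst (w n)) = 1 \<or> cmod (snd (w n)) = 1"
      using assms unfolding normalized_def max_def by metis
  qed
  then show False using ultra_disj[OF ultra] one hz by blast
qed

text \<open>Were the leading constant \<open>c\<close> infinite, dividing by it would make a product of non-zero
  linear forms vanish.\<close>

lemma factor_lift:
  assumes E: "Hform k E" and nz: "rp k E \<noteq> 0"
    and c: "\<And>n. E n = smult (c n) (\<Prod>i<k. lin (w i n))" and w: "\<And>i. normalized (w i)"
  shows "Hd c" "\<phi> c \<noteq> 0" "rp k E = smult (\<phi> c) (\<Prod>i<k. lin (phiv (w i)))"
proof -
  define Q where "Q n = (\<Prod>i<k. lin (w i n))" for n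
  have Q: "Hform k Q" "rp k Q = (\<Prod>i<k. lin (phiv (w i)))"
    unfolding Q_def[abs_def] using Hform_prod_lin[OF normalized_vHd[OF w]] by auto
  have Qnz: "rp k Q \<noteq> 0"
    unfolding Q(2) using normalized_phiv[OF w] by (auto simp: lin_eq_0_iff)
  show Hc: "Hd c"
  proof (rule ccontr)
    assume n: "\<not> Hd c"
    then have top: "filterlim (N c) at_top F"
      using wlim_infinite_iff[OF ultra] Hdom_def[of F \<eta> c] by (simp add: N_def[abs_def])
    then have "((\<lambda>n. inverse (N c n)) \<longlongrightarrow> 0) F" by (rule tendsto_inverse_0_at_top)
    moreover have "inverse (N c n) = N (\<lambda>n. inverse (c n)) n" for n
      by (auto simp: N_def inverse_eq_divide norm_divide powr_divide)
    ultimately have ic: "Hz (\<lambda>n. inverse (c n))" by (simp add: Hz_iff)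
    have cnz: "ev (\<lambda>n. c n \<noteq> 0)"
    proof (rule eventually_mono)
      show "ev (\<lambda>n. 0 < N c n)" using top unfolding filterlim_at_top_dense by blast
    qed (auto simp: N_def)
    have "coeff (rp k Q) i = 0" for i
    proof -
      have "Hz (\<lambda>n. inverse (c n) * coeff (E n) i)" by (rule Hz_mult[OF ic Hform_coeff[OF E]])
      then have "Hz (\<lambda>n. coeff (Q n) i)"
        by (rule iffD1[OF Hz_cong, rotated]) (use cnz in \<open>eventually_elim, simp add: c Q_def\<close>)
      then show ?thesis using Hform_rp_coeff[OF Q(1), of i] phi_zero_iff[OF Hform_coeff[OF Q(1)]] by simp
    qed
    then show False using Qnz by (simp add: poly_eq_iff)
  qed
  show eq: "rp k E = smult (\<phi> c) (\<Prod>i<k. lin (phiv (w i)))"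
  proof -
    have "E = (\<lambda>n. smult (c n) (Q n))" using c by (simp add: Q_def fun_eq_iff)
    then show ?thesis using Hform_smult(2)[OF Q(1) Hc] Q(2) by simp
  qed
  show "\<phi> c \<noteq> 0" using nz eq by auto
qed

text \<open>The complex forms split into normalised linear factors, and the reductions of these are
  the linear factors of the reduced form. So each zero of the reduction is the reduction of exact
  zeros of all the \<open>E n\<close>.\<close>

lemma zero_lift:
  assumes E: "Hform k E" and nz: "rp k E \<noteq> 0" and v: "hev k (rp k E) v = 0"
  obtains w where "normalized w" "\<And>n. hev k (E n) (w n) = 0" "wedge v (phiv w) = 0"
proof -
  obtain c w where cw: "\<And>n. E n = smult (c n) (\<Prod>i<k. lin (w i n))" "\<And>i. normalized (w i)"
    using factor_normalized_seq[of E k] Hform_degree[OF E] by metis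
  note fl = factor_lift[OF E nz cw]
  have "hev k (rp k E) v = \<phi> c * (\<Prod>i<k. wedge v (phiv (w i)))"
    unfolding fl(3) hev_smult hev_prod_lin_nat(2) ..
  then obtain i where i: "i < k" "wedge v (phiv (w i)) = 0"
    using v fl(2) by auto
  have "hev k (E n) (w i n) = 0" for n
  proof -
    have "(\<Prod>j<k. wedge (w i n) (w j n)) = 0" using i(1) by (intro prod_zero bexI[of _ i]) auto
    then show ?thesis unfolding cw(1) hev_smult hev_prod_lin_nat(2) by simp
  qed
  then show ?thesis using that[of "w i"] cw(2) i(2) by blast
qed

lemma form_divide_lin:
  fixes p :: "'h poly"
  assumes "degree p \<le> k" "v \<noteq> (0, 0)" "hev k p v = 0" "1 \<le> k"
  obtains q where "p = lin v * q" "degree q \<le> k - 1"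
proof (cases "snd v = 0")
  case True
  then have fv: "fst v \<noteq> 0" using assms(2) by (cases v) auto
  then have ck: "coeff p k = 0" using assms(3) True by (simp add: hev_infinity)
  have "degree (smult (- inverse (fst v)) p) \<le> k - 1"
  proof (rule degree_le, intro allI impI)
    fix i assume "k - 1 < i"
    then have "i = k \<or> degree p < i" using assms(1) by linarith
    then show "coeff (smult (- inverse (fst v)) p) i = 0" using ck by (auto simp: coeff_eq_0)
  qed
  moreover have "p = lin v * smult (- inverse (fst v)) p" using True fv by (simp add: lin_def)
  ultimately show ?thesis using that by blast
next
  case False
  then have "poly p (fst v / snd v) = 0" using assms by (simp add: hev_poly)
  then obtain q where q: "p = [:- (fst v / snd v), 1:] * q" using poly_eq_0_iff_dvd by (metis dvdE)
  have lv: "lin v = smult (snd v) [:- (fst v / snd v), 1:]" using False by (simp add: lin_def)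
  have eq: "p = lin v * smult (inverse (snd v)) q"
    unfolding q lv mult_smult_left mult_smult_right smult_smult using False by simp
  have "degree (smult (inverse (snd v)) q) \<le> k - 1"
  proof (cases "q = 0")
    case qz: False
    then have "degree p = 1 + degree q" unfolding q by (subst degree_mult_eq) auto
    then show ?thesis using assms(1) False by simp
  qed simp
  then show ?thesis using that eq by blast
qed

text \<open>A common zero over H gives a common linear factor over H; lifted to sequences, it is a
  common divisor of degree one in the sense of \<open>fcoprime\<close>.\<close>

lemma nondeg_of_coprime:
  assumes A: "Hform k A" and B: "Hform k B" and k: "1 \<le> k" and cop: "fcoprime Hd Hz k A B"
  shows "nondeg k (rp k A, rp k B)"
  unfolding nondeg_def
proof (intro conjI allI impI)
  show "degree (fst (rp k A, rp k B)) \<le> k" "degree (snd (rp k A, rp k B)) \<le> k" by (simp_all add: degree_rp)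
  fix v :: "'h \<times> 'h" assume v: "v \<noteq> (0, 0)"
  show "hev2 k (rp k A, rp k B) v \<noteq> (0, 0)"
  proof
    assume "hev2 k (rp k A, rp k B) v = (0, 0)"
    then have z: "hev k (rp k A) v = 0" "hev k (rp k B) v = 0" by (auto simp: hev2_def)
    obtain w where w: "vHd w" "phiv w = v" by (rule lift_vec)
    note lw = Hform_lin[OF w(1)]
    have dvd: "fdvd Hd Hz 1 k (\<lambda>n. lin (w n)) X" if X: "Hform k X" and zX: "hev k (rp k X) v = 0" for X
    proof -
      obtain q where q: "rp k X = lin v * q" "degree q \<le> k - 1"
        using form_divide_lin[OF degree_rp v zX k] .
      obtain Y where Y: "Hform (k - 1) Y" "rp (k - 1) Y = q" using lift_form[OF q(2)] .
      have k1: "1 + (k - 1) = k" using k by simp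
      have "Hform k (\<lambda>n. lin (w n) * Y n)" "rp k (\<lambda>n. lin (w n) * Y n) = rp k X"
        using Hform_mult[OF lw(1) Y(1)] lw(2) Y(2) q(1) w(2) unfolding k1 by auto
      then have "feq Hz k X (\<lambda>n. lin (w n) * Y n)" using feq_iff_rp[OF X] by simp
      then show ?thesis unfolding fdvd_def using k Y(1) by blast
    qed
    have "\<not> fzero Hz 1 (\<lambda>n. lin (w n))"
      using fzero_iff_rp[OF lw(1)] lw(2) w(2) v by (simp add: lin_eq_0_iff)
    then have "1 = (0::nat)"
      using cop lw(1) dvd[OF A z(1)] dvd[OF B z(2)] unfolding fcoprime_def by blast
    then show False by simp
  qed
qed

end

section \<open>Conjugation\<close>

definition gdet :: "'a::comm_ring_1 \<times> 'a \<times> 'a \<times> 'a \<Rightarrow> 'a" where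
  "gdet m = (case m of (a, b, c, d) \<Rightarrow> a * d - b * c)"

lemma gdet_mob: "gdet = mob_det"
  by (simp add: gdet_def mob_det_def fun_eq_iff)

lemma mapp_cmul: "mapp m (cmul c v) = cmul c (mapp m v)"
  by (cases m) (simp add: mapp_def cmul_def algebra_simps)

lemma mapp_madj: "mapp m (mapp (madj m) v) = cmul (gdet m) v"
  by (cases m; cases v) (simp add: mapp_def cmul_def madj_def gdet_def algebra_simps)

lemma madj_madj [simp]: "madj (madj m) = m"
  by (cases m) (simp add: madj_def)

lemma gdet_madj [simp]: "gdet (madj m) = gdet m"
  by (cases m) (simp add: madj_def gdet_def algebra_simps)

lemma madj_mapp: "mapp (madj m) (mapp m v) = cmul (gdet m) v"
  using mapp_madj[of "madj m" v] by simp

lemma wedge_mapp: "wedge (mapp m u) (mapp m v) = gdet m * wedge u v"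
  by (cases m) (simp add: mapp_def wedge_def gdet_def algebra_simps)

lemma wedge_adj: "wedge v (mapp m u) = wedge (mapp (madj m) v) u"
  by (cases m) (simp add: mapp_def madj_def wedge_def algebra_simps)

lemma mapp_eq_0:
  fixes m :: "'a::field \<times> 'a \<times> 'a \<times> 'a"
  assumes "gdet m \<noteq> 0"
  shows "mapp m v = (0, 0) \<longleftrightarrow> v = (0, 0)"
proof
  assume "mapp m v = (0, 0)"
  then have "cmul (gdet m) v = mapp (madj m) (0, 0)" by (simp flip: madj_mapp)
  also have "\<dots> = (0, 0)" by (cases m) (simp add: mapp_def madj_def)
  finally show "v = (0, 0)" using assms by (simp add: cmul_eq_0)
qed (cases m; simp add: mapp_def)

text \<open>Cramer's rule in the plane. It allows three points to be represented by vectors P, Q and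
  P + Q, so that one base change carries \<open>(1, 0)\<close>, \<open>(0, 1)\<close>,
  \<open>(1, 1)\<close> to them.\<close>

lemma wedge_decompose: "cmul (wedge p q) r = (fst (cmul (wedge r q) p) + fst (cmul (wedge p r) q),
    snd (cmul (wedge r q) p) + snd (cmul (wedge p r) q))"
  by (simp add: cmul_def wedge_def algebra_simps)

text \<open>The base change sending \<infinity> = \<open>(1, 0)\<close> to \<open>p\<close> and 0 =
  \<open>(0, 1)\<close> to \<open>q\<close>.\<close>

definition cols :: "'a \<times> 'a \<Rightarrow> 'a \<times> 'a \<Rightarrow> 'a \<times> 'a \<times> 'a \<times> 'a" where
  "cols p q = (fst p, fst q, snd p, snd q)"

lemma mapp_cols:
  "mapp (cols p q) v = (fst v * fst p + snd v * fst q, fst v * snd p + snd v * snd q)"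
  "mapp (madj (cols p q)) z = (wedge z q, wedge p z)"
  "gdet (cols p q) = wedge p q"
  by (simp_all add: mapp_def cols_def madj_def wedge_def gdet_def algebra_simps)

lemma hev_hsubst:
  fixes h a b :: "complex poly"
  assumes "degree a \<le> m" "degree b \<le> m"
  shows "hev (k * m) (hsubst k h a b) v = hev k h (hev m a v, hev m b v)"
    "degree (hsubst k h a b) \<le> k * m"
proof -
  have t: "hev (k * m) (a ^ i * b ^ (k - i)) v = hev m a v ^ i * hev m b v ^ (k - i)"
    "degree (a ^ i * b ^ (k - i)) \<le> k * m" if "i \<le> k" for i
  proof -
    have d: "degree (a ^ i) \<le> m * i" "degree (b ^ (k - i)) \<le> m * (k - i)"
      using degree_power_le[of a i] degree_power_le[of b "k - i"] assms
      by (meson le_trans mult_le_mono1)+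
    have e: "m * i + m * (k - i) = k * m" using that by (simp add: algebra_simps flip: distrib_left)
    show "hev (k * m) (a ^ i * b ^ (k - i)) v = hev m a v ^ i * hev m b v ^ (k - i)"
      using hev_mult[OF d, of v] hev_power[OF assms(1)] hev_power[OF assms(2)] by (simp add: e)
    show "degree (a ^ i * b ^ (k - i)) \<le> k * m"
      using degree_mult_le[of "a ^ i" "b ^ (k - i)"] d e by linarith
  qed
  show "hev (k * m) (hsubst k h a b) v = hev k h (hev m a v, hev m b v)"
    unfolding hsubst_def hev_sum hev_smult
    by (simp add: t hev_def[of k h] mult.assoc)
  show "degree (hsubst k h a b) \<le> k * m"
    unfolding hsubst_def by (intro degree_sum_le finite_atMost le_trans[OF degree_smult_le t(2)]) simp
qed

lemma hcomp_eval:
  assumes "degree (fst g) \<le> m" "degree (snd g) \<le> m"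
  shows "hev2 (k * m) (hcomp k f g) v = hev2 k f (hev2 m g v)"
    "degree (fst (hcomp k f g)) \<le> k * m" "degree (snd (hcomp k f g)) \<le> k * m"
  unfolding hcomp_def hev2_def using hev_hsubst[OF assms] by simp_all

lemma mob_eval:
  "hev2 1 (mob m) v = mapp m v" "hev2 1 (mob_inv m) v = mapp (madj m) v"
  "degree (fst (mob m)) \<le> 1" "degree (snd (mob m)) \<le> 1"
  "degree (fst (mob_inv m)) \<le> 1" "degree (snd (mob_inv m)) \<le> 1"
  by (cases m; simp add: hev2_def hev_def mob_def mob_inv_def mapp_def madj_def algebra_simps)+

lemma conj_eval:
  assumes "degree (fst g) \<le> K" "degree (snd g) \<le> K"
  shows "hev2 K (conj K m g) v = mapp m (hev2 K g (mapp (madj m) v))"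
    "degree (fst (conj K m g)) \<le> K" "degree (snd (conj K m g)) \<le> K"
proof -
  note i = hcomp_eval[OF mob_eval(5,6)[of m], of K g, unfolded mult_1_right mob_eval(2)]
  note o = hcomp_eval[OF i(2,3), of 1 "mob m", unfolded mult_1 mob_eval(1) i(1)]
  show "hev2 K (conj K m g) v = mapp m (hev2 K g (mapp (madj m) v))"
    "degree (fst (conj K m g)) \<le> K" "degree (snd (conj K m g)) \<le> K"
    unfolding conj_def using o by simp_all
qed

lemma coeff_scaled_form:
  fixes p e :: "complex poly"
  assumes "degree p \<le> K" "degree e \<le> K"
    and "\<And>v. hev K p v = t * hev K e (a * fst v, b * snd v)" and "i \<le> K"
  shows "coeff p i = t * (a ^ i * b ^ (K - i)) * coeff e i"
proof -
  define r where "r = (\<Sum>i\<le>K. monom (t * (a ^ i * b ^ (K - i)) * coeff e i) i)"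
  have c: "coeff r i = (if i \<le> K then t * (a ^ i * b ^ (K - i)) * coeff e i else 0)" for i
  proof -
    have "coeff r i = (\<Sum>j\<le>K. if j = i then t * (a ^ i * b ^ (K - i)) * coeff e i else 0)"
      unfolding r_def coeff_sum by (intro sum.cong) auto
    then show ?thesis by (simp add: sum.delta)
  qed
  have "p = r"
  proof (rule form_eqI[OF assms(1)])
    show "degree r \<le> K" by (rule degree_le) (simp add: c)
    have "t * hev K e (a * fst v, b * snd v) = hev K r v" for v
      unfolding hev_def sum_distrib_left
      by (intro sum.cong refl) (simp add: c power_mult_distrib algebra_simps)
    then show "hev K p v = hev K r v" for v by (simp only: assms(3))
  qed
  then show ?thesis using c assms(4) by simp
qed

section \<open>Conjugation with coefficients in a ring of sequences\<close>

context seq_ring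
begin

definition rpolys :: "(nat \<Rightarrow> complex poly) set" where
  "rpolys = {p. \<forall>i. (\<lambda>n. coeff (p n) i) \<in> R}"

lemma rpolys_mult: "p \<in> rpolys \<Longrightarrow> q \<in> rpolys \<Longrightarrow> (\<lambda>n. p n * q n) \<in> rpolys"
  unfolding rpolys_def by (auto simp: coeff_mult intro!: sum mult)

lemma rpolys_const: "(\<lambda>n. p) \<in> rpolys"
  unfolding rpolys_def by (auto intro: const)

lemma rpolys_power: "p \<in> rpolys \<Longrightarrow> (\<lambda>n. p n ^ k) \<in> rpolys"
  by (induction k) (auto intro: rpolys_mult rpolys_const)

lemma rpolys_smult: "p \<in> rpolys \<Longrightarrow> c \<in> R \<Longrightarrow> (\<lambda>n. smult (c n) (p n)) \<in> rpolys"
  unfolding rpolys_def by (auto intro: mult)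

lemma rpolys_sum: "(\<And>i. i \<in> A \<Longrightarrow> f i \<in> rpolys) \<Longrightarrow> (\<lambda>n. \<Sum>i\<in>A. f i n) \<in> rpolys"
  unfolding rpolys_def by (auto simp: coeff_sum intro!: sum)

lemma rpolys_hsubst:
  assumes "h \<in> rpolys" "a \<in> rpolys" "b \<in> rpolys"
  shows "(\<lambda>n. hsubst k (h n) (a n) (b n)) \<in> rpolys"
  unfolding hsubst_def
  by (intro rpolys_sum rpolys_smult rpolys_mult rpolys_power assms(2,3)) (use assms(1) in \<open>simp add: rpolys_def\<close>)

lemma rpolys_linear: "a \<in> R \<Longrightarrow> b \<in> R \<Longrightarrow> (\<lambda>n. [:a n, b n:]) \<in> rpolys"
proof -
  assume ab: "a \<in> R" "b \<in> R"
  have "(\<lambda>n. coeff [:a n, b n:] i) \<in> R" for i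
  proof -
    consider "i = 0" | "i = 1" | j where "i = Suc (Suc j)" by (metis One_nat_def not0_implies_Suc)
    then show ?thesis by cases (use ab const[of 0] in simp_all)
  qed
  then show ?thesis by (simp add: rpolys_def)
qed

definition rmat :: "(nat \<Rightarrow> mobius) \<Rightarrow> bool" where
  "rmat m \<longleftrightarrow> (\<lambda>n. fst (m n)) \<in> R \<and> (\<lambda>n. fst (snd (m n))) \<in> R \<and>
     (\<lambda>n. fst (snd (snd (m n)))) \<in> R \<and> (\<lambda>n. snd (snd (snd (m n)))) \<in> R"

lemma rmat_madj: "rmat m \<Longrightarrow> rmat (\<lambda>n. madj (m n))"
  unfolding rmat_def madj_def by (auto simp: case_prod_beta intro: minus)

lemma rpolys_mob:
  assumes "rmat m"
  shows "(\<lambda>n. fst (mob (m n))) \<in> rpolys" "(\<lambda>n. snd (mob (m n))) \<in> rpolys"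
    "(\<lambda>n. fst (mob_inv (m n))) \<in> rpolys" "(\<lambda>n. snd (mob_inv (m n))) \<in> rpolys"
  using assms unfolding mob_def mob_inv_def rmat_def case_prod_beta
  by (auto intro!: rpolys_linear minus)

lemma rpolys_conj:
  assumes "rmat m" "(\<lambda>n. fst (g n)) \<in> rpolys" "(\<lambda>n. snd (g n)) \<in> rpolys"
  shows "(\<lambda>n. fst (conj K (m n) (g n))) \<in> rpolys" "(\<lambda>n. snd (conj K (m n) (g n))) \<in> rpolys"
  unfolding conj_def hcomp_def fst_conv snd_conv
  using rpolys_mob[OF assms(1)] assms(2,3) by (auto intro!: rpolys_hsubst)

end

section \<open>Conjugation and reduction\<close>

context place
begin

text \<open>Forms over H can then be identified by their values. Distinct constants have distinct
  classes because a non-zero constant has norm 1.\<close>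

lemma infinite_H: "infinite (UNIV :: 'h set)"
proof -
  have "inj (\<lambda>c::complex. \<phi> (\<lambda>_. c))"
  proof (rule injI)
    fix c d :: complex
    assume "\<phi> (\<lambda>_. c) = \<phi> (\<lambda>_. d)"
    then have "Hz (\<lambda>_. c - d)" using phi_eq_iff[OF Hd_const Hd_const, of c d] by simp
    then have "nrm (\<lambda>_. c - d) = 0" using Hz_iff_nrm[OF Hd_const] by blast
    then show "c = d" using nrm_const[of "c - d"] by fastforce
  qed
  then have "infinite (range (\<lambda>c::complex. \<phi> (\<lambda>_. c)))"
    using finite_imageD[of "\<lambda>c::complex. \<phi> (\<lambda>_. c)" UNIV] infinite_UNIV_char_0 by blast
  then show ?thesis
    using finite_subset[OF subset_UNIV] by blast
qed

lemma form_eqI_H: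
  fixes p q :: "'h poly"
  assumes "degree p \<le> k" "degree q \<le> k" "\<And>v. hev k p v = hev k q v"
  shows "p = q"
proof (rule ccontr)
  assume "p \<noteq> q"
  then have "finite {x. poly (p - q) x = 0}" by (intro poly_roots_finite) simp
  moreover have "poly (p - q) x = 0" for x
    using assms(3)[of "(x, 1)"] assms(1,2) by (simp add: hev_poly)
  ultimately show False using infinite_H by simp
qed

lemma form_nonzero_at:
  fixes p :: "'h poly"
  assumes "degree p \<le> k" "p \<noteq> 0"
  obtains v where "hev k p v \<noteq> 0"
  using form_eqI_H[of p k 0] assms by auto

definition mHd :: "(nat \<Rightarrow> mobius) \<Rightarrow> bool" where
  "mHd m \<longleftrightarrow> Hd (\<lambda>n. fst (m n)) \<and> Hd (\<lambda>n. fst (snd (m n))) \<and>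
     Hd (\<lambda>n. fst (snd (snd (m n)))) \<and> Hd (\<lambda>n. snd (snd (snd (m n))))"

definition pm :: "(nat \<Rightarrow> mobius) \<Rightarrow> 'h \<times> 'h \<times> 'h \<times> 'h" where
  "pm m = (\<phi> (\<lambda>n. fst (m n)), \<phi> (\<lambda>n. fst (snd (m n))),
     \<phi> (\<lambda>n. fst (snd (snd (m n)))), \<phi> (\<lambda>n. snd (snd (snd (m n)))))"

lemma mapp_phi:
  assumes "mHd m" "vHd v"
  shows "vHd (\<lambda>n. mapp (m n) (v n))" "phiv (\<lambda>n. mapp (m n) (v n)) = mapp (pm m) (phiv v)"
  using assms unfolding mHd_def vHd_def phiv_def pm_def mapp_def case_prod_beta
  by (auto simp: phi_add phi_mult Hd_add Hd_mult)

lemma madj_phi: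
  assumes "mHd m"
  shows "mHd (\<lambda>n. madj (m n))" "pm (\<lambda>n. madj (m n)) = madj (pm m)"
  using assms unfolding mHd_def pm_def madj_def case_prod_beta
  by (auto simp: phi_minus Hd_minus)

lemma gdet_phi: "mHd m \<Longrightarrow> Hd (\<lambda>n. gdet (m n)) \<and> \<phi> (\<lambda>n. gdet (m n)) = gdet (pm m)"
  unfolding mHd_def pm_def gdet_def case_prod_beta
  by (auto simp: phi_diff phi_mult Hd_diff Hd_mult)

lemma wedge_phi:
  "vHd v \<Longrightarrow> vHd w \<Longrightarrow> Hd (\<lambda>n. wedge (v n) (w n))"
  "vHd v \<Longrightarrow> vHd w \<Longrightarrow> \<phi> (\<lambda>n. wedge (v n) (w n)) = wedge (phiv v) (phiv w)"
  unfolding vHd_def phiv_def wedge_def by (auto simp: phi_diff phi_mult Hd_diff Hd_mult)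

lemma cmul_phi:
  "Hd c \<Longrightarrow> vHd v \<Longrightarrow> vHd (\<lambda>n. cmul (c n) (v n))"
  "Hd c \<Longrightarrow> vHd v \<Longrightarrow> phiv (\<lambda>n. cmul (c n) (v n)) = cmul (\<phi> c) (phiv v)"
  unfolding vHd_def phiv_def cmul_def by (auto simp: phi_mult Hd_mult)

sublocale Hring: seq_ring F "{x. Hd x}"
  by unfold_locales (auto simp: ultra Hd_add Hd_mult)

definition rp2 :: "nat \<Rightarrow> (nat \<Rightarrow> complex poly \<times> complex poly) \<Rightarrow> 'h poly \<times> 'h poly" where
  "rp2 k g = (rp k (\<lambda>n. fst (g n)), rp k (\<lambda>n. snd (g n)))"

definition Hform2 :: "nat \<Rightarrow> (nat \<Rightarrow> complex poly \<times> complex poly) \<Rightarrow> bool" where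
  "Hform2 k g \<longleftrightarrow> Hform k (\<lambda>n. fst (g n)) \<and> Hform k (\<lambda>n. snd (g n))"

lemma hev2_phi:
  assumes "Hform2 k g" "vHd v"
  shows "vHd (\<lambda>n. hev2 k (g n) (v n))" "phiv (\<lambda>n. hev2 k (g n) (v n)) = hev2 k (rp2 k g) (phiv v)"
  using hev_rp[of k "\<lambda>n. fst (g n)" v] hev_rp[of k "\<lambda>n. snd (g n)" v] assms
  by (simp_all add: Hform2_def hev2_def rp2_def vHd_def phiv_def)

lemma degree_rp2: "degree (fst (rp2 k g)) \<le> k" "degree (snd (rp2 k g)) \<le> k"
  by (simp_all add: rp2_def degree_rp)

text \<open>Conjugation commutes with reduction: every vector over H lifts, and the values at the
  lifts can be compared.\<close>

lemma Hform2_conj: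
  assumes g: "Hform2 K g" and m: "mHd m"
  shows "Hform2 K (\<lambda>n. conj K (m n) (g n))"
    "hev2 K (rp2 K (\<lambda>n. conj K (m n) (g n))) v = mapp (pm m) (hev2 K (rp2 K g) (mapp (madj (pm m)) v))"
proof -
  have deg: "degree (fst (g n)) \<le> K" "degree (snd (g n)) \<le> K" for n
    using g Hform_degree by (auto simp: Hform2_def)
  have "Hring.rmat m" using m by (simp add: Hring.rmat_def mHd_def)
  moreover have "(\<lambda>n. fst (g n)) \<in> Hring.rpolys" "(\<lambda>n. snd (g n)) \<in> Hring.rpolys"
    using g Hform_coeff by (auto simp: Hform2_def Hring.rpolys_def)
  ultimately have "(\<lambda>n. fst (conj K (m n) (g n))) \<in> Hring.rpolys" "(\<lambda>n. snd (conj K (m n) (g n))) \<in> Hring.rpolys"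
    by (rule Hring.rpolys_conj)+
  then show h: "Hform2 K (\<lambda>n. conj K (m n) (g n))"
    unfolding Hform2_def by (auto intro!: HformI conj_eval deg simp: Hring.rpolys_def)
  obtain w where w: "vHd w" "phiv w = v" by (rule lift_vec)
  note ma = madj_phi[OF m]
  note w1 = mapp_phi[OF ma(1) w(1)]
  note w2 = hev2_phi[OF g w1(1)]
  have "hev2 K (rp2 K (\<lambda>n. conj K (m n) (g n))) v = phiv (\<lambda>n. hev2 K (conj K (m n) (g n)) (w n))"
    using hev2_phi(2)[OF h w(1)] w(2) by simp
  also have "\<dots> = phiv (\<lambda>n. mapp (m n) (hev2 K (g n) (mapp (madj (m n)) (w n))))"
    by (simp only: conj_eval(1)[OF deg])
  also have "\<dots> = mapp (pm m) (hev2 K (rp2 K g) (mapp (madj (pm m)) v))"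
    using mapp_phi(2)[OF m w2(1)] w2(2) w1(2) ma(2) w(2) by simp
  finally show "hev2 K (rp2 K (\<lambda>n. conj K (m n) (g n))) v =
      mapp (pm m) (hev2 K (rp2 K g) (mapp (madj (pm m)) v))" .
qed

lemma phi_inverse:
  assumes "Hd x" "\<phi> x \<noteq> 0"
  shows "Hd (\<lambda>n. inverse (x n))" "\<phi> (\<lambda>n. inverse (x n)) = inverse (\<phi> x)"
proof -
  have nz: "\<not> Hz x" using assms phi_zero_iff by blast
  show Hi: "Hd (\<lambda>n. inverse (x n))" by (rule Hd_inverse(1)[OF assms(1) nz])
  have "\<phi> (\<lambda>n. x n * inverse (x n)) = \<phi> (\<lambda>_. 1)"
    using not_Hz_nonzero[OF nz] by (intro phi_cong Hd_mult assms Hi) (auto elim: eventually_mono)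
  then have "\<phi> x * \<phi> (\<lambda>n. inverse (x n)) = 1" using phi_mult[OF assms(1) Hi] phi_one by simp
  then show "\<phi> (\<lambda>n. inverse (x n)) = inverse (\<phi> x)" by (metis inverse_unique)
qed

lemma nrm_eq_of_phi:
  assumes "Hd x" "Hd y" "\<phi> x = \<phi> y"
  shows "nrm x = nrm y"
proof -
  have le: "nrm x \<le> nrm y" if "Hd x" "Hd y" "\<phi> x = \<phi> y" for x y
  proof -
    have "Hz (\<lambda>n. x n - y n)" using phi_eq_iff[OF that(1,2)] that(3) by blast
    then have "nrm (\<lambda>n. x n - y n) = 0" using Hz_iff_nrm[OF Hd_diff[OF that(1,2)]] by blast
    then show ?thesis
      using nrm_add_le[OF Hd_diff[OF that(1,2)] that(2)] nrm_nonneg[of y] by simp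
  qed
  show ?thesis using le[OF assms] le[OF assms(2,1)] assms(3) by simp
qed

end

section \<open>Potential good reduction of rescalings over a trivially valued field\<close>

locale rescaling = place F \<eta> \<phi>
  for F :: "nat filter" and \<eta> :: "nat \<Rightarrow> real" and \<phi> :: "(nat \<Rightarrow> complex) \<Rightarrow> 'h::alg_closed_field" +
  fixes L :: "(nat \<Rightarrow> complex) set"
  assumes L: "acl_field F L" and triv: "trivially_valued F \<eta> L"
begin

lemma L_const: "(\<lambda>_. c) \<in> L"
  and L_add: "x \<in> L \<Longrightarrow> y \<in> L \<Longrightarrow> (\<lambda>n. x n + y n) \<in> L"
  and L_mult: "x \<in> L \<Longrightarrow> y \<in> L \<Longrightarrow> (\<lambda>n. x n * y n) \<in> L"
  and L_inverse: "x \<in> L \<Longrightarrow> (\<lambda>n. inverse (x n)) \<in> L"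
  and L_cong: "x \<in> L \<Longrightarrow> ev (\<lambda>n. x n = y n) \<Longrightarrow> y \<in> L"
  using L unfolding acl_field_def by blast+

lemma L_root:
  assumes "\<And>i. i \<le> m \<Longrightarrow> c i \<in> L" "ev (\<lambda>n. \<exists>i\<le>m. c i n \<noteq> 0)" "ev (\<lambda>n. (\<Sum>i\<le>m. c i n * x n ^ i) = 0)"
  shows "x \<in> L"
proof -
  have "\<forall>m c x. (\<forall>i\<le>m. c i \<in> L) \<and> ev (\<lambda>n. \<exists>i\<le>m. c i n \<noteq> 0) \<and>
        ev (\<lambda>n. (\<Sum>i\<le>m. c i n * x n ^ i) = 0) \<longrightarrow> x \<in> L"
    using L unfolding acl_field_def by (elim conjE)
  then show ?thesis using assms by blast
qed

sublocale Lring: seq_ring F L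
  by unfold_locales (auto intro: ultra L_const L_add L_mult)

text \<open>The residue field of L at this place. As L is trivially valued, its elements of finite
  norm reduce to a subfield of H whose non-zero elements have norm 1.\<close>

definition kk :: "'h set" where
  "kk = \<phi> ` {x \<in> L. Hd x}"

lemma kkI: "x \<in> L \<Longrightarrow> Hd x \<Longrightarrow> \<phi> x \<in> kk"
  by (simp add: kk_def)

lemma kk_subfield: "subfield_set kk"
  unfolding subfield_set_def
proof (intro conjI ballI)
  show "0 \<in> kk" using kkI[OF L_const[of 0]] by simp
  show "1 \<in> kk" using kkI[OF L_const[of 1]] by (simp add: phi_one)
  fix x assume "x \<in> kk"
  then obtain a where a: "a \<in> L" "Hd a" "x = \<phi> a" by (auto simp: kk_def)
  show "- x \<in> kk" using kkI[OF Lring.minus[OF a(1)]] a by (simp add: Hd_minus phi_minus)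
  show "inverse x \<in> kk"
  proof (cases "x = 0")
    case True
    then show ?thesis using \<open>0 \<in> kk\<close> by simp
  next
    case False
    then show ?thesis using kkI[OF L_inverse[OF a(1)]] phi_inverse[OF a(2)] a(3) by simp
  qed
  fix y assume "y \<in> kk"
  then obtain b where b: "b \<in> L" "Hd b" "y = \<phi> b" by (auto simp: kk_def)
  show "x + y \<in> kk" using kkI[OF L_add[OF a(1) b(1)]] a b by (simp add: Hd_add phi_add)
  show "x * y \<in> kk" using kkI[OF L_mult[OF a(1) b(1)]] a b by (simp add: Hd_mult phi_mult)
qed

lemma kk_norm:
  assumes "Hd x" "Hd u" "c \<in> kk" "\<phi> x = \<phi> u * c"
  shows "nrm x = (if c = 0 then 0 else nrm u)"
proof -
  obtain z where z: "z \<in> L" "Hd z" "c = \<phi> z" using assms(3) by (auto simp: kk_def)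
  have "nrm z \<in> {0, 1}" using triv z unfolding trivially_valued_def by blast
  moreover have "nrm z = 0 \<longleftrightarrow> c = 0" using Hz_iff_nrm[OF z(2)] phi_zero_iff[OF z(2)] z(3) by simp
  moreover have "nrm x = nrm u * nrm z"
    using nrm_eq_of_phi[OF assms(1) Hd_mult[OF assms(2) z(2)]] assms(2,4) z by (simp add: phi_mult nrm_mult)
  ultimately show ?thesis by auto
qed

text \<open>After a base change the coefficients lie in L only up to a common factor
  \<open>t\<close>, about which nothing is known; the quotient eliminates it.\<close>

lemma kk_ratio:
  assumes "Hd x" "Hd y" "\<phi> x \<noteq> 0" "a \<in> L" "b \<in> L" "ev (\<lambda>n. x n = t n * a n)" "ev (\<lambda>n. y n = t n * b n)"
  shows "\<phi> y / \<phi> x \<in> kk"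
proof -
  have xnz: "ev (\<lambda>n. x n \<noteq> 0)" using not_Hz_nonzero phi_zero_iff[OF assms(1)] assms(3) by blast
  have eq: "ev (\<lambda>n. b n * inverse (a n) = y n * inverse (x n))"
    using xnz assms(6,7) by eventually_elim (auto simp: field_simps)
  have "(\<lambda>n. y n * inverse (x n)) \<in> L"
    by (rule L_cong[OF L_mult[OF assms(5) L_inverse[OF assms(4)]] eq])
  then have "\<phi> (\<lambda>n. y n * inverse (x n)) \<in> kk"
    by (intro kkI Hd_mult assms(2) phi_inverse(1)[OF assms(1,3)])
  then show ?thesis
    using phi_mult[OF assms(2) phi_inverse(1)[OF assms(1,3)]] phi_inverse(2)[OF assms(1,3)]
    by (simp add: divide_inverse)
qed

text \<open>The resultant is a polynomial in the coefficients, by Leibniz expansion, so it commutes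
  with \<phi>.\<close>

lemma det_phi:
  assumes "Hform2 k g"
  shows "Hd (\<lambda>n. hres k (g n))"
    "\<phi> (\<lambda>n. hres k (g n)) = det (sylvester_mat_sub k k (fst (rp2 k g)) (snd (rp2 k g)))"
proof -
  have f: "Hform k (\<lambda>n. fst (g n))" "Hform k (\<lambda>n. snd (g n))" using assms by (auto simp: Hform2_def)
  have entry: "Hd (\<lambda>n. sylvester_mat_sub k k (fst (g n)) (snd (g n)) $$ (i, j))"
    "\<phi> (\<lambda>n. sylvester_mat_sub k k (fst (g n)) (snd (g n)) $$ (i, j)) =
       sylvester_mat_sub k k (fst (rp2 k g)) (snd (rp2 k g)) $$ (i, j)" if "i < k + k" "j < k + k" for i j
  proof -
    note c = Hform_coeff[OF f(1), of "k + i - j"] Hform_coeff[OF f(2), of "i - j"]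
      Hform_rp_coeff[OF f(1), of "k + i - j"] Hform_rp_coeff[OF f(2), of "i - j"]
    note x = sylvester_mat_sub_index[OF that]
    have "Hd (\<lambda>n. sylvester_mat_sub k k (fst (g n)) (snd (g n)) $$ (i, j)) \<and>
      \<phi> (\<lambda>n. sylvester_mat_sub k k (fst (g n)) (snd (g n)) $$ (i, j)) =
       sylvester_mat_sub k k (fst (rp2 k g)) (snd (rp2 k g)) $$ (i, j)"
    proof (cases "i < k")
      case True
      then show ?thesis
        unfolding x rp2_def by (cases "i \<le> j \<and> j - i \<le> k") (simp_all only: if_True if_False c phi_zero Hd_const simp_thms fst_conv snd_conv)
    next
      case False
      then show ?thesis
        unfolding x rp2_def by (cases "i - k \<le> j \<and> j \<le> i") (simp_all only: if_True if_False c phi_zero Hd_const simp_thms fst_conv snd_conv)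
    qed
    then show "Hd (\<lambda>n. sylvester_mat_sub k k (fst (g n)) (snd (g n)) $$ (i, j))"
      "\<phi> (\<lambda>n. sylvester_mat_sub k k (fst (g n)) (snd (g n)) $$ (i, j)) =
       sylvester_mat_sub k k (fst (rp2 k g)) (snd (rp2 k g)) $$ (i, j)" by blast+
  qed
  have det: "det (sylvester_mat_sub k k p q) = (\<Sum>\<pi> | \<pi> permutes {0..<k + k}. signof \<pi> *
      (\<Prod>i = 0..<k + k. sylvester_mat_sub k k p q $$ (i, \<pi> i)))" for p q :: "'b::comm_ring_1 poly"
    by (rule det_def') (rule sylvester_mat_sub_carrier)
  have perm: "\<pi> i < k + k" if "\<pi> permutes {0..<k + k}" "i < k + k" for \<pi> i
    using permutes_in_image[OF that(1), of i] that(2) by auto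
  have s1: "Hd (\<lambda>n. of_int c :: complex)" "\<phi> (\<lambda>n. of_int (sign \<pi>)) = of_int (sign \<pi>)" for c and \<pi> :: "nat \<Rightarrow> nat"
    using phi_minus[of "\<lambda>_. 1"] phi_one by (auto simp: sign_def)
  have t: "Hd (\<lambda>n. signof \<pi> * (\<Prod>i = 0..<k + k. sylvester_mat_sub k k (fst (g n)) (snd (g n)) $$ (i, \<pi> i)))"
    "\<phi> (\<lambda>n. signof \<pi> * (\<Prod>i = 0..<k + k. sylvester_mat_sub k k (fst (g n)) (snd (g n)) $$ (i, \<pi> i))) =
     signof \<pi> * (\<Prod>i = 0..<k + k. sylvester_mat_sub k k (fst (rp2 k g)) (snd (rp2 k g)) $$ (i, \<pi> i))"
    if \<pi>: "\<pi> permutes {0..<k + k}" for \<pi>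
  proof -
    have p: "Hd (\<lambda>n. \<Prod>i = 0..<k + k. sylvester_mat_sub k k (fst (g n)) (snd (g n)) $$ (i, \<pi> i))"
      by (intro Hd_prod entry perm[OF \<pi>]) auto
    show "Hd (\<lambda>n. signof \<pi> * (\<Prod>i = 0..<k + k. sylvester_mat_sub k k (fst (g n)) (snd (g n)) $$ (i, \<pi> i)))"
      by (intro Hd_mult p s1)
    have "\<phi> (\<lambda>n. \<Prod>i = 0..<k + k. sylvester_mat_sub k k (fst (g n)) (snd (g n)) $$ (i, \<pi> i)) =
      (\<Prod>i = 0..<k + k. sylvester_mat_sub k k (fst (rp2 k g)) (snd (rp2 k g)) $$ (i, \<pi> i))"
      using entry perm[OF \<pi>] by (subst phi_prod) auto
    then show "\<phi> (\<lambda>n. signof \<pi> * (\<Prod>i = 0..<k + k. sylvester_mat_sub k k (fst (g n)) (snd (g n)) $$ (i, \<pi> i))) =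
     signof \<pi> * (\<Prod>i = 0..<k + k. sylvester_mat_sub k k (fst (rp2 k g)) (snd (rp2 k g)) $$ (i, \<pi> i))"
      using phi_mult[OF s1(1) p, of "sign \<pi>"] s1(2) by simp
  qed
  show "Hd (\<lambda>n. hres k (g n))"
    unfolding hres_def det by (intro Hd_sum t) auto
  show "\<phi> (\<lambda>n. hres k (g n)) = det (sylvester_mat_sub k k (fst (rp2 k g)) (snd (rp2 k g)))"
    unfolding hres_def det using t by (subst phi_sum) auto
qed

lemma sylvester_smult:
  fixes p q :: "'h poly"
  shows "det (sylvester_mat_sub k k (smult u p) (smult u q)) = u ^ (2 * k) * det (sylvester_mat_sub k k p q)"
proof -
  have "sylvester_mat_sub k k (smult u p) (smult u q) = u \<cdot>\<^sub>m sylvester_mat_sub k k p q"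
    by (rule eq_matI) (auto simp: sylvester_mat_sub_index)
  then show ?thesis by (simp add: det_smult mult_2)
qed

text \<open>Every coefficient is \<open>u\<close> times an element of \<open>kk\<close>, hence has
  norm 0 or that of \<open>u\<close>, and the largest has the latter. The resultant is
  \<open>u ^ (2 * k)\<close> times the resultant of a coprime pair over \<open>kk\<close>, which is
  non-zero and so of norm 1.\<close>

lemma good_reductionI:
  assumes g: "Hform2 k g" and k: "1 \<le> k" and nd: "nondeg k (rp2 k g)" and u: "u \<noteq> 0"
    and P: "P \<in> polys_over kk" "Q \<in> polys_over kk" and bez: "x * P + y * Q = 1"
    and eq: "rp2 k g = (smult u P, smult u Q)"
  shows "good_reduction F \<eta> k g"
proof -
  obtain u' where u': "Hd u'" "\<phi> u' = u" using phi_surj by blast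
  have u'pos: "0 < nrm u'"
    using u u' phi_zero_iff[OF u'(1)] Hz_iff_nrm[OF u'(1)] nrm_nonneg[of u'] by auto
  have f: "Hform k (\<lambda>n. fst (g n))" "Hform k (\<lambda>n. snd (g n))" using g by (auto simp: Hform2_def)
  have e: "rp k (\<lambda>n. fst (g n)) = smult u P" "rp k (\<lambda>n. snd (g n)) = smult u Q"
    using eq by (simp_all add: rp2_def)
  define X where "X b i n = (if b then coeff (fst (g n)) i else coeff (snd (g n)) i)" for b i n
  define Y where "Y b i = (if b then coeff P i else coeff Q i)" for b i
  have X: "Hd (X b i)" "\<phi> (X b i) = u * Y b i" "Y b i \<in> kk" for b i
    using Hform_coeff[OF f(1), of i] Hform_coeff[OF f(2), of i] Hform_rp_coeff[OF f(1), of i]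
      Hform_rp_coeff[OF f(2), of i] e P
    by (cases b; simp add: X_def[abs_def] Y_def polys_over_def)+
  have nX: "nrm (X b i) = (if Y b i = 0 then 0 else nrm u')" for b i
    by (rule kk_norm[OF X(1) u'(1) X(3)]) (simp add: X(2) u'(2))
  have PQ: "degree P \<le> k" "degree Q \<le> k" "degree P = k \<or> degree Q = k"
    using nondegD(1,2)[OF nd] nondeg_degree[of k "fst (rp2 k g)" "snd (rp2 k g)"] nd eq u by auto
  have mc: "maxcoef k (g n) = Max ((\<lambda>(b, i). cmod (X b i n)) ` (UNIV \<times> {..k}))" for n
  proof -
    have "(\<lambda>(b, i). cmod (X b i n)) ` (UNIV \<times> {..k}) =
      (\<lambda>i. cmod (coeff (fst (g n)) i)) ` {..k} \<union> (\<lambda>i. cmod (coeff (snd (g n)) i)) ` {..k}"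
      by (force simp: X_def UNIV_bool image_iff)
    then show ?thesis by (simp add: maxcoef_def)
  qed
  define mx where "mx n = complex_of_real (maxcoef k (g n))" for n
  have le: "cmod (X b i n) \<le> cmod (mx n)" if "i \<le> k" for b i n
  proof -
    have "cmod (X b i n) \<le> maxcoef k (g n)"
      unfolding mc using that by (intro Max_ge) (auto intro!: image_eqI[of _ _ "(b, i)"])
    then show ?thesis by (simp add: mx_def)
  qed
  have "ev (\<lambda>n. \<exists>bi\<in>UNIV \<times> {..k}. cmod (mx n) = cmod (X (fst bi) (snd bi) n))"
  proof (intro always_eventually allI)
    fix n
    have "maxcoef k (g n) \<in> (\<lambda>(b, i). cmod (X b i n)) ` (UNIV \<times> {..k})"
      unfolding mc by (rule Max_in) auto
    then obtain b i where "i \<le> k" "maxcoef k (g n) = cmod (X b i n)" by auto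
    then show "\<exists>bi\<in>UNIV \<times> {..k}. cmod (mx n) = cmod (X (fst bi) (snd bi) n)"
      by (intro bexI[of _ "(b, i)"]) (auto simp: mx_def)
  qed
  \<comment> \<open>The position of a largest coefficient can be fixed along the
    ultrafilter.\<close>
  then obtain b i where bi: "i \<le> k" "ev (\<lambda>n. cmod (mx n) = cmod (X b i n))"
    using ultra_bex[OF ultra, of "UNIV \<times> {..k}" "\<lambda>bi n. cmod (mx n) = cmod (X (fst bi) (snd bi) n)"] by auto
  have Hmx: "Hd mx" by (rule Hd_mono[OF _ X(1)[of b i]]) (use bi(2) in \<open>auto elim: eventually_mono\<close>)
  have "nrm mx \<le> nrm (X b i)"
    by (rule nrm_mono[OF _ X(1)]) (use bi(2) in \<open>auto elim: eventually_mono\<close>)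
  then have ub: "nrm mx \<le> nrm u'" using nX[of b i] u'pos by (auto split: if_splits)
  \<comment> \<open>One of the two polynomials has exact degree \<open>k\<close>, which provides a
    coefficient whose norm is that of \<open>u\<close>.\<close>
  obtain b' i' where b': "i' \<le> k" "Y b' i' \<noteq> 0"
  proof (cases "degree P = k")
    case True
    then have "coeff P k \<noteq> 0" using k by auto
    then show ?thesis using that[of k True] by (simp add: Y_def)
  next
    case False
    then have "degree Q = k" using PQ by blast
    then have "coeff Q k \<noteq> 0" using k by auto
    then show ?thesis using that[of k False] by (simp add: Y_def)
  qed
  have "nrm (X b' i') \<le> nrm mx"
    by (rule nrm_mono[OF _ Hmx]) (use le[OF b'(1)] in simp)
  then have nmx: "nrm mx = nrm u'" using ub nX[of b' i'] b'(2) by simp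
  have res: "Hd (\<lambda>n. hres k (g n))" "\<phi> (\<lambda>n. hres k (g n)) = u ^ (2 * k) * det (sylvester_mat_sub k k P Q)"
    using det_phi[OF g] by (simp_all add: eq sylvester_smult)
  have dnz: "det (sylvester_mat_sub k k P Q) \<noteq> 0"
    using sylvester_nonzero[OF PQ _ bez] k by simp
  have dkk: "det (sylvester_mat_sub k k P Q) \<in> kk"
  proof -
    have zero: "0 \<in> kk" and one: "1 \<in> kk" and um: "\<And>x. x \<in> kk \<Longrightarrow> - x \<in> kk"
      and mul: "\<And>x y. x \<in> kk \<Longrightarrow> y \<in> kk \<Longrightarrow> x * y \<in> kk"
      using kk_subfield by (auto simp: subfield_set_def)
    have entry: "sylvester_mat_sub k k P Q $$ (i, j) \<in> kk" if "i < k + k" "j < k + k" for i j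
      unfolding sylvester_mat_sub_index[OF that] using P zero by (auto simp: polys_over_def)
    have perm: "\<pi> i < k + k" if "\<pi> permutes {0..<k + k}" "i < k + k" for \<pi> i
      using permutes_in_image[OF that(1), of i] that(2) by auto
    have sgn: "of_int (sign \<pi>) \<in> kk" for \<pi> :: "nat \<Rightarrow> nat" using one um by (auto simp: sign_def)
    show ?thesis
      unfolding det_def'[OF sylvester_mat_sub_carrier]
      by (intro sub_sum[OF kk_subfield] mul sub_prod[OF kk_subfield] sgn entry) (auto intro: perm)
  qed
  have nu: "nrm (\<lambda>n. u' n ^ j) = nrm u' ^ j" "\<phi> (\<lambda>n. u' n ^ j) = u ^ j" for j
  proof -
    show "nrm (\<lambda>n. u' n ^ j) = nrm u' ^ j"
      using u'(1) by (induction j) (auto simp: nrm_mult Hd_power nrm_const)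
    show "\<phi> (\<lambda>n. u' n ^ j) = u ^ j" using phi_power[OF u'(1)] u'(2) by simp
  qed
  have "nrm (\<lambda>n. hres k (g n)) = nrm u' ^ (2 * k)"
    using kk_norm[OF res(1) Hd_power[OF u'(1)] dkk, of "2 * k"] res(2) dnz by (simp add: nu)
  then have "Hnorm F \<eta> (\<lambda>n. hres k (g n)) = ereal (nrm u' ^ (2 * k))"
    by (simp add: Hnorm_ereal[OF res(1)])
  moreover have "Hnorm F \<eta> (\<lambda>n. complex_of_real (maxcoef k (g n))) = ereal (nrm u')"
    using Hnorm_ereal[OF Hmx] nmx by (simp add: mx_def[abs_def])
  ultimately show ?thesis
    unfolding good_reduction_def using u'pos by simp
qed

end

text \<open>\<open>T\<close> is the normalised rescaled map, which is \<open>G\<close> over L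
  conjugated by \<open>W\<close> up to the scalars \<open>s\<close>. Over H it equals the common
  factor \<open>C\<close> times the coprime pair \<open>(A, B)\<close>, the limit of degree
  \<open>k\<close>.\<close>

locale rescaling_limit = rescaling F \<eta> \<phi> L
  for F :: "nat filter" and \<eta> :: "nat \<Rightarrow> real"
    and \<phi> :: "(nat \<Rightarrow> complex) \<Rightarrow> 'h::alg_closed_field" and L :: "(nat \<Rightarrow> complex) set" +
  fixes K k :: nat and T G :: "nat \<Rightarrow> complex poly \<times> complex poly" and W :: "nat \<Rightarrow> mobius"
    and s :: "nat \<Rightarrow> complex" and A B C :: "nat \<Rightarrow> complex poly"
  assumes W: "\<And>n. gdet (W n) \<noteq> 0"
    and G_degree: "\<And>n. degree (fst (G n)) \<le> K" "\<And>n. degree (snd (G n)) \<le> K"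
    and G_coeff: "\<And>i. (\<lambda>n. coeff (fst (G n)) i) \<in> L" "\<And>i. (\<lambda>n. coeff (snd (G n)) i) \<in> L"
    and T: "Hform2 K T"
    and conjT: "ev (\<lambda>n. \<forall>v. hev2 K (T n) v = cmul (s n) (mapp (W n) (hev2 K (G n) (mapp (madj (W n)) v))))"
    and k: "1 \<le> k" "k \<le> K"
    and AB: "Hform2 k (\<lambda>n. (A n, B n))" and C: "Hform (K - k) C" and C_nonzero: "rp (K - k) C \<noteq> 0"
    and TC: "rp2 K T = (rp (K - k) C * fst (rp2 k (\<lambda>n. (A n, B n))), rp (K - k) C * snd (rp2 k (\<lambda>n. (A n, B n))))"
    and nd: "nondeg k (rp2 k (\<lambda>n. (A n, B n)))"
begin

abbreviation "g \<equiv> rp2 k (\<lambda>n. (A n, B n))"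
abbreviation "CH \<equiv> rp (K - k) C"

lemma hev_T: "hev2 K (rp2 K T) v = cmul (hev (K - k) CH v) (hev2 k g v)"
proof -
  have "hev ((K - k) + k) (CH * p) v = hev (K - k) CH v * hev k p v" if "degree p \<le> k" for p
    using hev_mult[OF degree_rp that] .
  then show ?thesis
    using k degree_rp2[of k "\<lambda>n. (A n, B n)"] by (simp add: TC hev2_def cmul_def)
qed

text \<open>Only the point has to be defined over L: the vector \<open>y n\<close> may carry an
  arbitrary scalar depending on n.\<close>

definition LP :: "(nat \<Rightarrow> complex \<times> complex) \<Rightarrow> bool" where
  "LP y \<longleftrightarrow> (\<exists>a\<in>L. \<exists>b\<in>L. ev (\<lambda>n. (a n, b n) \<noteq> (0, 0)) \<and> ev (\<lambda>n. wedge (a n, b n) (y n) = 0))"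

text \<open>An affine zero lies in L because L is algebraically closed in the ultrapower; the point
  at infinity is over L anyway.\<close>

lemma LP_root:
  assumes deg: "\<And>n. degree (E n) \<le> m" and E: "\<And>i. (\<lambda>n. coeff (E n) i) \<in> L"
    and nz: "ev (\<lambda>n. E n \<noteq> 0)" and root: "ev (\<lambda>n. hev m (E n) (y n) = 0)"
  shows "LP y"
proof (cases "ev (\<lambda>n. snd (y n) = 0)")
  case True
  then have "ev (\<lambda>n. wedge (1, 0) (y n) = 0)" by eventually_elim (simp add: wedge_def)
  then show ?thesis
    unfolding LP_def using L_const[of 1] L_const[of 0] by (intro bexI[of _ "\<lambda>_. 1"] bexI[of _ "\<lambda>_. 0"]) auto
next
  case False
  then have sy: "ev (\<lambda>n. snd (y n) \<noteq> 0)" using ultra_not[OF ultra] by simp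
  define x where "x n = fst (y n) / snd (y n)" for n
  have "x \<in> L"
  proof (rule L_root[of m "\<lambda>i n. coeff (E n) i"])
    show "ev (\<lambda>n. \<exists>i\<le>m. coeff (E n) i \<noteq> 0)"
      using nz
    proof eventually_elim
      case (elim n)
      then show ?case using deg[of n] by (intro exI[of _ "degree (E n)"]) auto
    qed
    show "ev (\<lambda>n. (\<Sum>i\<le>m. coeff (E n) i * x n ^ i) = 0)"
      using root sy
    proof eventually_elim
      case (elim n)
      have "y n = cmul (snd (y n)) (x n, 1)" using elim(2) by (simp add: cmul_def x_def)
      then have "snd (y n) ^ m * hev m (E n) (x n, 1) = 0" using elim(1) by (metis hev_cmul)
      then show ?case using elim(2) by (simp add: hev_def)
    qed
  qed (rule E)
  moreover have "ev (\<lambda>n. wedge (x n, 1) (y n) = 0)"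
    using sy by eventually_elim (simp add: wedge_def x_def)
  ultimately show ?thesis
    unfolding LP_def using L_const[of 1] by (intro bexI[of _ x] bexI[of _ "\<lambda>_. 1"]) auto
qed

text \<open>The points of the limit that come from points over L. The lift is normalised so that it
  has a reduction, and it is pulled back by \<open>W\<close> to the coordinates in which the map has
  coefficients in L.\<close>

definition Lam :: "'h \<times> 'h \<Rightarrow> bool" where
  "Lam v \<longleftrightarrow> (\<exists>w. normalized w \<and> wedge v (phiv w) = 0 \<and> LP (\<lambda>n. mapp (madj (W n)) (w n)))"

lemma normalized_nonzero: "normalized w \<Longrightarrow> w n \<noteq> (0, 0)"
  unfolding normalized_def by (metis fst_conv snd_conv max.idem norm_zero zero_neq_one)

lemma adj_W_nonzero: "v \<noteq> (0, 0) \<Longrightarrow> mapp (madj (W n)) v \<noteq> (0, 0)"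
  using mapp_eq_0[of "madj (W n)" v] W by simp

lemma ev_form_nonzero:
  assumes "Hform m E" "rp m E \<noteq> 0"
  shows "ev (\<lambda>n. E n \<noteq> 0)"
proof -
  obtain i where "coeff (rp m E) i \<noteq> 0" using assms(2) by (metis coeff_0 poly_eqI)
  then have "\<not> Hz (\<lambda>n. coeff (E n) i)"
    using Hform_rp_coeff[OF assms(1)] phi_zero_iff[OF Hform_coeff[OF assms(1)]] by simp
  from not_Hz_nonzero[OF this] show ?thesis by (rule eventually_mono) auto
qed

lemma T_degree: "degree (fst (T n)) \<le> K" "degree (snd (T n)) \<le> K"
  using T Hform_degree unfolding Hform2_def by blast+

text \<open>A fixed point of the limit is a zero of the reduced fixed form of \<open>T\<close>, so
  it lifts to exact fixed points of \<open>T n\<close>; these correspond under \<open>W n\<close> to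
  zeros of the fixed form of \<open>G n\<close>, which is over L. The common factor \<open>C\<close>
  only adds zeros.\<close>

lemma Lam_fixed:
  assumes ff: "fixform g \<noteq> 0" and v: "wedge v (hev2 k g v) = 0"
  shows "Lam v"
proof -
  have T': "Hform K (\<lambda>n. fst (T n))" "Hform K (\<lambda>n. snd (T n))" using T by (auto simp: Hform2_def)
  note E = Hform_fixform[OF T']
  have rE: "rp (Suc K) (\<lambda>n. fixform (T n)) = CH * fixform g"
  proof -
    have "rp (Suc K) (\<lambda>n. fixform (T n)) = fixform (rp2 K T)" using E(2) by (simp add: rp2_def)
    also have "\<dots> = CH * fixform g" by (simp add: TC fixform_def right_diff_distrib)
    finally show ?thesis .
  qed
  have nz: "rp (Suc K) (\<lambda>n. fixform (T n)) \<noteq> 0" unfolding rE using ff C_nonzero by simp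
  have "hev (Suc K) (rp (Suc K) (\<lambda>n. fixform (T n))) v = 0"
  proof -
    have "hev ((K - k) + Suc k) (CH * fixform g) v = hev (K - k) CH v * hev (Suc k) (fixform g) v"
      by (rule hev_mult[OF degree_rp degree_fixform[OF degree_rp2]])
    moreover have "(K - k) + Suc k = Suc K" using k by simp
    ultimately show ?thesis
      unfolding rE using v by (simp add: hev_fixform degree_rp2)
  qed
  then obtain w where w: "normalized w" "\<And>n. hev (Suc K) (fixform (T n)) (w n) = 0" "wedge v (phiv w) = 0"
    using zero_lift[OF E(1) nz] by metis
  define y where "y n = mapp (madj (W n)) (w n)" for n
  have key: "ev (\<lambda>n. fixform (G n) \<noteq> 0 \<and> hev (Suc K) (fixform (G n)) (y n) = 0)"
    using conjT ev_form_nonzero[OF E(1) nz]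
  proof eventually_elim
    case (elim n)
    \<comment> \<open>Moving \<open>W n\<close> across the wedge as its adjugate identifies the
      fixed form of \<open>T n\<close> with that of \<open>G n\<close> up to the scalar
      \<open>s n\<close>.\<close>
    have eq: "hev (Suc K) (fixform (T n)) u = s n * hev (Suc K) (fixform (G n)) (mapp (madj (W n)) u)" for u
      using elim(1)[rule_format, of u] by (simp add: hev_fixform T_degree G_degree wedge_adj)
    have nz: "\<exists>u. hev (Suc K) (fixform (T n)) u \<noteq> 0"
      using form_eqI[of "fixform (T n)" "Suc K" 0] degree_fixform[OF T_degree] elim(2) by fastforce
    then have "s n \<noteq> 0" "fixform (G n) \<noteq> 0" using eq by auto
    moreover have "hev (Suc K) (fixform (G n)) (y n) = 0"
      using eq[of "w n"] w(2) \<open>s n \<noteq> 0\<close> by (simp add: y_def)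
    ultimately show ?case by blast
  qed
  have "LP y"
  proof (rule LP_root[of "\<lambda>n. fixform (G n)" "Suc K"])
    show "degree (fixform (G n)) \<le> Suc K" for n by (rule degree_fixform[OF G_degree])
    show "(\<lambda>n. coeff (fixform (G n)) i) \<in> L" for i
    proof (cases i)
      case 0
      then show ?thesis using Lring.minus[OF G_coeff(1)[of 0]] by (simp add: fixform_def)
    next
      case (Suc j)
      then show ?thesis
        using L_add[OF G_coeff(2)[of j] Lring.minus[OF G_coeff(1)[of i]]] by (simp add: fixform_def)
    qed
  qed (use key in \<open>auto elim: eventually_mono\<close>)
  then show ?thesis unfolding Lam_def y_def[abs_def] using w by blast
qed

text \<open>The argument for fixed points, applied to the preimage form of a lift \<open>w\<close>
  of \<open>p\<close>. Pulled back by \<open>W\<close>, the target becomes a point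
  \<open>(a, b)\<close> over L, so the preimage form of \<open>G\<close> is over L as well.\<close>

lemma Lam_preimage:
  assumes p: "p \<noteq> (0, 0)" "Lam p" and v: "wedge (hev2 k g v) p = 0"
  shows "Lam v"
proof -
  obtain w where w: "normalized w" "wedge p (phiv w) = 0" "LP (\<lambda>n. mapp (madj (W n)) (w n))"
    using p(2) unfolding Lam_def by blast
  then obtain a b where ab: "a \<in> L" "b \<in> L" "ev (\<lambda>n. (a n, b n) \<noteq> (0, 0))"
    "ev (\<lambda>n. wedge (a n, b n) (mapp (madj (W n)) (w n)) = 0)" unfolding LP_def by blast
  have T': "Hform K (\<lambda>n. fst (T n))" "Hform K (\<lambda>n. snd (T n))" using T by (auto simp: Hform2_def)
  note E = Hform_preform[OF T' normalized_vHd[OF w(1)]]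
  have rE: "rp K (\<lambda>n. preform (w n) (T n)) = CH * preform (phiv w) g"
  proof -
    have "rp K (\<lambda>n. preform (w n) (T n)) = preform (phiv w) (rp2 K T)" using E(2) by (simp add: rp2_def)
    also have "\<dots> = CH * preform (phiv w) g" by (simp add: TC preform_def right_diff_distrib)
    finally show ?thesis .
  qed
  have nz: "rp K (\<lambda>n. preform (w n) (T n)) \<noteq> 0"
    unfolding rE using preform_nonzero[OF nd k(1) normalized_phiv[OF w(1)]] C_nonzero by simp
  have "hev K (rp K (\<lambda>n. preform (w n) (T n))) v = 0"
  proof -
    have "hev ((K - k) + k) (CH * preform (phiv w) g) v = hev (K - k) CH v * hev k (preform (phiv w) g) v"
      by (rule hev_mult[OF degree_rp degree_preform[OF degree_rp2]])
    moreover have "wedge (hev2 k g v) (phiv w) = 0" by (rule wedge_trans[OF v w(2) p(1)])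
    ultimately show ?thesis unfolding rE using k by (simp add: hev_preform)
  qed
  then obtain u where u: "normalized u" "\<And>n. hev K (preform (w n) (T n)) (u n) = 0" "wedge v (phiv u) = 0"
    using zero_lift[OF E(1) nz] by metis
  define y where "y n = mapp (madj (W n)) (u n)" for n
  have key: "ev (\<lambda>n. preform (a n, b n) (G n) \<noteq> 0 \<and> hev K (preform (a n, b n) (G n)) (y n) = 0)"
    using conjT ev_form_nonzero[OF E(1) nz] ab(3,4)
  proof eventually_elim
    case (elim n)
    let ?z = "mapp (madj (W n)) (w n)"
    have zn: "?z \<noteq> (0, 0)" by (rule adj_W_nonzero[OF normalized_nonzero[OF w(1)]])
    have eq: "hev K (preform (w n) (T n)) x = - s n * wedge ?z (hev2 K (G n) (mapp (madj (W n)) x))" for x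
    proof -
      have "hev K (preform (w n) (T n)) x = s n * wedge (mapp (W n) (hev2 K (G n) (mapp (madj (W n)) x))) (w n)"
        using elim(1)[rule_format, of x] by (simp add: hev_preform)
      also have "\<dots> = - s n * wedge (w n) (mapp (W n) (hev2 K (G n) (mapp (madj (W n)) x)))"
        using wedge_swap[of "mapp (W n) (hev2 K (G n) (mapp (madj (W n)) x))" "w n"] by simp
      finally show ?thesis by (simp only: wedge_adj)
    qed
    obtain x where x: "hev K (preform (w n) (T n)) x \<noteq> 0"
      using form_eqI[of "preform (w n) (T n)" K 0] degree_preform[OF T_degree] elim(2) by fastforce
    have "preform (a n, b n) (G n) \<noteq> 0"
    proof
      assume "preform (a n, b n) (G n) = 0"
      then have "wedge (hev2 K (G n) (mapp (madj (W n)) x)) (a n, b n) = 0"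
        using hev_preform[of K "(a n, b n)" "G n" "mapp (madj (W n)) x"] by simp
      then have "wedge (hev2 K (G n) (mapp (madj (W n)) x)) ?z = 0"
        using wedge_trans elim(3,4) by blast
      then have "wedge ?z (hev2 K (G n) (mapp (madj (W n)) x)) = 0" by (subst wedge_swap_zero)
      then show False using x unfolding eq by simp
    qed
    moreover have "hev K (preform (a n, b n) (G n)) (y n) = 0"
    proof -
      have "s n \<noteq> 0" using x unfolding eq by auto
      then have "wedge ?z (hev2 K (G n) (y n)) = 0" using u(2)[of n] unfolding eq y_def by simp
      then have "wedge (hev2 K (G n) (y n)) (a n, b n) = 0"
        using wedge_trans[of "hev2 K (G n) (y n)" ?z "(a n, b n)"] elim(4) zn wedge_swap_zero by metis
      then show ?thesis by (simp add: hev_preform)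
    qed
    ultimately show ?case by blast
  qed
  have "LP y"
  proof (rule LP_root[of "\<lambda>n. preform (a n, b n) (G n)" K])
    show "degree (preform (a n, b n) (G n)) \<le> K" for n by (rule degree_preform[OF G_degree])
    show "(\<lambda>n. coeff (preform (a n, b n) (G n)) i) \<in> L" for i
      using L_add[OF L_mult[OF ab(2) G_coeff(1)[of i]] Lring.minus[OF L_mult[OF ab(1) G_coeff(2)[of i]]]]
      by (simp add: preform_def)
  qed (use key in \<open>auto elim: eventually_mono\<close>)
  then show ?thesis unfolding Lam_def y_def[abs_def] using u by blast
qed

lemma cols_phi: "vHd p \<Longrightarrow> vHd q \<Longrightarrow> mHd (\<lambda>n. cols (p n) (q n))"
  "pm (\<lambda>n. cols (p n) (q n)) = cols (phiv p) (phiv q)"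
  by (simp_all add: vHd_def mHd_def cols_def pm_def phiv_def)

text \<open>In a basis whose vectors pull back to \<sigma> and \<tau> times vectors over L, the
  rescaled map is a map \<open>E\<close> over L conjugated by the diagonal matrix of \<sigma> and
  \<tau>. Its coefficients are those of \<open>E\<close> times known monomials in \<sigma> and
  \<tau>.\<close>

lemma base_change:
  assumes L4: "a \<in> L" "b \<in> L" "a' \<in> L" "b' \<in> L"
    and P: "ev (\<lambda>n. mapp (madj (W n)) (p n) = cmul (\<sigma> n) (a n, b n))"
    and Q: "ev (\<lambda>n. mapp (madj (W n)) (q n) = cmul (\<tau> n) (a' n, b' n))"
  obtains E where "\<And>i. (\<lambda>n. coeff (fst (E n)) i) \<in> L" "\<And>i. (\<lambda>n. coeff (snd (E n)) i) \<in> L"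
    "ev (\<lambda>n. \<forall>i\<le>K.
      coeff (fst (conj K (madj (cols (p n) (q n))) (T n))) i = s n * \<tau> n * (\<sigma> n ^ i * \<tau> n ^ (K - i)) * coeff (fst (E n)) i \<and>
      coeff (snd (conj K (madj (cols (p n) (q n))) (T n))) i = s n * \<sigma> n * (\<sigma> n ^ i * \<tau> n ^ (K - i)) * coeff (snd (E n)) i)"
proof -
  \<comment> \<open>With U the basis \<open>p\<close>, \<open>q\<close>, the matrix
    \<open>madj W\<close> times U is \<open>Y\<close> times the diagonal matrix of \<sigma> and
    \<tau>, and \<open>Y\<close> is over L.\<close>
  define Y where "Y n = cols (a n, b n) (a' n, b' n)" for n
  define E where "E n = conj K (madj (Y n)) (G n)" for n
  have "Lring.rmat (\<lambda>n. madj (Y n))"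
    by (rule Lring.rmat_madj) (use L4 in \<open>simp add: Lring.rmat_def Y_def cols_def\<close>)
  moreover have "(\<lambda>n. fst (G n)) \<in> Lring.rpolys" "(\<lambda>n. snd (G n)) \<in> Lring.rpolys"
    using G_coeff by (auto simp: Lring.rpolys_def)
  ultimately have EL: "(\<lambda>n. fst (E n)) \<in> Lring.rpolys" "(\<lambda>n. snd (E n)) \<in> Lring.rpolys"
    unfolding E_def by (rule Lring.rpolys_conj)+
  have "ev (\<lambda>n. \<forall>i\<le>K.
      coeff (fst (conj K (madj (cols (p n) (q n))) (T n))) i = s n * \<tau> n * (\<sigma> n ^ i * \<tau> n ^ (K - i)) * coeff (fst (E n)) i \<and>
      coeff (snd (conj K (madj (cols (p n) (q n))) (T n))) i = s n * \<sigma> n * (\<sigma> n ^ i * \<tau> n ^ (K - i)) * coeff (snd (E n)) i)"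
    using conjT P Q
  proof eventually_elim
    case (elim n)
    let ?U = "cols (p n) (q n)"
    have lin: "mapp m (mapp (cols p' q') v) = mapp (cols (mapp m p') (mapp m q')) v" for m p' q' and v :: "complex \<times> complex"
      by (cases m) (simp add: mapp_def cols_def algebra_simps)
    have cc: "mapp (cols (cmul x p') (cmul y q')) v = mapp (cols p' q') (x * fst v, y * snd v)" for x y p' q' and v :: "complex \<times> complex"
      by (simp add: mapp_def cols_def cmul_def algebra_simps)
    have ev2: "hev2 K (conj K (madj ?U) (T n)) v =
      (s n * \<tau> n * hev K (fst (E n)) (\<sigma> n * fst v, \<tau> n * snd v),
       s n * \<sigma> n * hev K (snd (E n)) (\<sigma> n * fst v, \<tau> n * snd v))" for v
    proof -
      define z where "z = hev2 K (G n) (mapp (Y n) (\<sigma> n * fst v, \<tau> n * snd v))"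
      have "mapp (madj (W n)) (mapp ?U v) = mapp (Y n) (\<sigma> n * fst v, \<tau> n * snd v)"
        unfolding lin elim(2,3) cc Y_def ..
      then have "hev2 K (conj K (madj ?U) (T n)) v = mapp (madj ?U) (cmul (s n) (mapp (W n) z))"
        using elim(1)[rule_format, of "mapp ?U v"] by (simp add: conj_eval(1)[OF T_degree] z_def)
      also have "\<dots> = (s n * wedge (mapp (W n) z) (q n), s n * wedge (p n) (mapp (W n) z))"
        by (simp add: mapp_cols)
      also have "wedge (mapp (W n) z) (q n) = - wedge (mapp (madj (W n)) (q n)) z"
        by (subst wedge_swap) (simp only: wedge_adj)
      also have "\<dots> = \<tau> n * wedge z (a' n, b' n)"
        using wedge_swap[of z "(a' n, b' n)"] by (simp add: elim(3))
      also have "wedge (p n) (mapp (W n) z) = \<sigma> n * wedge (a n, b n) z"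
        by (simp add: wedge_adj elim(2))
      finally have *: "hev2 K (conj K (madj ?U) (T n)) v =
        (s n * (\<tau> n * wedge z (a' n, b' n)), s n * (\<sigma> n * wedge (a n, b n) z))" .
      have "hev2 K (E n) (\<sigma> n * fst v, \<tau> n * snd v) = (wedge z (a' n, b' n), wedge (a n, b n) z)"
        unfolding E_def conj_eval(1)[OF G_degree] madj_madj z_def[symmetric] by (simp add: Y_def mapp_cols)
      then show ?thesis unfolding * by (simp add: hev2_def)
    qed
    have "degree (fst (E n)) \<le> K" "degree (snd (E n)) \<le> K"
      unfolding E_def by (rule conj_eval[OF G_degree])+
    then show ?case
      using ev2 conj_eval(2,3)[OF T_degree, where m = "madj ?U"]
      by (auto simp: hev2_def intro!: coeff_scaled_form)
  qed
  then show ?thesis using that[of E] EL by (simp add: Lring.rpolys_def)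
qed

text \<open>The base change is invertible over H, so it preserves the coprimality of the limit and
  merely substitutes into the common factor.\<close>

lemma reduction_conj:
  assumes p: "vHd p" "vHd q" and det: "wedge (phiv p) (phiv q) \<noteq> 0"
  shows "Hform2 k (\<lambda>n. conj k (madj (cols (p n) (q n))) (A n, B n))"
    "Hform2 K (\<lambda>n. conj K (madj (cols (p n) (q n))) (T n))"
    "nondeg k (rp2 k (\<lambda>n. conj k (madj (cols (p n) (q n))) (A n, B n)))"
    "hev2 k (rp2 k (\<lambda>n. conj k (madj (cols (p n) (q n))) (A n, B n))) v =
       mapp (madj (cols (phiv p) (phiv q))) (hev2 k g (mapp (cols (phiv p) (phiv q)) v))"
    "\<exists>c. c \<noteq> 0 \<and> rp2 K (\<lambda>n. conj K (madj (cols (p n) (q n))) (T n)) =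
       (c * fst (rp2 k (\<lambda>n. conj k (madj (cols (p n) (q n))) (A n, B n))),
        c * snd (rp2 k (\<lambda>n. conj k (madj (cols (p n) (q n))) (A n, B n))))"
proof -
  define U where "U n = cols (p n) (q n)" for n
  define u where "u = cols (phiv p) (phiv q)"
  have mU: "mHd U" and pU: "pm U = u" using cols_phi p by (auto simp: U_def[abs_def] u_def)
  have du: "gdet u \<noteq> 0" "gdet (madj u) \<noteq> 0" using det by (simp_all add: u_def mapp_cols)
  note mN = madj_phi[OF mU]
  note cA = Hform2_conj[OF AB mN(1), unfolded mN(2) pU madj_madj]
  note cT = Hform2_conj[OF T mN(1), unfolded mN(2) pU madj_madj]
  show "Hform2 k (\<lambda>n. conj k (madj (cols (p n) (q n))) (A n, B n))"
    "Hform2 K (\<lambda>n. conj K (madj (cols (p n) (q n))) (T n))"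
    using cA(1) cT(1) by (simp_all add: U_def)
  show "hev2 k (rp2 k (\<lambda>n. conj k (madj (cols (p n) (q n))) (A n, B n))) v =
       mapp (madj (cols (phiv p) (phiv q))) (hev2 k g (mapp (cols (phiv p) (phiv q)) v))"
    using cA(2) by (simp add: U_def u_def)
  let ?A = "rp2 k (\<lambda>n. conj k (madj (U n)) (A n, B n))"
  let ?T = "rp2 K (\<lambda>n. conj K (madj (U n)) (T n))"
  have "nondeg k ?A"
    unfolding nondeg_def
  proof (intro conjI allI impI degree_rp2)
    fix v :: "'h \<times> 'h" assume "v \<noteq> (0, 0)"
    then have "mapp u v \<noteq> (0, 0)" using mapp_eq_0[OF du(1)] by blast
    then have "hev2 k g (mapp u v) \<noteq> (0, 0)" by (rule nondegD(3)[OF nd])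
    then show "hev2 k ?A v \<noteq> (0, 0)" unfolding cA(2) using mapp_eq_0[OF du(2)] by blast
  qed
  then show "nondeg k (rp2 k (\<lambda>n. conj k (madj (cols (p n) (q n))) (A n, B n)))" by (simp add: U_def)
  \<comment> \<open>The common factor in the new coordinates; it is non-zero because substituting
    the adjugate recovers \<open>C\<close> up to a power of the determinant.\<close>
  define D where "D n = hsubst (K - k) (C n) (fst (mob (U n))) (snd (mob (U n)))" for n
  have dD: "degree (D n) \<le> K - k" for n
    using hev_hsubst(2)[OF mob_eval(3,4)[of "U n"], of "K - k" "C n"] by (simp add: D_def)
  have "Hring.rmat U" using mU by (simp add: Hring.rmat_def mHd_def)
  moreover have "C \<in> Hring.rpolys" using Hform_coeff[OF C] by (simp add: Hring.rpolys_def)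
  ultimately have "D \<in> Hring.rpolys"
    unfolding D_def[abs_def] by (intro Hring.rpolys_hsubst Hring.rpolys_mob)
  then have HD: "Hform (K - k) D" using dD by (intro HformI) (auto simp: Hring.rpolys_def)
  define c where "c = rp (K - k) D"
  have hc: "hev (K - k) c v = hev (K - k) CH (mapp u v)" for v
  proof -
    obtain w where w: "vHd w" "phiv w = v" by (rule lift_vec)
    have "hev (K - k) (D n) (w n) = hev (K - k) (C n) (mapp (U n) (w n))" for n
      using hev_hsubst(1)[OF mob_eval(3,4)[of "U n"], of "K - k" "C n" "w n"] mob_eval(1)[of "U n" "w n"]
      by (simp add: D_def hev2_def)
    then show ?thesis
      using hev_rp(2)[OF HD w(1)] hev_rp(2)[OF C mapp_phi(1)[OF mU w(1)]] mapp_phi(2)[OF mU w(1)] w(2) pU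
      by (simp add: c_def)
  qed
  have "c \<noteq> 0"
  proof
    assume "c = 0"
    obtain v where v: "hev (K - k) CH v \<noteq> 0" using form_nonzero_at[OF degree_rp C_nonzero] .
    have "hev (K - k) CH (mapp u (mapp (madj u) v)) = 0"
      using hc[of "mapp (madj u) v"] \<open>c = 0\<close> by simp
    then show False using v du(1) by (simp add: mapp_madj hev_cmul)
  qed
  moreover have "?T = (c * fst ?A, c * snd ?A)"
  proof -
    have ev: "hev2 K ?T v = cmul (hev (K - k) c v) (hev2 k ?A v)" for v
      unfolding cT(2) cA(2) hev_T hc mapp_cmul ..
    have dc: "degree c \<le> K - k" by (simp add: c_def degree_rp)
    have kK: "K - k + k = K" using k by simp
    have m: "hev K (c * x) v = hev (K - k) c v * hev k x v" "degree (c * x) \<le> K" if "degree x \<le> k" for x v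
    proof -
      show "hev K (c * x) v = hev (K - k) c v * hev k x v" using hev_mult[OF dc that, of v] by (simp only: kK)
      show "degree (c * x) \<le> K" using degree_mult_le[of c x] dc that kK by linarith
    qed
    have "fst ?T = c * fst ?A"
      by (rule form_eqI_H[OF degree_rp2(1) m(2)[OF degree_rp2(1)]])
         (use ev in \<open>simp add: m(1)[OF degree_rp2(1)] hev2_def cmul_def\<close>)
    moreover have "snd ?T = c * snd ?A"
      by (rule form_eqI_H[OF degree_rp2(2) m(2)[OF degree_rp2(2)]])
         (use ev in \<open>simp add: m(1)[OF degree_rp2(2)] hev2_def cmul_def\<close>)
    ultimately show ?thesis by (simp add: prod_eq_iff)
  qed
  ultimately show "\<exists>c. c \<noteq> 0 \<and> rp2 K (\<lambda>n. conj K (madj (cols (p n) (q n))) (T n)) =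
       (c * fst (rp2 k (\<lambda>n. conj k (madj (cols (p n) (q n))) (A n, B n))),
        c * snd (rp2 k (\<lambda>n. conj k (madj (cols (p n) (q n))) (A n, B n))))"
    by (auto simp: U_def)
qed

lemma pot_good_reductionI:
  assumes p: "vHd p" "vHd q" and det: "wedge (phiv p) (phiv q) \<noteq> 0"
    and gr: "good_reduction F \<eta> k (\<lambda>n. conj k (madj (cols (p n) (q n))) (A n, B n))"
  shows "pot_good_reduction F \<eta> k A B"
proof -
  have mU: "mHd (\<lambda>n. cols (p n) (q n))" by (rule cols_phi(1)[OF p])
  note mN = madj_phi[OF mU]
  have "Hd (\<lambda>n. gdet (madj (cols (p n) (q n))))" "\<phi> (\<lambda>n. gdet (madj (cols (p n) (q n)))) \<noteq> 0"
    using gdet_phi[OF mN(1)] det by (simp_all add: mN(2) cols_phi(2) mapp_cols)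
  then have "\<not> Hz (\<lambda>n. mob_det (madj (cols (p n) (q n))))"
    using phi_zero_iff by (simp add: gdet_mob)
  then show ?thesis
    unfolding pot_good_reduction_def using mN(1) gr
    by (intro exI[of _ "\<lambda>n. madj (cols (p n) (q n))"]) (simp add: mHd_def)
qed

lemma LP_scalar:
  assumes "LP y" "\<And>n. y n \<noteq> (0, 0)"
  obtains a b \<sigma> where "a \<in> L" "b \<in> L" "ev (\<lambda>n. (a n, b n) \<noteq> (0, 0))"
    "ev (\<lambda>n. \<sigma> n \<noteq> 0 \<and> y n = cmul (\<sigma> n) (a n, b n))"
proof -
  obtain a b where ab: "a \<in> L" "b \<in> L" "ev (\<lambda>n. (a n, b n) \<noteq> (0, 0))" "ev (\<lambda>n. wedge (a n, b n) (y n) = 0)"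
    using assms(1) unfolding LP_def by blast
  define \<sigma> where "\<sigma> n = (SOME c. y n = cmul c (a n, b n))" for n
  have "ev (\<lambda>n. \<sigma> n \<noteq> 0 \<and> y n = cmul (\<sigma> n) (a n, b n))"
    using ab(3,4)
  proof eventually_elim
    case (elim n)
    obtain c where "y n = cmul c (a n, b n)" using wedge_zero_imp_cmul[OF elim(2,1)] .
    then have y: "y n = cmul (\<sigma> n) (a n, b n)" unfolding \<sigma>_def by (rule someI)
    moreover have "\<sigma> n \<noteq> 0" using y assms(2)[of n] by (auto simp: cmul_def)
    ultimately show ?case by blast
  qed
  then show ?thesis using that ab by blast
qed

end

lemma wedge_nonzero_transfer:
  fixes p q p' q' :: "'a::field \<times> 'a"
  assumes "wedge p q \<noteq> 0" "wedge p p' = 0" "wedge q q' = 0" "p' \<noteq> (0, 0)" "q' \<noteq> (0, 0)"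
  shows "wedge p' q' \<noteq> 0"
proof
  assume "wedge p' q' = 0"
  then have "wedge p q' = 0" using wedge_trans[OF assms(2)] assms(4) by blast
  moreover have "wedge q' q = 0" using assms(3) by (subst wedge_swap_zero)
  ultimately show False using wedge_trans[of p q' q] assms(1,5) by blast
qed

lemma hev2_linear:
  "hev2 1 g (x * fst p + y * fst q, x * snd p + y * snd q) =
    (x * fst (hev2 1 g p) + y * fst (hev2 1 g q), x * snd (hev2 1 g p) + y * snd (hev2 1 g q))"
  for x y :: "'a::comm_ring_1"
  by (simp add: hev2_def hev_def algebra_simps)

section \<open>Potential good reduction of the limit\<close>

context rescaling_limit
begin

text \<open>The reduction of \<open>T\<close> still contains the common factor. Dividing the pair
  over \<open>kk\<close> by its greatest common divisor gives a coprime pair over \<open>kk\<close>,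
  and the limit, being coprime as well, is a scalar multiple of it.\<close>

lemma pot_good_reduction_of_kk:
  assumes p: "vHd p" "vHd q" and det: "wedge (phiv p) (phiv q) \<noteq> 0"
    and PQ: "P \<in> polys_over kk" "Q \<in> polys_over kk" and \<sigma>: "\<sigma> \<noteq> 0"
    and eq: "rp2 K (\<lambda>n. conj K (madj (cols (p n) (q n))) (T n)) = (smult \<sigma> P, smult \<sigma> Q)"
  shows "pot_good_reduction F \<eta> k A B"
proof -
  note r = reduction_conj[OF p det]
  let ?A = "rp2 k (\<lambda>n. conj k (madj (cols (p n) (q n))) (A n, B n))"
  obtain c where c: "c \<noteq> 0" "smult \<sigma> P = c * fst ?A" "smult \<sigma> Q = c * snd ?A"
    using r(5) eq by auto
  have "fst ?A \<noteq> 0 \<or> snd ?A \<noteq> 0"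
  proof (rule ccontr)
    assume "\<not> ?thesis"
    then have "hev2 k ?A (1, 0) = (0, 0)" by (simp add: hev2_def)
    moreover have "(1, 0) \<noteq> (0 :: 'h, 0 :: 'h)" by simp
    ultimately show False using nondegD(3)[OF r(3), of "(1, 0)"] by blast
  qed
  then have "P \<noteq> 0 \<or> Q \<noteq> 0" using c by auto
  from polys_over_bezout[OF kk_subfield PQ this] obtain d p' q' x y
    where b: "p' \<in> polys_over kk" "q' \<in> polys_over kk" "d \<noteq> 0" "P = d * p'" "Q = d * q'" "x * p' + y * q' = 1"
    by blast
  have nd': "nondeg k (fst ?A, snd ?A)" using r(3) by simp
  have e: "c * fst ?A = smult \<sigma> d * p'" "c * snd ?A = smult \<sigma> d * q'" "smult \<sigma> d \<noteq> 0"
    using c b \<sigma> by auto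
  obtain u where u: "u \<noteq> 0" "fst ?A = smult u p'" "snd ?A = smult u q'"
    using alg_closed_coprime_scalar[OF b(6) nd' k(1) c(1) e(3) e(1,2)] .
  have "good_reduction F \<eta> k (\<lambda>n. conj k (madj (cols (p n) (q n))) (A n, B n))"
    by (rule good_reductionI[OF r(1) k(1) r(3) u(1) b(1,2,6)]) (use u in \<open>simp add: prod_eq_iff\<close>)
  then show ?thesis by (rule pot_good_reductionI[OF p det])
qed

lemma Lam_lift:
  assumes "Lam v"
  obtains w a b \<sigma> where "normalized w" "wedge v (phiv w) = 0" "a \<in> L" "b \<in> L"
    "ev (\<lambda>n. mapp (madj (W n)) (w n) = cmul (\<sigma> n) (a n, b n))"
proof -
  obtain w where w: "normalized w" "wedge v (phiv w) = 0" "LP (\<lambda>n. mapp (madj (W n)) (w n))"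
    using assms unfolding Lam_def by blast
  obtain a b \<sigma> where ab: "a \<in> L" "b \<in> L" "ev (\<lambda>n. (a n, b n) \<noteq> (0, 0))"
    "ev (\<lambda>n. \<sigma> n \<noteq> 0 \<and> mapp (madj (W n)) (w n) = cmul (\<sigma> n) (a n, b n))"
    using LP_scalar[OF w(3) adj_W_nonzero[OF normalized_nonzero[OF w(1)]]] .
  from ab(4) have "ev (\<lambda>n. mapp (madj (W n)) (w n) = cmul (\<sigma> n) (a n, b n))"
    by (rule eventually_mono) (erule conjunct2)
  then show ?thesis using that[OF w(1,2) ab(1,2)] by blast
qed

text \<open>The third point removes the diagonal freedom: with representatives P, Q, P + Q the two
  scalars in \<open>base_change\<close> coincide, so all coefficients share one factor and their
  ratios reduce into \<open>kk\<close>.\<close>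

lemma pot_good_reduction_three:
  assumes ind: "indep3 p q r" and Lam: "Lam p" "Lam q" "Lam r"
  shows "pot_good_reduction F \<eta> k A B"
proof -
  obtain wp a1 b1 \<sigma>1 where p: "normalized wp" "wedge p (phiv wp) = 0" "a1 \<in> L" "b1 \<in> L"
    "ev (\<lambda>n. mapp (madj (W n)) (wp n) = cmul (\<sigma>1 n) (a1 n, b1 n))" using Lam_lift[OF Lam(1)] .
  obtain wq a2 b2 \<sigma>2 where q: "normalized wq" "wedge q (phiv wq) = 0" "a2 \<in> L" "b2 \<in> L"
    "ev (\<lambda>n. mapp (madj (W n)) (wq n) = cmul (\<sigma>2 n) (a2 n, b2 n))" using Lam_lift[OF Lam(2)] .
  obtain wr a3 b3 \<sigma>3 where r: "normalized wr" "wedge r (phiv wr) = 0" "a3 \<in> L" "b3 \<in> L"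
    "ev (\<lambda>n. mapp (madj (W n)) (wr n) = cmul (\<sigma>3 n) (a3 n, b3 n))" using Lam_lift[OF Lam(3)] .
  note vH = normalized_vHd[OF p(1)] normalized_vHd[OF q(1)] normalized_vHd[OF r(1)]
  note nz = normalized_phiv[OF p(1)] normalized_phiv[OF q(1)] normalized_phiv[OF r(1)]
  have w: "wedge (phiv wp) (phiv wq) \<noteq> 0" "wedge (phiv wq) (phiv wr) \<noteq> 0" "wedge (phiv wp) (phiv wr) \<noteq> 0"
    using ind wedge_nonzero_transfer p(2) q(2) r(2) nz unfolding indep3_def by blast+
  \<comment> \<open>Scaled as in \<open>wedge_decompose\<close>, so that the third point is
    represented by the sum of \<open>P n\<close> and \<open>Q n\<close>.\<close>
  define P where "P n = cmul (wedge (wr n) (wq n)) (wp n)" for n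
  define Q where "Q n = cmul (wedge (wp n) (wr n)) (wq n)" for n
  have hP: "vHd P" "phiv P = cmul (wedge (phiv wr) (phiv wq)) (phiv wp)"
    unfolding P_def[abs_def] using cmul_phi[OF wedge_phi(1)[OF vH(3,2)] vH(1)] wedge_phi(2)[OF vH(3,2)] by auto
  have hQ: "vHd Q" "phiv Q = cmul (wedge (phiv wp) (phiv wr)) (phiv wq)"
    unfolding Q_def[abs_def] using cmul_phi[OF wedge_phi(1)[OF vH(1,3)] vH(2)] wedge_phi(2)[OF vH(1,3)] by auto
  have det: "wedge (phiv P) (phiv Q) \<noteq> 0"
    unfolding hP hQ using w wedge_swap[of "phiv wr" "phiv wq"] by simp
  define m1 where "m1 n = wedge (a3 n, b3 n) (a2 n, b2 n)" for n
  define m2 where "m2 n = wedge (a1 n, b1 n) (a3 n, b3 n)" for n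
  have mL: "m1 \<in> L" "m2 \<in> L"
    using L_add[OF L_mult[OF r(3) q(4)] Lring.minus[OF L_mult[OF r(4) q(3)]]]
      L_add[OF L_mult[OF p(3) r(4)] Lring.minus[OF L_mult[OF p(4) r(3)]]]
    by (simp_all add: m1_def[abs_def] m2_def[abs_def] wedge_def)
  \<comment> \<open>The common scalar: the wedge scaling \<open>wp\<close> contributes \<sigma>3 and
    \<sigma>2 while \<open>wp\<close> itself carries \<sigma>1, and for \<open>wq\<close> the same
    product arises in another order.\<close>
  define \<kappa> where "\<kappa> n = \<sigma>1 n * \<sigma>2 n * \<sigma>3 n / gdet (W n)" for n
  have adj: "ev (\<lambda>n. mapp (madj (W n)) (P n) = cmul (\<kappa> n) (m1 n * a1 n, m1 n * b1 n) \<and>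
                   mapp (madj (W n)) (Q n) = cmul (\<kappa> n) (m2 n * a2 n, m2 n * b2 n))"
    using p(5) q(5) r(5)
  proof eventually_elim
    case (elim n)
    have "gdet (W n) * wedge (wr n) (wq n) = wedge (mapp (madj (W n)) (wr n)) (mapp (madj (W n)) (wq n))"
      by (simp only: wedge_mapp gdet_madj)
    also have "\<dots> = \<sigma>3 n * \<sigma>2 n * m1 n" by (simp only: elim) (simp add: m1_def)
    finally have "gdet (W n) * wedge (wr n) (wq n) = \<sigma>3 n * \<sigma>2 n * m1 n" .
    then have e1: "wedge (wr n) (wq n) = \<sigma>3 n * \<sigma>2 n * m1 n / gdet (W n)" using W[of n] by (simp add: field_simps)
    have "gdet (W n) * wedge (wp n) (wr n) = wedge (mapp (madj (W n)) (wp n)) (mapp (madj (W n)) (wr n))"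
      by (simp only: wedge_mapp gdet_madj)
    also have "\<dots> = \<sigma>1 n * \<sigma>3 n * m2 n" by (simp only: elim) (simp add: m2_def)
    finally have "gdet (W n) * wedge (wp n) (wr n) = \<sigma>1 n * \<sigma>3 n * m2 n" .
    then have e2: "wedge (wp n) (wr n) = \<sigma>1 n * \<sigma>3 n * m2 n / gdet (W n)" using W[of n] by (simp add: field_simps)
    show ?case
      unfolding P_def Q_def mapp_cmul elim e1 e2 by (simp add: cmul_def \<kappa>_def)
  qed
  have adj1: "ev (\<lambda>n. mapp (madj (W n)) (P n) = cmul (\<kappa> n) (m1 n * a1 n, m1 n * b1 n))"
    and adj2: "ev (\<lambda>n. mapp (madj (W n)) (Q n) = cmul (\<kappa> n) (m2 n * a2 n, m2 n * b2 n))"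
    by (rule eventually_mono[OF adj], erule conjunct1) (rule eventually_mono[OF adj], erule conjunct2)
  obtain E where E: "\<And>i. (\<lambda>n. coeff (fst (E n)) i) \<in> L" "\<And>i. (\<lambda>n. coeff (snd (E n)) i) \<in> L"
    "ev (\<lambda>n. \<forall>i\<le>K.
      coeff (fst (conj K (madj (cols (P n) (Q n))) (T n))) i = s n * \<kappa> n * (\<kappa> n ^ i * \<kappa> n ^ (K - i)) * coeff (fst (E n)) i \<and>
      coeff (snd (conj K (madj (cols (P n) (Q n))) (T n))) i = s n * \<kappa> n * (\<kappa> n ^ i * \<kappa> n ^ (K - i)) * coeff (snd (E n)) i)"
    using base_change[OF L_mult[OF mL(1) p(3)] L_mult[OF mL(1) p(4)] L_mult[OF mL(2) q(3)] L_mult[OF mL(2) q(4)] adj1 adj2] by blast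
  note rc = reduction_conj[OF hP(1) hQ(1) det]
  define S where "S n = conj K (madj (cols (P n) (Q n))) (T n)" for n
  have HS: "Hform K (\<lambda>n. fst (S n))" "Hform K (\<lambda>n. snd (S n))" using rc(2) by (auto simp: Hform2_def S_def)
  define X where "X b i n = (if b then coeff (fst (S n)) i else coeff (snd (S n)) i)" for b i n
  define e where "e b i n = (if b then coeff (fst (E n)) i else coeff (snd (E n)) i)" for b i n
  have X: "Hd (X b i)" "\<phi> (X b i) = coeff (if b then fst (rp2 K S) else snd (rp2 K S)) i" for b i
    using Hform_coeff[OF HS(1), of i] Hform_coeff[OF HS(2), of i] Hform_rp_coeff[OF HS(1), of i]
      Hform_rp_coeff[OF HS(2), of i] by (cases b; simp add: X_def[abs_def] rp2_def)+
  have eL: "e b i \<in> L" for b i using E(1,2) by (cases b) (simp_all add: e_def[abs_def])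
  have Xe: "ev (\<lambda>n. X b i n = (s n * \<kappa> n * \<kappa> n ^ K) * e b i n)" if "i \<le> K" for b i
    using E(3)
  proof eventually_elim
    case (elim n)
    have "\<kappa> n ^ i * \<kappa> n ^ (K - i) = \<kappa> n ^ K" using that by (simp flip: power_add)
    then show ?case using elim that by (simp add: X_def e_def S_def)
  qed
  obtain b0 i0 where b0: "\<phi> (X b0 i0) \<noteq> 0" "i0 \<le> K"
  proof -
    obtain c where c: "c \<noteq> 0" "rp2 K S = (c * fst (rp2 k (\<lambda>n. conj k (madj (cols (P n) (Q n))) (A n, B n))),
        c * snd (rp2 k (\<lambda>n. conj k (madj (cols (P n) (Q n))) (A n, B n))))"
      using rc(5) by (auto simp: S_def[abs_def])
    have "fst (rp2 K S) \<noteq> 0 \<or> snd (rp2 K S) \<noteq> 0"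
    proof (rule ccontr)
      assume "\<not> ?thesis"
      then have "hev2 k (rp2 k (\<lambda>n. conj k (madj (cols (P n) (Q n))) (A n, B n))) (1, 0) = (0, 0)"
        using c by (simp add: hev2_def)
      moreover have "(1, 0) \<noteq> (0 :: 'h, 0 :: 'h)" by simp
      ultimately show False using nondegD(3)[OF rc(3), of "(1, 0)"] by blast
    qed
    then obtain b where "(if b then fst (rp2 K S) else snd (rp2 K S)) \<noteq> 0" by (metis (full_types))
    then obtain i where i: "coeff (if b then fst (rp2 K S) else snd (rp2 K S)) i \<noteq> 0"
      by (metis coeff_0 poly_eqI)
    have "i \<le> K"
    proof (cases b)
      case True
      then show ?thesis using i le_degree[of "fst (rp2 K S)" i] degree_rp2(1)[of K S] by simp
    next
      case False
      then show ?thesis using i le_degree[of "snd (rp2 K S)" i] degree_rp2(2)[of K S] by simp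
    qed
    moreover have "\<phi> (X b i) \<noteq> 0" unfolding X(2) by (rule i)
    ultimately show ?thesis using that by blast
  qed
  \<comment> \<open>With equal scalars the monomial factor no longer depends on the index, so
    \<open>kk_ratio\<close> applies to any two coefficients.\<close>
  have ratio: "\<phi> (X b i) / \<phi> (X b0 i0) \<in> kk" for b i
  proof (cases "i \<le> K")
    case True
    show ?thesis by (rule kk_ratio[OF X(1) X(1) b0(1) eL eL Xe[OF b0(2)] Xe[OF True]])
  next
    case False
    have "coeff (fst (rp2 K S)) i = 0"
      by (rule coeff_eq_0) (use degree_rp2(1)[of K S] False in linarith)
    moreover have "coeff (snd (rp2 K S)) i = 0"
      by (rule coeff_eq_0) (use degree_rp2(2)[of K S] False in linarith)
    ultimately have "\<phi> (X b i) = 0" unfolding X(2) by (cases b) simp_all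
    then show ?thesis using kk_subfield by (simp add: subfield_set_def)
  qed
  define \<sigma> where "\<sigma> = \<phi> (X b0 i0)"
  have \<sigma>: "\<sigma> \<noteq> 0" using b0 by (simp add: \<sigma>_def)
  show ?thesis
  proof (rule pot_good_reduction_of_kk[OF hP(1) hQ(1) det _ _ \<sigma>])
    show "smult (inverse \<sigma>) (fst (rp2 K S)) \<in> polys_over kk" "smult (inverse \<sigma>) (snd (rp2 K S)) \<in> polys_over kk"
      using ratio[of True] ratio[of False] unfolding X(2) polys_over_def
      by (simp_all add: \<sigma>_def X(2)[of b0 i0, symmetric] divide_inverse mult.commute)
    show "rp2 K (\<lambda>n. conj K (madj (cols (P n) (Q n))) (T n)) =
      (smult \<sigma> (smult (inverse \<sigma>) (fst (rp2 K S))), smult \<sigma> (smult (inverse \<sigma>) (snd (rp2 K S))))"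
      using \<sigma> by (simp add: S_def[abs_def])
  qed
qed

lemma pot_good_reduction_degree_ge_2:
  assumes k2: "2 \<le> k"
  shows "pot_good_reduction F \<eta> k A B"
proof -
  note ff = fixform_nonzero[OF nd k2]
  obtain p q r where pqr: "indep3 p q r"
    "wedge p (hev2 k g p) = 0 \<and> wedge q (hev2 k g q) = 0 \<and> wedge r (hev2 k g r) = 0 \<or>
      wedge p (hev2 k g p) = 0 \<and> wedge (hev2 k g q) p = 0 \<and> wedge (hev2 k g r) q = 0"
    using three_points[OF nd k2] by blast
  have nz: "p \<noteq> (0, 0)" "q \<noteq> (0, 0)" using pqr(1) by (auto simp: indep3_def wedge_def)
  have "Lam p" "Lam q" "Lam r"
    using pqr(2) Lam_fixed[OF ff] Lam_preimage nz by blast+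
  then show ?thesis by (rule pot_good_reduction_three[OF pqr(1)])
qed

text \<open>In the basis \<open>p\<close>, \<open>q\<close> the limit is \<alpha> times the
  triangular matrix with diagonal 1, \<epsilon> and corner \<delta>, all of them in
  \<open>kk\<close>.\<close>

lemma good_reduction_triangular:
  assumes k1: "k = 1" and p: "vHd p" "vHd q" and det: "wedge (phiv p) (phiv q) \<noteq> 0" and \<alpha>: "\<alpha> \<noteq> 0" "\<epsilon> \<noteq> 0"
    and kk: "\<delta> \<in> kk" "\<epsilon> \<in> kk"
    and gp: "hev2 1 g (phiv p) = cmul \<alpha> (phiv p)"
    and gq: "hev2 1 g (phiv q) = (\<alpha> * (\<delta> * fst (phiv p) + \<epsilon> * fst (phiv q)), \<alpha> * (\<delta> * snd (phiv p) + \<epsilon> * snd (phiv q)))"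
  shows "pot_good_reduction F \<eta> k A B"
proof -
  note r = reduction_conj[OF p det]
  let ?A = "rp2 k (\<lambda>n. conj k (madj (cols (p n) (q n))) (A n, B n))"
  define D where "D = wedge (phiv p) (phiv q)"
  have ev: "hev2 1 ?A v = (D * \<alpha> * (fst v + \<delta> * snd v), D * \<alpha> * (\<epsilon> * snd v))" for v
  proof -
    have "hev2 1 ?A v = mapp (madj (cols (phiv p) (phiv q))) (hev2 1 g (mapp (cols (phiv p) (phiv q)) v))"
      using r(4) k1 by simp
    also have "hev2 1 g (mapp (cols (phiv p) (phiv q)) v) =
        mapp (cols (phiv p) (phiv q)) (\<alpha> * (fst v + \<delta> * snd v), \<alpha> * (\<epsilon> * snd v))"
      unfolding mapp_cols hev2_linear gp gq by (simp add: cmul_def algebra_simps)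
    also have "mapp (madj (cols (phiv p) (phiv q))) \<dots> = cmul D (\<alpha> * (fst v + \<delta> * snd v), \<alpha> * (\<epsilon> * snd v))"
      by (simp only: madj_mapp mapp_cols(3) D_def)
    finally show ?thesis by (simp add: cmul_def mult.assoc)
  qed
  have d1: "degree (fst ?A) \<le> 1" "degree (snd ?A) \<le> 1" using degree_rp2[of k] k1 by auto
  have "fst ?A = smult (D * \<alpha>) [:\<delta>, 1:]"
    by (rule form_eqI_H[OF d1(1)]) (use ev in \<open>simp_all add: hev2_def hev_def algebra_simps\<close>)
  moreover have "snd ?A = smult (D * \<alpha>) [:\<epsilon>:]"
    by (rule form_eqI_H[OF d1(2)]) (use ev in \<open>simp_all add: hev2_def hev_def algebra_simps\<close>)
  ultimately have eq: "?A = (smult (D * \<alpha>) [:\<delta>, 1:], smult (D * \<alpha>) [:\<epsilon>:])" by (simp add: prod_eq_iff)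
  have kk01: "0 \<in> kk" "1 \<in> kk" using kk_subfield by (auto simp: subfield_set_def)
  have cP: "[:\<delta>, 1:] \<in> polys_over kk" "[:\<epsilon>:] \<in> polys_over kk"
    unfolding polys_over_def using kk kk01 by (auto simp: coeff_pCons split: nat.split)
  \<comment> \<open>The denominator is a non-zero constant, which makes the Bezout relation
    immediate.\<close>
  have bz: "0 * [:\<delta>, 1:] + [:inverse \<epsilon>:] * [:\<epsilon>:] = 1" using \<alpha> by (simp add: one_pCons)
  have "good_reduction F \<eta> k (\<lambda>n. conj k (madj (cols (p n) (q n))) (A n, B n))"
    by (rule good_reductionI[OF r(1) k(1) r(3) _ cP bz eq]) (use det \<alpha> in \<open>simp add: D_def\<close>)
  then show ?thesis by (rule pot_good_reductionI[OF p det])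
qed

text \<open>If the two eigenvalues agree, scaling the eigenvector gives a Jordan form with entries 0
  and 1. If they differ, both eigenvectors come from points over L, and the ratio of the eigenvalues
  has to be shown to lie in \<open>kk\<close>.\<close>

lemma pot_good_reduction_degree_1:
  assumes k1: "k = 1"
  shows "pot_good_reduction F \<eta> k A B"
proof -
  have nd1: "nondeg 1 g" using nd k1 by simp
  have d: "degree (fst g) \<le> 1" "degree (snd g) \<le> 1" using nondegD(1,2)[OF nd1] .
  have kk01: "0 \<in> kk" "1 \<in> kk" using kk_subfield by (auto simp: subfield_set_def)
  obtain p where p: "p \<noteq> (0, 0)" "hev (Suc 1) (fixform g) p = 0"
    using form_has_zero[OF _ degree_fixform[OF d]] by (metis One_nat_def le_SucI order_refl)
  then have "wedge p (hev2 1 g p) = 0" by (simp only: hev_fixform[OF d(1)])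
  then obtain \<alpha> where \<alpha>: "hev2 1 g p = cmul \<alpha> p" using wedge_zero_imp_cmul p(1) by blast
  have \<alpha>0: "\<alpha> \<noteq> 0" using nondegD(3)[OF nd1 p(1)] \<alpha> by (auto simp: cmul_def)
  obtain q where q: "wedge p q \<noteq> 0"
  proof (cases "fst p = 0")
    case True
    then show ?thesis using that[of "(1, 0)"] p(1) by (cases p) (auto simp: wedge_def)
  next
    case False
    then show ?thesis using that[of "(0, 1)"] by (simp add: wedge_def)
  qed
  have decomp: "\<exists>\<beta> \<gamma>. z = (\<beta> * fst p + \<gamma> * fst q, \<beta> * snd p + \<gamma> * snd q)" for z
  proof -
    define \<beta> \<gamma> where "\<beta> = wedge z q / wedge p q" and "\<gamma> = wedge p z / wedge p q"
    have "z = (\<beta> * fst p + \<gamma> * fst q, \<beta> * snd p + \<gamma> * snd q)"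
      using q unfolding \<beta>_def \<gamma>_def by (cases z) (simp add: field_simps, simp add: wedge_def algebra_simps)
    then show ?thesis by blast
  qed
  obtain \<beta> \<gamma> where bg: "hev2 1 g q = (\<beta> * fst p + \<gamma> * fst q, \<beta> * snd p + \<gamma> * snd q)"
    using decomp by blast
  show ?thesis
  proof (cases "\<alpha> = \<gamma>")
    case True
    \<comment> \<open>Rescaled so that the off-diagonal entry becomes 1 unless it is 0.\<close>
    define p2 where "p2 = (if \<beta> = 0 then p else cmul (\<beta> / \<alpha>) p)"
    define \<delta> where "\<delta> = (if \<beta> = 0 then 0 else 1 :: 'h)"
    have p2q: "wedge p2 q \<noteq> 0" using q \<alpha>0 by (simp add: p2_def)
    have "hev2 1 g (cmul c p) = cmul \<alpha> (cmul c p)" for c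
      unfolding hev2_cmul \<alpha> by (simp add: cmul_def)
    then have g2: "hev2 1 g p2 = cmul \<alpha> p2" using \<alpha> by (simp add: p2_def del: One_nat_def)
    have gq: "hev2 1 g q = (\<alpha> * (\<delta> * fst p2 + 1 * fst q), \<alpha> * (\<delta> * snd p2 + 1 * snd q))"
      using \<alpha>0 unfolding bg by (simp add: p2_def \<delta>_def cmul_def True algebra_simps)
    obtain P where P: "vHd P" "phiv P = p2" by (rule lift_vec)
    obtain Q where Q: "vHd Q" "phiv Q = q" by (rule lift_vec)
    show ?thesis
      by (rule good_reduction_triangular[OF k1 P(1) Q(1) _ \<alpha>0, of 1 \<delta>])
         (use p2q g2 gq P Q kk01 in \<open>auto simp: \<delta>_def\<close>)
  next
    case False
    \<comment> \<open>The eigenvector of the second eigenvalue \<gamma>.\<close>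
    define q' where "q' = (\<beta> * fst p + (\<gamma> - \<alpha>) * fst q, \<beta> * snd p + (\<gamma> - \<alpha>) * snd q)"
    have pq': "wedge p q' = (\<gamma> - \<alpha>) * wedge p q" by (simp add: q'_def wedge_def algebra_simps)
    then have pq'0: "wedge p q' \<noteq> 0" using q False by simp
    have q'0: "q' \<noteq> (0, 0)" using pq'0 by (auto simp: wedge_def)
    have gq': "hev2 1 g q' = cmul \<gamma> q'"
      unfolding q'_def hev2_linear \<alpha> bg by (simp add: cmul_def algebra_simps)
    have \<gamma>0: "\<gamma> \<noteq> 0" using nondegD(3)[OF nd1 q'0] gq' by (auto simp: cmul_def)
    have ff: "fixform g \<noteq> 0"
    proof
      assume "fixform g = 0"
      then have *: "wedge v (hev2 1 g v) = 0" for v using hev_fixform[OF d(1), of v] by simp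
      \<comment> \<open>If all points were fixed, the sum of two eigenvectors would be one as well,
        against \<alpha> \<noteq> \<gamma>.\<close>
      have "wedge (1 * fst p + 1 * fst q', 1 * snd p + 1 * snd q')
         (1 * fst (hev2 1 g p) + 1 * fst (hev2 1 g q'), 1 * snd (hev2 1 g p) + 1 * snd (hev2 1 g q')) = 0"
        using *[of "(1 * fst p + 1 * fst q', 1 * snd p + 1 * snd q')"] unfolding hev2_linear .
      then have "(\<gamma> - \<alpha>) * wedge p q' = 0" unfolding \<alpha> gq' by (simp add: wedge_def cmul_def algebra_simps)
      then show False using pq'0 False by simp
    qed
    have "Lam p" "Lam q'"
      using Lam_fixed[OF ff] \<alpha> gq' k1 by simp_all
    obtain wp a1 b1 \<sigma> where P: "normalized wp" "wedge p (phiv wp) = 0" "a1 \<in> L" "b1 \<in> L"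
      "ev (\<lambda>n. mapp (madj (W n)) (wp n) = cmul (\<sigma> n) (a1 n, b1 n))" using Lam_lift[OF \<open>Lam p\<close>] .
    obtain wq a2 b2 \<tau> where Q: "normalized wq" "wedge q' (phiv wq) = 0" "a2 \<in> L" "b2 \<in> L"
      "ev (\<lambda>n. mapp (madj (W n)) (wq n) = cmul (\<tau> n) (a2 n, b2 n))" using Lam_lift[OF \<open>Lam q'\<close>] .
    note vH = normalized_vHd[OF P(1)] normalized_vHd[OF Q(1)]
    note nz = normalized_phiv[OF P(1)] normalized_phiv[OF Q(1)]
    have det: "wedge (phiv wp) (phiv wq) \<noteq> 0"
      by (rule wedge_nonzero_transfer[OF pq'0 P(2) Q(2) nz])
    have gP: "hev2 1 g (phiv wp) = cmul \<alpha> (phiv wp)"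
    proof -
      obtain c where c: "phiv wp = cmul c p" using wedge_zero_imp_cmul[OF P(2) p(1)] .
      show ?thesis unfolding c hev2_cmul \<alpha> by (simp add: cmul_def)
    qed
    have gQ: "hev2 1 g (phiv wq) = cmul \<gamma> (phiv wq)"
    proof -
      obtain c where c: "phiv wq = cmul c q'" using wedge_zero_imp_cmul[OF Q(2) q'0] .
      show ?thesis unfolding c hev2_cmul gq' by (simp add: cmul_def)
    qed
    note rc = reduction_conj[OF vH det]
    obtain E where E: "\<And>i. (\<lambda>n. coeff (fst (E n)) i) \<in> L" "\<And>i. (\<lambda>n. coeff (snd (E n)) i) \<in> L"
      "ev (\<lambda>n. \<forall>i\<le>K.
        coeff (fst (conj K (madj (cols (wp n) (wq n))) (T n))) i = s n * \<tau> n * (\<sigma> n ^ i * \<tau> n ^ (K - i)) * coeff (fst (E n)) i \<and>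
        coeff (snd (conj K (madj (cols (wp n) (wq n))) (T n))) i = s n * \<sigma> n * (\<sigma> n ^ i * \<tau> n ^ (K - i)) * coeff (snd (E n)) i)"
      using base_change[OF P(3,4) Q(3,4) P(5) Q(5)] by blast
    define D where "D = wedge (phiv wp) (phiv wq)"
    let ?A = "rp2 k (\<lambda>n. conj k (madj (cols (wp n) (wq n))) (A n, B n))"
    define S where "S n = conj K (madj (cols (wp n) (wq n))) (T n)" for n
    have HS: "Hform K (\<lambda>n. fst (S n))" "Hform K (\<lambda>n. snd (S n))" using rc(2) by (auto simp: Hform2_def S_def)
    have evA: "hev2 1 ?A v = (D * \<alpha> * fst v, D * \<gamma> * snd v)" for v
    proof -
      have "hev2 1 ?A v = mapp (madj (cols (phiv wp) (phiv wq))) (hev2 1 g (mapp (cols (phiv wp) (phiv wq)) v))"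
        using rc(4) k1 by simp
      also have "hev2 1 g (mapp (cols (phiv wp) (phiv wq)) v) = mapp (cols (phiv wp) (phiv wq)) (\<alpha> * fst v, \<gamma> * snd v)"
        unfolding mapp_cols hev2_linear gP gQ by (simp add: cmul_def algebra_simps)
      also have "mapp (madj (cols (phiv wp) (phiv wq))) \<dots> = cmul D (\<alpha> * fst v, \<gamma> * snd v)"
        by (simp only: madj_mapp mapp_cols(3) D_def)
      finally show ?thesis by (simp add: cmul_def mult.assoc)
    qed
    have d1: "degree (fst ?A) \<le> 1" "degree (snd ?A) \<le> 1" using degree_rp2[of k] k1 by auto
    have fA: "fst ?A = smult (D * \<alpha>) [:0, 1:]"
      by (rule form_eqI_H[OF d1(1)]) (use evA in \<open>simp_all add: hev2_def hev_def algebra_simps\<close>)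
    have sA: "snd ?A = smult (D * \<gamma>) [:1:]"
      by (rule form_eqI_H[OF d1(2)]) (use evA in \<open>simp_all add: hev2_def hev_def algebra_simps\<close>)
    obtain c where c: "c \<noteq> 0" "rp2 K S = (c * fst ?A, c * snd ?A)"
      using rc(5) by (auto simp: S_def[abs_def])
    then obtain i where i: "coeff c i \<noteq> 0" by (metis coeff_0 poly_eqI)
    have D0: "D \<noteq> 0" using det by (simp add: D_def)
    have cf: "coeff (fst (rp2 K S)) (Suc i) = D * \<alpha> * coeff c i" "coeff (snd (rp2 K S)) i = D * \<gamma> * coeff c i"
      unfolding c(2) fA sA by simp_all
    then have "Suc i \<le> K"
      using i D0 \<alpha>0 degree_rp2(1)[of K S] le_degree[of "fst (rp2 K S)" "Suc i"] by simp
    \<comment> \<open>The numerator is a multiple of X and the denominator of Y, so coefficient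
      \<open>i\<close> of the common factor shows up at index \<open>Suc i\<close> above and
      \<open>i\<close> below. These two positions carry the same monomial
      \<open>\<sigma> ^ Suc i * \<tau> ^ (K - i)\<close>, which cancels and leaves \<gamma> /
      \<alpha>.\<close>
    define x where "x n = coeff (fst (S n)) (Suc i)" for n
    define y where "y n = coeff (snd (S n)) i" for n
    have x: "Hd x" "\<phi> x = D * \<alpha> * coeff c i" and y: "Hd y" "\<phi> y = D * \<gamma> * coeff c i"
      unfolding x_def[abs_def] y_def[abs_def]
      using Hform_coeff[OF HS(1)] Hform_coeff[OF HS(2)] Hform_rp_coeff[OF HS(1)] Hform_rp_coeff[OF HS(2)] cf
      by (simp_all add: rp2_def)
    have Ki: "K - i = Suc (K - Suc i)" using \<open>Suc i \<le> K\<close> by simp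
    have xy: "ev (\<lambda>n. x n = (s n * \<sigma> n ^ Suc i * \<tau> n ^ (K - i)) * coeff (fst (E n)) (Suc i) \<and>
       y n = (s n * \<sigma> n ^ Suc i * \<tau> n ^ (K - i)) * coeff (snd (E n)) i)"
      using E(3)
    proof eventually_elim
      case (elim n)
      show ?case
        using elim[rule_format, of "Suc i"] elim[rule_format, of i] \<open>Suc i \<le> K\<close>
        by (simp add: x_def y_def S_def Ki)
    qed
    have "\<phi> y / \<phi> x \<in> kk"
      by (rule kk_ratio[OF x(1) y(1) _ E(1)[of "Suc i"] E(2)[of i], where t = "\<lambda>n. s n * \<sigma> n ^ Suc i * \<tau> n ^ (K - i)"])
         (use x(2) D0 \<alpha>0 i xy in \<open>auto elim: eventually_mono\<close>)
    then have "\<gamma> / \<alpha> \<in> kk" using x(2) y(2) D0 i by simp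
    then show ?thesis
      by (intro good_reduction_triangular[OF k1 vH det \<alpha>0, of "\<gamma> / \<alpha>" 0])
         (use \<gamma>0 \<alpha>0 kk01 gP gQ in \<open>auto simp: cmul_def\<close>)
  qed
qed

theorem pot_good: "pot_good_reduction F \<eta> k A B"
proof (cases "k = 1")
  case True
  then show ?thesis by (rule pot_good_reduction_degree_1)
next
  case False
  then show ?thesis using k by (intro pot_good_reduction_degree_ge_2) simp
qed

end

section \<open>Adapted rescalings at an arbitrary place\<close>

lemma normalize_pair_coeff_le:
  "cmod (coeff (fst (normalize_pair K g)) i) \<le> 1" "cmod (coeff (snd (normalize_pair K g)) i) \<le> 1"
  if "degree (fst g) \<le> K" "degree (snd g) \<le> K"
proof -
  let ?S = "(\<lambda>i. cmod (coeff (fst g) i)) ` {..K} \<union> (\<lambda>i. cmod (coeff (snd g) i)) ` {..K}"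
  have le: "x \<le> maxcoef K g" if "x \<in> ?S" for x
    unfolding maxcoef_def using that by (intro Max_ge) auto
  have m0: "0 \<le> maxcoef K g" 
  proof -
    have "cmod (coeff (fst g) 0) \<in> ?S" by auto
    from le[OF this] show ?thesis using norm_ge_zero[of "coeff (fst g) 0"] by linarith
  qed
  have "cmod (coeff (fst g) i) \<le> maxcoef K g \<and> cmod (coeff (snd g) i) \<le> maxcoef K g"
  proof (cases "i \<le> K")
    case True
    then show ?thesis using le by auto
  next
    case False
    then have "coeff (fst g) i = 0" "coeff (snd g) i = 0" using that by (auto intro!: coeff_eq_0)
    then show ?thesis using m0 by auto
  qed
  then show "cmod (coeff (fst (normalize_pair K g)) i) \<le> 1" "cmod (coeff (snd (normalize_pair K g)) i) \<le> 1"
    using m0 by (auto simp: normalize_pair_def norm_mult norm_divide divide_le_eq_1)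
qed

text \<open>An adapted rescaling supplies all the data of \<open>rescaling_limit\<close>, whose
  conclusion contradicts (A2). The common factor and the coprime pair are those of the limit, and
  the scalars are chosen n by n.\<close>

lemma (in place) never_adapted_place: "never_adapted F \<eta>"
  unfolding never_adapted_def
proof (intro impI allI notI)
  fix L K h M W G
  assume *: "acl_field F L \<and> trivially_valued F \<eta> L \<and> (\<forall>n. mob_det (W n) \<noteq> 0) \<and>
        (\<forall>n. degree (fst (G n)) \<le> K \<and> degree (snd (G n)) \<le> K) \<and>
        (\<forall>i. (\<lambda>n. coeff (fst (G n)) i) \<in> L \<and> (\<lambda>n. coeff (snd (G n)) i) \<in> L) \<and>
        (\<forall>n. degree (fst (h n)) \<le> K \<and> degree (snd (h n)) \<le> K) \<and>
        ev (\<lambda>n. \<exists>s. s \<noteq> 0 \<and> (\<forall>v. hev2 K (conj K (M n) (h n)) v =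
            cmul s (mapp (W n) (hev2 K (G n) (mapp (madj (W n)) v)))))"
    and ad: "adapted F K h M \<eta>"
  define gg where "gg n = conj K (M n) (h n)" for n
  define T where "T n = normalize_pair K (gg n)" for n
  have "scale_less F \<eta> one_scale" using scale_less_one[OF ultra] small by blast
  with ad obtain k A B where lr: "lim_rep F \<eta> K gg k A B" and k: "1 \<le> k"
    and np: "\<not> pot_good_reduction F \<eta> k A B"
    unfolding adapted_def Let_def gg_def by blast
  obtain C where red: "k \<le> K" "Hform k A" "Hform k B" "Hform (K - k) C" "\<not> fzero Hz (K - k) C"
    "feq Hz K (\<lambda>n. fst (T n)) (\<lambda>n. C n * A n)" "feq Hz K (\<lambda>n. snd (T n)) (\<lambda>n. C n * B n)"
    "fcoprime Hd Hz k A B"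
    using lr unfolding lim_rep_def reduced_pair_def T_def by blast
  have hdeg: "degree (fst (h n)) \<le> K" "degree (snd (h n)) \<le> K" for n using * by auto
  have gdeg: "degree (fst (gg n)) \<le> K" "degree (snd (gg n)) \<le> K" for n
    unfolding gg_def by (rule conj_eval(2,3)[OF hdeg])+
  have tdeg: "degree (fst (T n)) \<le> K" "degree (snd (T n)) \<le> K" for n
    unfolding T_def normalize_pair_def using gdeg[of n] degree_smult_le le_trans by auto
  have HT: "Hform2 K T"
    unfolding Hform2_def
    using tdeg normalize_pair_coeff_le[OF gdeg]
    by (auto intro!: HformI Hd_bounded[of _ 1] simp: T_def)
  note HT' = HT[unfolded Hform2_def, THEN conjunct1] HT[unfolded Hform2_def, THEN conjunct2]
  have kK: "K - k + k = K" using red(1) by simp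
  note m1 = Hform_mult[OF red(4,2), unfolded kK] and m2 = Hform_mult[OF red(4,3), unfolded kK]
  have TC: "rp2 K T = (rp (K - k) C * fst (rp2 k (\<lambda>n. (A n, B n))), rp (K - k) C * snd (rp2 k (\<lambda>n. (A n, B n))))"
    using feq_iff_rp[OF HT'(1) m1(1)] feq_iff_rp[OF HT'(2) m2(1)] red(6,7) m1(2) m2(2) by (simp add: rp2_def)
  have nd: "nondeg k (rp2 k (\<lambda>n. (A n, B n)))"
    using nondeg_of_coprime[OF red(2,3) k red(8)] by (simp add: rp2_def)
  define s0 where "s0 n = (SOME s. \<forall>v. hev2 K (gg n) v = cmul s (mapp (W n) (hev2 K (G n) (mapp (madj (W n)) v))))" for n
  have ex: "ev (\<lambda>n. \<exists>s. \<forall>v. hev2 K (gg n) v = cmul s (mapp (W n) (hev2 K (G n) (mapp (madj (W n)) v))))"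
    using * unfolding gg_def by (blast intro: eventually_mono)
  \<comment> \<open>Normalising the coefficients only changes the scalar.\<close>
  define s where "s n = complex_of_real (1 / maxcoef K (gg n)) * s0 n" for n
  have conjT: "ev (\<lambda>n. \<forall>v. hev2 K (T n) v = cmul (s n) (mapp (W n) (hev2 K (G n) (mapp (madj (W n)) v))))"
    using ex
  proof (rule eventually_mono, intro allI)
    fix n v
    assume "\<exists>s. \<forall>v. hev2 K (gg n) v = cmul s (mapp (W n) (hev2 K (G n) (mapp (madj (W n)) v)))"
    from someI_ex[OF this] have "hev2 K (gg n) v = cmul (s0 n) (mapp (W n) (hev2 K (G n) (mapp (madj (W n)) v)))"
      unfolding s0_def by blast
    moreover have "hev2 K (T n) v = cmul (of_real (1 / maxcoef K (gg n))) (hev2 K (gg n) v)"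
      by (simp add: T_def normalize_pair_def hev2_def hev_smult cmul_def)
    ultimately show "hev2 K (T n) v = cmul (s n) (mapp (W n) (hev2 K (G n) (mapp (madj (W n)) v)))"
      by (simp add: s_def cmul_def mult.assoc)
  qed
  interpret R: rescaling_limit F \<eta> \<phi> L K k T G W s A B C
  proof unfold_locales
    show "rp (K - k) C \<noteq> 0" using fzero_iff_rp[OF red(4)] red(5) by blast
    show "gdet (W n) \<noteq> 0" for n using * by (simp add: gdet_mob)
    show "Hform2 k (\<lambda>n. (A n, B n))" using red by (simp add: Hform2_def)
  qed (use * red k HT TC nd conjT in \<open>blast+\<close>)
  show False using R.pot_good np by blast
qed

text \<open>By its choice, the place underlying \<open>hfield\<close> decides the matter for all
  places. If its scale does not tend to 0 the claim about it is vacuous.\<close>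

theorem never_adapted_all:
  assumes "ultra F" "scale \<eta>"
  shows "never_adapted F \<eta>"
proof -
  have "never_adapted cexF cexS"
  proof (cases "(cexS \<longlongrightarrow> 0) cexF")
    case True
    interpret place cexF cexS abs_hfield by unfold_locales (rule True)
    show ?thesis by (rule never_adapted_place)
  next
    case False
    then show ?thesis by (simp add: never_adapted_def)
  qed
  then show ?thesis using never_adapted_cex assms by blast
qed

section \<open>Normal forms\<close>

lemma ratmap_nondeg:
  assumes "ratmap d g" "1 \<le> d"
  shows "nondeg d g"
  unfolding nondeg_def
proof (intro conjI allI impI)
  have md: "max (degree (fst g)) (degree (snd g)) = d" and cop: "coprime (fst g) (snd g)"
    using assms(1) by (auto simp: ratmap_def)
  then show deg: "degree (fst g) \<le> d" "degree (snd g) \<le> d" by auto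
  fix v :: "complex \<times> complex" assume v: "v \<noteq> (0, 0)"
  show "hev2 d g v \<noteq> (0, 0)"
  proof
    assume "hev2 d g v = (0, 0)"
    then have z: "hev d (fst g) v = 0" "hev d (snd g) v = 0" by (auto simp: hev2_def)
    show False
    proof (cases "snd v = 0")
      case True
      then have "fst v \<noteq> 0" using v by (cases v) auto
      then have c: "coeff (fst g) d = 0" "coeff (snd g) d = 0" using z True by (auto simp: hev_infinity)
      from md have "degree (fst g) = d \<or> degree (snd g) = d" by (auto simp: max_def split: if_splits)
      then show False
      proof
        assume "degree (fst g) = d"
        then show False using c(1) assms(2) by (metis leading_coeff_0_iff degree_0 not_one_le_zero)
      next
        assume "degree (snd g) = d"
        then show False using c(2) assms(2) by (metis leading_coeff_0_iff degree_0 not_one_le_zero)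
      qed
    next
      case False
      let ?x = "fst v / snd v"
      have "poly (fst g) ?x = 0" "poly (snd g) ?x = 0" using z False deg by (simp_all add: hev_poly)
      then have "[:- ?x, 1:] dvd fst g" "[:- ?x, 1:] dvd snd g" by (simp_all add: poly_eq_0_iff_dvd)
      then have "is_unit [:- ?x, 1:]" using cop by (meson coprime_common_divisor)
      then show False by (simp add: is_unit_pCons_iff)
    qed
  qed
qed

text \<open>The value \<open>t = 1\<close> stands for the fixed points \<infinity>, 0, 1, and
  \<open>t = 0\<close> for the chain 1 -> 0 -> \<infinity> with \<infinity> fixed. As a number,
  \<open>t\<close> is the first index of the numerator coefficients later kept as
  parameters.\<close>

definition in_normal_form :: "nat \<Rightarrow> complex poly \<times> complex poly \<Rightarrow> nat \<Rightarrow> bool" where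
  "in_normal_form d g t \<longleftrightarrow> degree (fst g) \<le> d \<and> degree (snd g) \<le> d \<and> coeff (snd g) d = 0 \<and>
     (t = 1 \<and> coeff (fst g) 0 = 0 \<and> (\<Sum>i\<le>d. coeff (fst g) i) = (\<Sum>i\<le>d. coeff (snd g) i) \<or>
      t = 0 \<and> coeff (snd g) 0 = 0 \<and> (\<Sum>i\<le>d. coeff (fst g) i) = 0)"

text \<open>The three points are moved to \<open>\<infinity>\<close>, \<open>0\<close>, \<open>1\<close>. That each is mapped to a prescribed one of
  them is a linear condition on the coefficients.\<close>

lemma normal_form_exists:
  assumes nd: "nondeg d g" and d: "2 \<le> d"
  shows "\<exists>u t. gdet u \<noteq> 0 \<and> in_normal_form d (conj d (madj u) g) t"
proof -
  have deg: "degree (fst g) \<le> d" "degree (snd g) \<le> d" using nondegD(1,2)[OF nd] .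
  obtain p q r where ind: "indep3 p q r"
    and cases: "wedge p (hev2 d g p) = 0 \<and> wedge q (hev2 d g q) = 0 \<and> wedge r (hev2 d g r) = 0 \<or>
      wedge p (hev2 d g p) = 0 \<and> wedge (hev2 d g q) p = 0 \<and> wedge (hev2 d g r) q = 0"
    using three_points[OF nd d] by blast
  have w: "wedge p q \<noteq> 0" "wedge q r \<noteq> 0" "wedge p r \<noteq> 0" using ind by (auto simp: indep3_def)
  \<comment> \<open>Scaled as in \<open>wedge_decompose\<close>: in the basis P, Q the third point R
    has coordinates \<open>(1, 1)\<close>.\<close>
  define P where "P = cmul (wedge r q) p"
  define Q where "Q = cmul (wedge p r) q"
  define R where "R = cmul (wedge p q) r"
  have R: "R = (fst P + fst Q, snd P + snd Q)" unfolding R_def P_def Q_def by (rule wedge_decompose)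
  have rq: "wedge r q \<noteq> 0" using w(2) wedge_swap_zero[of r q] by simp
  have det: "gdet (cols P Q) \<noteq> 0" using w rq by (simp add: mapp_cols P_def Q_def)
  let ?f = "conj d (madj (cols P Q)) g"
  have ev: "hev2 d ?f v = (wedge (hev2 d g (mapp (cols P Q) v)) Q, wedge P (hev2 d g (mapp (cols P Q) v)))" for v
    by (simp add: conj_eval(1)[OF deg] mapp_cols)
  have a: "coeff (snd ?f) d = wedge P (hev2 d g P)"
    using ev[of "(1, 0)"] hev_infinity[of "(1, 0)" d "snd ?f"] by (simp add: hev2_def[of d ?f] mapp_cols)
  have z: "hev d x (0, 1) = coeff x 0" for x :: "complex poly"
    unfolding hev_def by (subst sum.mono_neutral_right[of _ "{0}"]) (auto simp: power_0_left)
  have b: "coeff (fst ?f) 0 = wedge (hev2 d g Q) Q" "coeff (snd ?f) 0 = wedge P (hev2 d g Q)"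
    using ev[of "(0, 1)"] by (simp_all add: hev2_def[of d ?f] mapp_cols z)
  have o: "hev d x (1, 1) = (\<Sum>i\<le>d. coeff x i)" for x :: "complex poly" by (simp add: hev_def)
  have c: "(\<Sum>i\<le>d. coeff (fst ?f) i) = wedge (hev2 d g R) Q" "(\<Sum>i\<le>d. coeff (snd ?f) i) = wedge P (hev2 d g R)"
    using ev[of "(1, 1)"] by (simp_all add: hev2_def[of d ?f] mapp_cols o R)
  have fp: "wedge P (hev2 d g P) = 0" using cases by (auto simp: P_def hev2_cmul)
  note D = conj_eval(2,3)[OF deg, of "madj (cols P Q)"]
  from cases have "\<exists>t. in_normal_form d ?f t"
  proof
    assume *: "wedge p (hev2 d g p) = 0 \<and> wedge q (hev2 d g q) = 0 \<and> wedge r (hev2 d g r) = 0"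
    then have "wedge (hev2 d g q) q = 0" using wedge_swap_zero[of "hev2 d g q" q] by simp
    then have "wedge (hev2 d g Q) Q = 0" by (simp add: Q_def hev2_cmul)
    moreover have "wedge (hev2 d g R) Q = wedge P (hev2 d g R)"
    proof -
      have "wedge R (hev2 d g R) = 0" using * by (simp add: R_def hev2_cmul)
      then have "wedge P (hev2 d g R) + wedge Q (hev2 d g R) = 0"
        by (subst (asm) R) (simp add: wedge_def algebra_simps)
      then show ?thesis using wedge_swap[of "hev2 d g R" Q] by (simp add: add_eq_0_iff)
    qed
    ultimately show ?thesis using D a b c fp by (intro exI[of _ 1]) (simp add: in_normal_form_def)
  next
    assume *: "wedge p (hev2 d g p) = 0 \<and> wedge (hev2 d g q) p = 0 \<and> wedge (hev2 d g r) q = 0"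
    then have "wedge p (hev2 d g q) = 0" using wedge_swap_zero[of p "hev2 d g q"] by simp
    then have "wedge P (hev2 d g Q) = 0" by (simp add: P_def Q_def hev2_cmul)
    moreover have "wedge (hev2 d g R) Q = 0" using * by (simp add: R_def Q_def hev2_cmul)
    ultimately show ?thesis using D a b c fp by (intro exI[of _ 0]) (simp add: in_normal_form_def)
  qed
  then show ?thesis using det by blast
qed

text \<open>The coefficients do not depend on n, so that spanning sequences over the constants
  really counts parameters.\<close>

definition const_span :: "nat filter \<Rightarrow> nat \<Rightarrow> (nat \<Rightarrow> nat \<Rightarrow> complex) \<Rightarrow> (nat \<Rightarrow> complex) \<Rightarrow> bool" where
  "const_span F m S x \<longleftrightarrow> (\<exists>c. eventually (\<lambda>n. x n = (\<Sum>j<m. c j * S j n)) F)"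

lemma const_span_add:
  "const_span F m S x \<Longrightarrow> const_span F m S y \<Longrightarrow> const_span F m S (\<lambda>n. x n + y n)"
proof -
  assume "const_span F m S x" "const_span F m S y"
  then obtain c d where "eventually (\<lambda>n. x n = (\<Sum>j<m. c j * S j n)) F" "eventually (\<lambda>n. y n = (\<Sum>j<m. d j * S j n)) F"
    by (auto simp: const_span_def)
  then have "eventually (\<lambda>n. x n + y n = (\<Sum>j<m. (c j + d j) * S j n)) F"
    by eventually_elim (simp add: sum.distrib algebra_simps)
  then show ?thesis unfolding const_span_def by (rule exI[of _ "\<lambda>j. c j + d j"])
qed

lemma const_span_minus: "const_span F m S x \<Longrightarrow> const_span F m S (\<lambda>n. - x n)"
proof -
  assume "const_span F m S x"
  then obtain c where "eventually (\<lambda>n. x n = (\<Sum>j<m. c j * S j n)) F"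
    by (auto simp: const_span_def)
  then have "eventually (\<lambda>n. - x n = (\<Sum>j<m. (- c j) * S j n)) F"
    by eventually_elim (simp add: sum_negf)
  then show ?thesis unfolding const_span_def by (rule exI[of _ "\<lambda>j. - c j"])
qed

lemma const_span_zero: "eventually (\<lambda>n. x n = 0) F \<Longrightarrow> const_span F m S x"
  unfolding const_span_def by (rule exI[of _ "\<lambda>_. 0"]) simp

lemma const_span_sum:
  "(\<And>i. i \<in> A \<Longrightarrow> const_span F m S (f i)) \<Longrightarrow> const_span F m S (\<lambda>n. \<Sum>i\<in>A. f i n)"
  by (induction A rule: infinite_finite_induct) (auto intro: const_span_add const_span_zero)

lemma const_span_gen: "j < m \<Longrightarrow> const_span F m S (S j)"
  unfolding const_span_def
  by (rule exI[of _ "\<lambda>i. if i = j then 1 else 0"])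
     (simp add: if_distrib[of "\<lambda>x. x * _"] sum.delta cong: if_cong)

lemma const_span_cong: "const_span F m S x \<Longrightarrow> eventually (\<lambda>n. x n = y n) F \<Longrightarrow> const_span F m S y"
proof -
  assume "const_span F m S x" and eq: "eventually (\<lambda>n. x n = y n) F"
  then obtain c where "eventually (\<lambda>n. x n = (\<Sum>j<m. c j * S j n)) F" by (auto simp: const_span_def)
  with eq have "eventually (\<lambda>n. y n = (\<Sum>j<m. c j * S j n)) F" by eventually_elim simp
  then show ?thesis unfolding const_span_def by (rule exI[of _ c])
qed

text \<open>Of the 2d + 2 coefficients two vanish, and the condition at the point 1 expresses one
  more through the others; d of the numerator and d - 1 of the denominator remain.\<close>

lemma normal_form_span:
  fixes h :: "nat \<Rightarrow> complex poly \<times> complex poly"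
  assumes u: "ultra F" and d: "2 \<le> d" and nf: "\<And>n. \<exists>t. in_normal_form d (h n) t"
  obtains S where "\<And>i. const_span F (2 * d - 1) S (\<lambda>n. coeff (fst (h n)) i)"
    "\<And>i. const_span F (2 * d - 1) S (\<lambda>n. coeff (snd (h n)) i)"
proof -
  have "in_normal_form d g t \<Longrightarrow> t = 0 \<or> t = 1" for g t by (auto simp: in_normal_form_def)
  \<comment> \<open>The type of the normal form may vary with n; the ultrafilter selects
    one.\<close>
  then have "eventually (\<lambda>n. \<exists>t\<in>{0, 1}. in_normal_form d (h n) t) F"
    using nf by (intro always_eventually allI) blast
  then obtain t where t: "t \<in> {0, 1}" "eventually (\<lambda>n. in_normal_form d (h n) t) F"
    using ultra_bex[OF u, of "{0, 1}" "\<lambda>t n. in_normal_form d (h n) t"] by auto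
  define a where "a i n = coeff (fst (h n)) i" for i n
  define b where "b i n = coeff (snd (h n)) i" for i n
  \<comment> \<open>First \<open>a t\<close>, ..., \<open>a (t + d - 1)\<close>, then
    \<open>b 1\<close>, ..., \<open>b (d - 1)\<close>.\<close>
  define S where "S j = (if j < d then a (j + t) else b (j - d + 1))" for j
  let ?c = "const_span F (2 * d - 1) S"
  have ea: "?c (a i)" if "t \<le> i" "i < d + t" for i
  proof -
    have "S (i - t) = a i" using that by (auto simp: S_def)
    moreover have "i - t < 2 * d - 1" using that d by linarith
    ultimately show ?thesis using const_span_gen[of "i - t" "2 * d - 1" F S] by simp
  qed
  have eb: "?c (b i)" if "1 \<le> i" "i < d" for i
  proof -
    have "S (d + i - 1) = b i" using that by (auto simp: S_def)
    moreover have "d + i - 1 < 2 * d - 1" using that by linarith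
    ultimately show ?thesis using const_span_gen[of "d + i - 1" "2 * d - 1" F S] by simp
  qed
  have big: "?c (a i)" "?c (b i)" if "d < i" for i
    using t(2) that
    by (auto intro!: const_span_zero elim!: eventually_mono simp: a_def b_def in_normal_form_def coeff_eq_0)
  have bd: "?c (b d)"
    using t(2) by (auto intro!: const_span_zero elim!: eventually_mono simp: b_def in_normal_form_def)
  have d0: "{..d} = insert 0 {1..d}" by auto
  have dd: "{..d} = insert d {..<d}" by auto
  have "(\<forall>i\<le>d. ?c (a i)) \<and> ?c (b 0)"
  proof (cases "t = 1")
    case True
    have a0: "?c (a 0)"
      using t(2) True by (auto intro!: const_span_zero elim!: eventually_mono simp: a_def in_normal_form_def)
    have ai: "?c (a i)" if "i \<le> d" for i using a0 ea[of i] that True by (cases "i = 0") auto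
    have bi: "?c (b i)" if "1 \<le> i" "i \<le> d" for i using eb[of i] bd that by (cases "i = d") auto
    \<comment> \<open>That 1 is fixed equates the two coefficient sums and determines
      \<open>b 0\<close>.\<close>
    have "?c (\<lambda>n. (\<Sum>i\<in>{..d}. a i n) + - (\<Sum>i\<in>{1..d}. b i n))"
      by (intro const_span_add const_span_minus const_span_sum ai bi) auto
    then have "?c (b 0)"
    proof (rule const_span_cong)
      show "eventually (\<lambda>n. (\<Sum>i\<in>{..d}. a i n) + - (\<Sum>i\<in>{1..d}. b i n) = b 0 n) F"
        using t(2)
      proof eventually_elim
        case (elim n)
        then have "(\<Sum>i\<in>{..d}. a i n) = (\<Sum>i\<in>{..d}. b i n)" using True by (simp add: in_normal_form_def a_def b_def)
        also have "\<dots> = b 0 n + (\<Sum>i\<in>{1..d}. b i n)" unfolding d0 by (subst sum.insert) auto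
        finally show ?case by simp
      qed
    qed
    then show ?thesis using ai by blast
  next
    case False
    then have t0: "t = 0" using t(1) by simp
    have b0: "?c (b 0)"
      using t(2) t0 by (auto intro!: const_span_zero elim!: eventually_mono simp: b_def in_normal_form_def)
    have ai: "?c (a i)" if "i < d" for i using ea[of i] that t0 by simp
    \<comment> \<open>That 1 is sent to 0 makes the numerator sum vanish and determines
      \<open>a d\<close>.\<close>
    have "?c (\<lambda>n. - (\<Sum>i\<in>{..<d}. a i n))"
      by (intro const_span_minus const_span_sum ai) auto
    then have "?c (a d)"
    proof (rule const_span_cong)
      show "eventually (\<lambda>n. - (\<Sum>i\<in>{..<d}. a i n) = a d n) F"
        using t(2)
      proof eventually_elim
        case (elim n)
        then have "(\<Sum>i\<in>{..d}. a i n) = 0" using t0 by (simp add: in_normal_form_def a_def)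
        then have "a d n + (\<Sum>i\<in>{..<d}. a i n) = 0" unfolding dd by (subst (asm) sum.insert) auto
        then show ?case by (rule eq_neg_iff_add_eq_0[THEN iffD2, symmetric])
      qed
    qed
    show ?thesis
    proof (intro conjI allI impI)
      fix i assume "i \<le> d"
      then consider "i < d" | "i = d" by linarith
      then show "?c (a i)"
      proof cases
        case 1
        then show ?thesis by (rule ai)
      next
        case 2
        show ?thesis unfolding 2 using \<open>?c (a d)\<close> .
      qed
    next
      show "?c (b 0)" by (rule b0)
    qed
  qed
  then have al: "\<And>i. i \<le> d \<Longrightarrow> ?c (a i)" and b0: "?c (b 0)"
    by blast+
  have "?c (a i)" for i
  proof (cases "i \<le> d")
    case True
    then show ?thesis by (rule al)
  next
    case False
    then show ?thesis by (intro big(1)) simp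
  qed
  moreover have "?c (b i)" for i
  proof -
    consider "i = 0" | "1 \<le> i" "i < d" | "i = d" | "d < i" by linarith
    then show ?thesis
    proof cases
      case 1
      show ?thesis unfolding 1 by (rule b0)
    next
      case 2
      then show ?thesis by (rule eb)
    next
      case 3
      show ?thesis unfolding 3 by (rule bd)
    next
      case 4
      then show ?thesis by (rule big(2))
    qed
  qed
  ultimately show ?thesis unfolding a_def[abs_def] b_def[abs_def] by (rule that)
qed

section \<open>Iterates and changes of coordinates\<close>

definition mmul :: "mobius \<Rightarrow> mobius \<Rightarrow> mobius" where
  "mmul m n = cols (mapp m (fst n, fst (snd (snd n)))) (mapp m (fst (snd n), snd (snd (snd n))))"

lemma mapp_mmul: "mapp (mmul m n) v = mapp m (mapp n v)"
  and madj_mmul: "mapp (madj (mmul m n)) v = mapp (madj n) (mapp (madj m) v)"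
  and gdet_mmul: "gdet (mmul m n) = gdet m * gdet n"
  by (cases m; cases n; simp add: mmul_def mapp_def cols_def madj_def gdet_def algebra_simps)+

lemma hiter_degree:
  "degree (fst (hiter d g l)) \<le> d ^ l" "degree (snd (hiter d g l)) \<le> d ^ l"
  "hev2 (d ^ Suc l) (hiter d g (Suc l)) v = hev2 d g (hev2 (d ^ l) (hiter d g l) v)"
proof -
  have d: "degree (fst (hiter d g l)) \<le> d ^ l \<and> degree (snd (hiter d g l)) \<le> d ^ l" for l
    by (induction l) (auto simp: hcomp_eval(2,3))
  then show "degree (fst (hiter d g l)) \<le> d ^ l" "degree (snd (hiter d g l)) \<le> d ^ l" by auto
  show "hev2 (d ^ Suc l) (hiter d g (Suc l)) v = hev2 d g (hev2 (d ^ l) (hiter d g l) v)"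
    using hcomp_eval(1)[of "hiter d g l" "d ^ l" d g v] d by simp
qed

lemma hiter_conj:
  assumes g: "\<And>v. hev2 d f (mapp u v) = cmul c (mapp u (hev2 d g v))" and c: "c \<noteq> 0"
  shows "\<exists>s. s \<noteq> 0 \<and> (\<forall>v. hev2 (d ^ l) (hiter d f l) (mapp u v) = cmul s (mapp u (hev2 (d ^ l) (hiter d g l) v)))"
proof (induction l)
  case 0
  have "hev2 1 ([:0, 1:], [:1:]) v = v" for v :: "complex \<times> complex" by (simp add: hev2_def hev_def)
  then show ?case by (intro exI[of _ 1]) (simp add: cmul_def)
next
  case (Suc l)
  then obtain s where s: "s \<noteq> 0"
    "\<And>v. hev2 (d ^ l) (hiter d f l) (mapp u v) = cmul s (mapp u (hev2 (d ^ l) (hiter d g l) v))" by blast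
  have "hev2 (d ^ Suc l) (hiter d f (Suc l)) (mapp u v) =
      cmul (s ^ d * c) (mapp u (hev2 (d ^ Suc l) (hiter d g (Suc l)) v))" for v
    unfolding hiter_degree(3) s(2) hev2_cmul g by (simp add: cmul_def mult.assoc)
  then show ?case using s(1) c by (intro exI[of _ "s ^ d * c"]) simp
qed

lemma cmul_cmul: "cmul a (cmul b v) = cmul (a * b) v"
  by (simp add: cmul_def mult.assoc)

text \<open>Conjugating an iterate of \<open>f\<close> by \<open>m\<close> is conjugating the
  iterate of \<open>g\<close> by the product of \<open>m\<close> and \<open>u\<close>, up to a
  scalar. Thus the coordinates in which the coefficients lie in L serve all rescalings of all
  iterates at once.\<close>

lemma hiter_conj_mobius:
  assumes g: "\<And>v. hev2 d f (mapp u v) = cmul c (mapp u (hev2 d g v))" and c: "c \<noteq> 0" and u: "gdet u \<noteq> 0"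
  shows "\<exists>s. s \<noteq> 0 \<and> (\<forall>v. hev2 (d ^ l) (conj (d ^ l) m (hiter d f l)) v =
     cmul s (mapp (mmul m u) (hev2 (d ^ l) (hiter d g l) (mapp (madj (mmul m u)) v))))"
proof -
  obtain s where s: "s \<noteq> 0"
    "\<And>v. hev2 (d ^ l) (hiter d f l) (mapp u v) = cmul s (mapp u (hev2 (d ^ l) (hiter d g l) v))"
    using hiter_conj[OF g c] by blast
  have "hev2 (d ^ l) (conj (d ^ l) m (hiter d f l)) v =
     cmul ((1 / gdet u) ^ (d ^ l) * s) (mapp (mmul m u) (hev2 (d ^ l) (hiter d g l) (mapp (madj (mmul m u)) v)))" for v
  proof -
    define x where "x = mapp (madj m) v"
    \<comment> \<open>Writes the vector as an image under \<open>u\<close>, so that the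
      semiconjugacy applies.\<close>
    have x: "x = cmul (1 / gdet u) (mapp u (mapp (madj u) x))" using u by (simp add: mapp_madj cmul_def)
    have "hev2 (d ^ l) (conj (d ^ l) m (hiter d f l)) v = mapp m (hev2 (d ^ l) (hiter d f l) x)"
      by (simp add: conj_eval(1)[OF hiter_degree(1,2)] x_def)
    also have "hev2 (d ^ l) (hiter d f l) x =
        cmul ((1 / gdet u) ^ (d ^ l)) (cmul s (mapp u (hev2 (d ^ l) (hiter d g l) (mapp (madj u) x))))"
      by (subst x) (simp only: hev2_cmul s(2))
    finally show ?thesis
      by (simp only: mapp_mmul madj_mmul mapp_cmul cmul_cmul x_def)
  qed
  then show ?thesis using s(1) u by (intro exI[of _ "(1 / gdet u) ^ (d ^ l) * s"]) simp
qed

section \<open>The bound on the number of scales\<close>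

text \<open>The parameters \<open>T\<close> depend on \<open>f\<close> alone and serve every scale,
  iterate and rescaling simultaneously, as the count of scales requires.\<close>

lemma adapted_scales_jump:
  fixes f :: "nat \<Rightarrow> complex poly \<times> complex poly"
  assumes u: "ultra F" and d: "2 \<le> d" and f: "\<And>n. ratmap d (f n)"
  obtains T where "\<And>e l M. scale e \<Longrightarrow> (e \<longlongrightarrow> 0) F \<Longrightarrow> adapted F (d ^ l) (\<lambda>n. hiter d (f n) l) M e \<Longrightarrow>
     \<exists>p\<in>seq_poly.spolys T (2 * d - 2). \<exists>q\<in>seq_poly.spolys T (2 * d - 2). \<exists>r. r \<noteq> 0 \<and> seq_poly.jump F e p q r"
proof -
  have nd: "nondeg d (f n)" for n using ratmap_nondeg[OF f] d by simp
  have fdeg: "degree (fst (f n)) \<le> d" "degree (snd (f n)) \<le> d" for n using nondegD(1,2)[OF nd] .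
  have "\<forall>n. \<exists>v t. gdet v \<noteq> 0 \<and> in_normal_form d (conj d (madj v) (f n)) t"
    using normal_form_exists[OF nd d] by blast
  then obtain U where U: "\<And>n. gdet (U n) \<noteq> 0" "\<And>n. \<exists>t. in_normal_form d (conj d (madj (U n)) (f n)) t"
    by metis
  define h where "h n = conj d (madj (U n)) (f n)" for n
  obtain S where S: "\<And>i. const_span F (2 * d - 1) S (\<lambda>n. coeff (fst (h n)) i)"
    "\<And>i. const_span F (2 * d - 1) S (\<lambda>n. coeff (snd (h n)) i)"
    using normal_form_span[OF u d, of h] U(2) unfolding h_def by blast
  have hdeg: "degree (fst (h n)) \<le> d" "degree (snd (h n)) \<le> d" for n
    unfolding h_def by (rule conj_eval(2,3)[OF fdeg])+
  have hev_h: "hev2 d (h n) v = mapp (madj (U n)) (hev2 d (f n) (mapp (U n) v))" for n v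
    by (simp add: h_def conj_eval(1)[OF fdeg])
  have hnz: "fst (h n) \<noteq> 0 \<or> snd (h n) \<noteq> 0" for n
  proof (rule ccontr)
    assume "\<not> ?thesis"
    then have "hev2 d (h n) (1, 0) = (0, 0)" by (simp add: hev2_def)
    then have "hev2 d (f n) (mapp (U n) (1, 0)) = (0, 0)"
      unfolding hev_h using mapp_eq_0[of "madj (U n)"] U(1) by simp
    moreover have "mapp (U n) (1, 0) \<noteq> (0, 0)" using mapp_eq_0[OF U(1), of n "(1, 0)"] by simp
    ultimately show False using nondegD(3)[OF nd] by blast
  qed
  \<comment> \<open>If all spanning sequences vanished along the filter, so would all coefficients
    of \<open>h n\<close>, which is a non-degenerate map.\<close>
  have "\<exists>j<2 * d - 1. eventually (\<lambda>n. S j n \<noteq> 0) F"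
  proof (rule ccontr)
    assume "\<not> ?thesis"
    then have "eventually (\<lambda>n. S j n = 0) F" if "j < 2 * d - 1" for j
      using that ultra_not[OF u, of "\<lambda>n. S j n \<noteq> 0"] by auto
    then have S0: "eventually (\<lambda>n. \<forall>j\<in>{..<2 * d - 1}. S j n = 0) F" by (intro eventually_ball_finite) auto
    have zero: "eventually (\<lambda>n. x n = 0) F" if xs: "const_span F (2 * d - 1) S x" for x
    proof -
      obtain c where "eventually (\<lambda>n. x n = (\<Sum>j<2 * d - 1. c j * S j n)) F"
        using xs unfolding const_span_def by blast
      with S0 show ?thesis by eventually_elim simp
    qed
    have "eventually (\<lambda>n. \<forall>i\<in>{..d}. coeff (fst (h n)) i = 0 \<and> coeff (snd (h n)) i = 0) F"
      using zero[OF S(1)] zero[OF S(2)] by (intro eventually_ball_finite ballI eventually_conj) auto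
    then have "eventually (\<lambda>n. False) F"
    proof (rule eventually_mono)
      fix n assume *: "\<forall>i\<in>{..d}. coeff (fst (h n)) i = 0 \<and> coeff (snd (h n)) i = 0"
      have "fst (h n) = 0" "snd (h n) = 0"
        using * hdeg[of n] leading_coeff_0_iff[of "fst (h n)"] leading_coeff_0_iff[of "snd (h n)"] by auto
      then show False using hnz by blast
    qed
    then show False using ultra_bot[OF u] by simp
  qed
  then obtain j0 where j0: "j0 < 2 * d - 1" "eventually (\<lambda>n. S j0 n \<noteq> 0) F" by blast
  \<comment> \<open>Affine coordinates: dividing by the non-zero parameter \<open>j0\<close> and
    omitting its index turns 2d - 1 homogeneous parameters into 2d - 2.\<close>
  define T where "T j n = S (if j < j0 then j else Suc j) n / S j0 n" for j n
  define G where "G n = (smult (1 / S j0 n) (fst (h n)), smult (1 / S j0 n) (snd (h n)))" for n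
  interpret Q: seq_poly F T "2 * d - 2" by unfold_locales (rule u)
  interpret A: seq_ring F Q.algebraics
  proof unfold_locales
    show "ultra F" by (rule u)
    show "(\<lambda>_. c) \<in> Q.algebraics" for c by (rule Q.base_algebraic[OF Q.const])
  qed (rule Q.algebraics_add_mult; assumption)+
  have span_alg: "(\<lambda>n. 1 / S j0 n * x n) \<in> Q.algebraics" if x: "const_span F (2 * d - 1) S x" for x
  proof -
    obtain c where c: "eventually (\<lambda>n. x n = (\<Sum>j<2 * d - 1. c j * S j n)) F" 
      using x unfolding const_span_def by blast
    define y where "y j = (if j = j0 then (\<lambda>_. 1) else if j < j0 then T j else T (j - 1))" for j
    have "y j \<in> Q.spolys" if "j < 2 * d - 1" for j
    proof -
      have "T i \<in> Q.spolys" if "i < 2 * d - 2" for i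
        using Q.spoly_var[OF that] unfolding Q.spolys_def by blast
      then show ?thesis using that j0(1) Q.const by (auto simp: y_def)
    qed
    then have "(\<lambda>n. \<Sum>j<2 * d - 1. c j * y j n) \<in> Q.spolys"
      by (intro Q.sum Q.mult Q.const) auto
    then have "(\<lambda>n. \<Sum>j<2 * d - 1. c j * y j n) \<in> Q.algebraics" by (rule Q.base_algebraic)
    then show ?thesis
    proof (rule Q.algebraics_cong)
      show "eventually (\<lambda>n. (\<Sum>j<2 * d - 1. c j * y j n) = 1 / S j0 n * x n) F"
        using c j0(2)
      proof eventually_elim
        case (elim n)
        have "c j * y j n = 1 / S j0 n * (c j * S j n)" for j
          using elim(2) by (auto simp: y_def T_def)
        then show ?case unfolding elim(1) sum_distrib_left by simp
      qed
    qed
  qed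
  have GL: "(\<lambda>n. fst (G n)) \<in> A.rpolys" "(\<lambda>n. snd (G n)) \<in> A.rpolys"
    unfolding A.rpolys_def G_def using span_alg[OF S(1)] span_alg[OF S(2)] by simp_all
  have iterL: "(\<lambda>n. fst (hiter d (G n) l)) \<in> A.rpolys \<and> (\<lambda>n. snd (hiter d (G n) l)) \<in> A.rpolys" for l
  proof (induction l)
    case (Suc l)
    then show ?case using GL by (simp add: hcomp_def A.rpolys_hsubst)
  qed (simp add: A.rpolys_const)
  have Gf: "hev2 d (f n) (mapp (U n) v) = cmul (S j0 n / gdet (U n)) (mapp (U n) (hev2 d (G n) v))"
    if "S j0 n \<noteq> 0" for n v
  proof -
    have "hev2 d (G n) v = cmul (1 / S j0 n) (hev2 d (h n) v)"
      by (simp add: G_def hev2_def hev_smult cmul_def)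
    then have "mapp (U n) (hev2 d (G n) v) = cmul (1 / S j0 n) (cmul (gdet (U n)) (hev2 d (f n) (mapp (U n) v)))"
      by (simp only: mapp_cmul hev_h mapp_madj)
    then show ?thesis using that U(1)[of n] by (simp add: cmul_def)
  qed
  show ?thesis
  proof (rule that[of T])
    fix e l M
    assume e: "scale e" "(e \<longlongrightarrow> 0) F" and ad: "adapted F (d ^ l) (\<lambda>n. hiter d (f n) l) M e"
    \<comment> \<open>The rescaling by \<open>M n\<close> of the iterate of \<open>f n\<close> is,
      up to scalars, the rescaling by \<open>mmul (M n) (U n)\<close> of the iterate of
      \<open>G n\<close>, which is over L; a trivially valued L is excluded by
      \<open>never_adapted_all\<close>.\<close>
    have "\<not> trivially_valued F e Q.algebraics"
    proof
      assume tv: "trivially_valued F e Q.algebraics"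
      have dM: "mob_det (M n) \<noteq> 0" for n using ad unfolding adapted_def by blast
      have W: "\<forall>n. mob_det (mmul (M n) (U n)) \<noteq> 0"
        using dM U(1) gdet_mmul by (simp add: gdet_mob[symmetric])
      have ev: "eventually (\<lambda>n. \<exists>s. s \<noteq> 0 \<and> (\<forall>v. hev2 (d ^ l) (conj (d ^ l) (M n) (hiter d (f n) l)) v =
         cmul s (mapp (mmul (M n) (U n)) (hev2 (d ^ l) (hiter d (G n) l) (mapp (madj (mmul (M n) (U n))) v))))) F"
        using j0(2)
      proof (rule eventually_mono)
        fix n assume s: "S j0 n \<noteq> 0"
        show "\<exists>s. s \<noteq> 0 \<and> (\<forall>v. hev2 (d ^ l) (conj (d ^ l) (M n) (hiter d (f n) l)) v =
         cmul s (mapp (mmul (M n) (U n)) (hev2 (d ^ l) (hiter d (G n) l) (mapp (madj (mmul (M n) (U n))) v))))"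
          by (rule hiter_conj_mobius[OF Gf[OF s] _ U(1)]) (use s U(1)[of n] in simp)
      qed
      have "\<not> adapted F (d ^ l) (\<lambda>n. hiter d (f n) l) M e"
        by (rule never_adapted_all[OF u e(1), unfolded never_adapted_def, rule_format, OF e(2),
              where L = Q.algebraics and W = "\<lambda>n. mmul (M n) (U n)" and G = "\<lambda>n. hiter d (G n) l"])
           (use Q.acl_field_algebraics tv W ev iterL[of l] hiter_degree(1,2) in \<open>simp add: A.rpolys_def\<close>)
      then show False using ad by blast
    qed
    from Q.jump_exists[OF e this] show "\<exists>p\<in>Q.spolys. \<exists>q\<in>Q.spolys. \<exists>r. r \<noteq> 0 \<and> Q.jump e p q r" .
  qed
qed

lemma finite_card_bounded:
  assumes "\<And>X. X \<subseteq> E \<Longrightarrow> finite X \<Longrightarrow> card X \<le> m"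
  shows "finite E \<and> card E \<le> m"
proof -
  have "finite E"
  proof (rule ccontr)
    assume "infinite E"
    then obtain X where "X \<subseteq> E" "finite X" "card X = Suc m" using infinite_arbitrarily_large by blast
    then show False using assms[of X] by simp
  qed
  then show ?thesis using assms by blast
qed

theorem mainTheorem13:
  fixes F :: "nat filter" and d :: nat and f :: "nat \<Rightarrow> complex poly \<times> complex poly"
  assumes "nonprincipal_ultrafilter F"
    and "2 \<le> d"
    and "\<forall>n. ratmap d (f n)"
  shows "(\<forall>E. (\<forall>e\<in>E. scale e \<and> scale_less F e one_scale \<and>
                  (\<exists>l M. 1 \<le> l \<and> adapted F (d ^ l) (\<lambda>n. hiter d (f n) l) M e)) \<and>
              (\<forall>e\<in>E. \<forall>e'\<in>E. e \<noteq> e' \<longrightarrow> \<not> scale_equiv F e e')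
           \<longrightarrow> finite E \<and> card E \<le> 2 * d - 2)
       \<and> (\<forall>E. (\<forall>e\<in>E. scale e \<and>
                  (\<exists>l M. 1 \<le> l \<and> adapted F (d ^ l) (\<lambda>n. hiter d (f n) l) M e)) \<and>
              (\<forall>e\<in>E. \<forall>e'\<in>E. e \<noteq> e' \<longrightarrow> \<not> scale_equiv F e e')
           \<longrightarrow> finite E \<and> card E \<le> 2 * d - 1)"
proof -
  have u: "ultra F" using assms(1) by (simp add: nonprincipal_ultrafilter_def ultra_def)
  obtain T where T: "\<And>e l M. scale e \<Longrightarrow> (e \<longlongrightarrow> 0) F \<Longrightarrow> adapted F (d ^ l) (\<lambda>n. hiter d (f n) l) M e \<Longrightarrow>
     \<exists>p\<in>seq_poly.spolys T (2 * d - 2). \<exists>q\<in>seq_poly.spolys T (2 * d - 2). \<exists>r. r \<noteq> 0 \<and> seq_poly.jump F e p q r"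
    using adapted_scales_jump[OF u assms(2)] assms(3) by blast
  interpret Q: seq_poly F T "2 * d - 2" by unfold_locales (rule u)
  have bound: "finite E \<and> card E \<le> 2 * d - 2"
    if E: "\<And>e. e \<in> E \<Longrightarrow> scale e" "\<And>e. e \<in> E \<Longrightarrow> scale_less F e one_scale"
      "\<And>e. e \<in> E \<Longrightarrow> \<exists>l M. adapted F (d ^ l) (\<lambda>n. hiter d (f n) l) M e"
      "\<And>e e'. e \<in> E \<Longrightarrow> e' \<in> E \<Longrightarrow> e \<noteq> e' \<Longrightarrow> \<not> scale_equiv F e e'" for E
  proof (rule finite_card_bounded)
    fix X assume X: "X \<subseteq> E" "finite X"
    have small: "(e \<longlongrightarrow> 0) F" if "e \<in> X" for e
      using E(2)[of e] X that scale_less_one[OF u] by blast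
    show "card X \<le> 2 * d - 2"
    proof (rule Q.card_jump_scales[OF X(2)])
      fix e assume e: "e \<in> X"
      obtain l M where "adapted F (d ^ l) (\<lambda>n. hiter d (f n) l) M e" using E(3) e X by blast
      then show "\<exists>p\<in>Q.spolys. \<exists>q\<in>Q.spolys. \<exists>l. l \<noteq> 0 \<and> Q.jump e p q l"
        using T[OF _ small[OF e]] E(1) e X by blast
    qed (use E(1,4) X small in \<open>blast+\<close>)
  qed
  \<comment> \<open>A scale that does not tend to 0 has a positive finite limit, by boundedness; so
    all of them represent the trivial scale, and a set of inequivalent scales contains at most one.
    This is the extra unit in 2d - 1.\<close>
  have triv: "e = e'" if e: "scale e" "\<not> scale_less F e one_scale" "scale e'" "\<not> scale_less F e' one_scale"
    and ne: "e \<noteq> e' \<Longrightarrow> \<not> scale_equiv F e e'" for e e'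
  proof (rule ccontr)
    assume "e \<noteq> e'"
    have lim: "\<exists>r>0. (x \<longlongrightarrow> r) F" if x: "scale x" "\<not> scale_less F x one_scale" for x
    proof -
      obtain B where B: "\<And>n. x n \<le> B" using x(1) by (auto simp: scale_def bdd_above_def)
      have pos: "0 < x n" for n using x(1) by (simp add: scale_def)
      have "eventually (\<lambda>n. \<bar>x n\<bar> \<le> B) F" using B pos by (simp add: abs_of_pos)
      then obtain r where r: "(x \<longlongrightarrow> r) F" using ultra_bounded_tendsto[OF u] by metis
      have "0 \<le> r" by (rule tendsto_lowerbound[OF r _ ultra_bot[OF u]]) (simp add: pos less_imp_le)
      moreover have "r \<noteq> 0" using x(2) r scale_less_one[OF u] by blast
      ultimately show ?thesis using r by (intro exI[of _ r]) simp
    qed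
    obtain r r' where r: "0 < r" "(e \<longlongrightarrow> r) F" "0 < r'" "(e' \<longlongrightarrow> r') F"
      using lim[OF e(1,2)] lim[OF e(3,4)] by blast
    then have "((\<lambda>n. e n / e' n) \<longlongrightarrow> r / r') F" by (intro tendsto_divide) auto
    then have "wlim F (\<lambda>n. e n / e' n) = ereal (r / r')" using wlim_eq_ereal[OF u] by blast
    then have "scale_equiv F e e'" using r by (simp add: scale_equiv_def)
    then show False using ne \<open>e \<noteq> e'\<close> by blast
  qed
  have bound2: "finite E \<and> card E \<le> 2 * d - 1"
    if E: "\<And>e. e \<in> E \<Longrightarrow> scale e" "\<And>e. e \<in> E \<Longrightarrow> \<exists>l M. adapted F (d ^ l) (\<lambda>n. hiter d (f n) l) M e"
      "\<And>e e'. e \<in> E \<Longrightarrow> e' \<in> E \<Longrightarrow> e \<noteq> e' \<Longrightarrow> \<not> scale_equiv F e e'" for E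
  proof -
    define E1 where "E1 = {e \<in> E. scale_less F e one_scale}"
    define E2 where "E2 = {e \<in> E. \<not> scale_less F e one_scale}"
    have b1: "finite E1 \<and> card E1 \<le> 2 * d - 2"
      by (rule bound) (use E in \<open>auto simp: E1_def\<close>)
    have "\<exists>x. E2 \<subseteq> {x}"
    proof (cases "E2 = {}")
      case False
      then obtain x where "x \<in> E2" by blast
      then have "E2 \<subseteq> {x}" using triv E unfolding E2_def by blast
      then show ?thesis by blast
    qed blast
    then obtain x where x: "E2 \<subseteq> {x}" by blast
    then have b2: "finite E2" "card E2 \<le> 1"
      using finite_subset[OF x] card_mono[OF _ x] by auto
    have "E = E1 \<union> E2" by (auto simp: E1_def E2_def)
    then have "finite E" "card E \<le> card E1 + card E2" using b1 b2 card_Un_le by auto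
    then show ?thesis using b1 b2 assms(2) by linarith
  qed
  show ?thesis
  proof (intro conjI allI impI)
    fix E
    assume *: "(\<forall>e\<in>E. scale e \<and> scale_less F e one_scale \<and>
                  (\<exists>l M. 1 \<le> l \<and> adapted F (d ^ l) (\<lambda>n. hiter d (f n) l) M e)) \<and>
              (\<forall>e\<in>E. \<forall>e'\<in>E. e \<noteq> e' \<longrightarrow> \<not> scale_equiv F e e')"
    have "finite E \<and> card E \<le> 2 * d - 2" by (rule bound) (use * in blast)+
    then show "finite E" "card E \<le> 2 * d - 2" by blast+
  next
    fix E
    assume *: "(\<forall>e\<in>E. scale e \<and>
                  (\<exists>l M. 1 \<le> l \<and> adapted F (d ^ l) (\<lambda>n. hiter d (f n) l) M e)) \<and>
              (\<forall>e\<in>E. \<forall>e'\<in>E. e \<noteq> e' \<longrightarrow> \<not> scale_equiv F e e')"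
    have "finite E \<and> card E \<le> 2 * d - 1" by (rule bound2) (use * in blast)+
    then show "finite E" "card E \<le> 2 * d - 1" by blast+
  qed
qed

end
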